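(* Let $n\in\mathbb N$, let $K=\mathbb Q(\zeta_n)$ be the $n$th cyclotomic field, $\mathcal O=\mathbb Z[\zeta_n]$ its ring of integers, $\mathfrak p\subset\mathcal O$ a nonzero prime ideal, and $G$ a finite abelian group. Let $p$ be the prime number with $p\mathbb Z=\mathfrak p\cap\mathbb Z$. Let $n_0$ be the maximal positive divisor of $n$ with $p\nmid n_0$, let $n_1$ be the maximal positive divisor of $\exp(G)$ with $p\nmid n_1$ and $\gcd(n_1,n_0)=1$, and let $m'$ be the maximal positive divisor of $\frac{\operatorname{lcm}(\exp(G),n_0)}{n_0n_1}$ with $p\nmid m'$. Then the group ring $\mathcal O_{\mathfrak p}[G]$ is clean if and only if $$\operatorname{ord}_{n_1}p=\varphi(n_1),\qquad \operatorname{ord}_{n_0m'}p=m'\operatorname{ord}_{n_0}p,\qquad\text{and}\qquad \gcd(\operatorname{ord}_{n_1}p,\operatorname{ord}_{n_0m'}p)=1.$$ In particular, if $\exp(G)$ is a divisor of $n$, then $\mathcal O_{\mathfrak p}[G]$ is clean.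
   Context: A ring (associative, with $1\neq 0$) is clean if each of its elements is the sum of a unit and an idempotent. $\mathbb N$ is the set of positive integers, and $\zeta_n$ is a primitive $n$th root of unity over $\mathbb Q$. $\mathcal O_{\mathfrak p}$ denotes the localization of $\mathcal O$ at the prime ideal $\mathfrak p$, and $\mathcal O_{\mathfrak p}[G]$ is the group ring of $G$ over $\mathcal O_{\mathfrak p}$. $\exp(G)$ is the exponent of $G$, $\varphi$ is Euler's function, and for $\gcd(m,k)=1$, $\operatorname{ord}_k m$ is the multiplicative order of $m$ modulo $k$ (so $\operatorname{ord}_1 m=1$). *)

theory Defs
  imports
    "HOL-Algebra.Algebra"
    "HOL-Algebra.Algebraic_Closure_Type"
    "HOL-Number_Theory.Number_Theory"
begin

locale clean_ring = ring +
  assumes one_not_zero: "\<one> \<noteq> \<zero>"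
    and clean: "a \<in> carrier R \<Longrightarrow>
      \<exists>u\<in>Units R. \<exists>e\<in>carrier R. e \<otimes> e = e \<and> a = u \<oplus> e"

definition primitive_root_of_unity :: "nat \<Rightarrow> 'a::monoid_mult \<Rightarrow> bool"
  where "primitive_root_of_unity n z \<longleftrightarrow>
    0 < n \<and> z ^ n = 1 \<and> (\<forall>k. 0 < k \<and> k < n \<longrightarrow> z ^ k \<noteq> 1)"

text \<open>\<open>\<rat>(z)\<close> and \<open>\<int>[z]\<close> as substructures of the complex numbers. The generated subring
  and subfield contain the unit element, hence \<open>\<int>\<close> and \<open>\<rat>\<close> respectively.\<close>

definition rat_adjoin :: "complex \<Rightarrow> complex ring"
  where "rat_adjoin z =
    ring_of_type_algebra\<lparr>carrier := generate_field ring_of_type_algebra {z}\<rparr>"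

definition int_adjoin :: "complex \<Rightarrow> complex ring"
  where "int_adjoin z =
    ring_of_type_algebra\<lparr>carrier := generate_ring ring_of_type_algebra {z}\<rparr>"

text \<open>For a subring \<open>A\<close> of a field \<open>K\<close> and a prime ideal \<open>P\<close> of \<open>A\<close>, the localization \<open>A\<^sub>P\<close>
  realized inside \<open>K\<close> as the ring of fractions \<open>a / s\<close> with \<open>a \<in> A\<close> and \<open>s \<in> A - P\<close>.\<close>

definition localization_in :: "('a, 'b) ring_scheme \<Rightarrow> 'a set \<Rightarrow> 'a set \<Rightarrow> ('a, 'b) ring_scheme"
  where "localization_in K A P =
    K\<lparr>carrier := {a \<otimes>\<^bsub>K\<^esub> inv\<^bsub>K\<^esub> s | a s. a \<in> A \<and> s \<in> A - P}\<rparr>"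

text \<open>The element \<open>\<Sum>g. f g \<cdot> g\<close> of the group ring is represented by its finitely supported
  coefficient function \<open>f\<close>, taken to be \<open>undefined\<close> outside \<open>carrier G\<close> so that equality of
  elements is equality of functions. Multiplication is convolution; the sum runs over the
  support of the first factor because \<open>finsum\<close> is only meaningful over finite index sets.\<close>

definition group_ring ::
    "('r, 'c) ring_scheme \<Rightarrow> ('g, 'd) monoid_scheme \<Rightarrow> ('g \<Rightarrow> 'r) ring"
  where "group_ring R G =
    \<lparr>carrier = {f \<in> carrier G \<rightarrow>\<^sub>E carrier R. finite {g \<in> carrier G. f g \<noteq> \<zero>\<^bsub>R\<^esub>}},
     monoid.mult = (\<lambda>f f'. \<lambda>x\<in>carrier G.
       \<Oplus>\<^bsub>R\<^esub>y\<in>{g \<in> carrier G. f g \<noteq> \<zero>\<^bsub>R\<^esub>}. f y \<otimes>\<^bsub>R\<^esub> f' (inv\<^bsub>G\<^esub> y \<otimes>\<^bsub>G\<^esub> x)),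
     one = (\<lambda>x\<in>carrier G. if x = \<one>\<^bsub>G\<^esub> then \<one>\<^bsub>R\<^esub> else \<zero>\<^bsub>R\<^esub>),
     ring.zero = (\<lambda>x\<in>carrier G. \<zero>\<^bsub>R\<^esub>),
     add = (\<lambda>f f'. \<lambda>x\<in>carrier G. f x \<oplus>\<^bsub>R\<^esub> f' x)\<rparr>"

text \<open>Intended for groups of finite exponent, e.g. finite groups.\<close>

definition group_exponent :: "('g, 'd) monoid_scheme \<Rightarrow> nat"
  where "group_exponent G = (LEAST e. 0 < e \<and> (\<forall>x\<in>carrier G. x [^]\<^bsub>G\<^esub> e = \<one>\<^bsub>G\<^esub>))"

end

theory Submission
  imports Defs "Jordan_Normal_Form.Char_Poly"
begin

text \<open>
  Let \<open>L = lcm n (exp G) = p\<^sup>k N\<close> with \<open>p\<close> not dividing \<open>N\<close>. Both sides of the equivalence say that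
  every \<open>a\<close> prime to \<open>N\<close> with \<open>a = 1\<close> modulo \<open>n\<^sub>0\<close> is a power of \<open>p\<close> modulo \<open>N\<close>, that is, that
  only one prime of \<open>\<rat>(\<zeta>\<^sub>L)\<close> lies over \<open>P\<close>. For the three order conditions this is a count, as
  there are \<open>m' \<phi>(n\<^sub>1)\<close> such residues.

  If the group ring is clean, its image under a character of order \<open>exp G\<close> is the localization of
  \<open>\<int>[\<zeta>\<^sub>L]\<close> at the complement of \<open>P\<close>. It is a clean domain, so its nonunits form an ideal, which
  is therefore stable under all automorphisms \<open>\<zeta>\<^sub>L \<mapsto> \<zeta>\<^sub>L\<^sup>a\<close>. Sums of roots of unity over the
  orbits of \<open>p\<close> are rational integers modulo this ideal, hence unchanged by the automorphisms, and a
  Vandermonde argument shows that \<open>a\<close> is a power of \<open>p\<close>.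

  Conversely, let \<open>Q\<close> be a prime of \<open>\<int>[\<zeta>\<^sub>L]\<close> over \<open>P\<close> and \<open>f\<close> an element of the group ring. The
  set \<open>T\<close> of the characters whose value at \<open>f\<close> vanishes modulo \<open>Q\<close> is closed under the residue field
  Frobenius, hence under all the powers \<open>a\<close> above. So the idempotent \<open>e\<close> of the complex group
  algebra that is \<open>1\<close> on \<open>T\<close> and \<open>0\<close> elsewhere has its coefficients in the localization, and
  \<open>f - e\<close> is a unit because none of its character values vanishes modulo \<open>Q\<close>.
\<close>

section \<open>Subrings and prime ideals of a commutative ring type\<close>

text \<open>What shapes the converse is that \<open>p\<close> may divide the order of
  \<open>G\<close> and the degrees of the cyclotomic fields. Frobenius congruences show that
  membership in \<open>T\<close> depends only on the restriction of a character to the subgroup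
  \<open>H\<close> of elements of order prime to \<open>p\<close>. So \<open>e\<close> is supported
  on \<open>H\<close>, its only explicit denominator \<open>card H\<close> is prime to
  \<open>p\<close>, and its coefficients come down to the localization by a trace form that is
  nondegenerate modulo \<open>Q\<close>, not by averaging over conjugates. Nonvanishing modulo
  \<open>Q\<close> suffices for a unit because multiplication by an element of the group ring has
  the product of its character values as determinant, and the adjugate supplies the inverse. In the
  other direction, an idempotent has value 0 or 1 under each character, so in the image one of
  \<open>y\<close> and \<open>y - 1\<close> is always a unit. Residue rings are replaced by
  congruences modulo an ideal, and an automorphism is the replacement of \<open>w\<close> by
  \<open>w ^ a\<close> in integer polynomial relations. Only the part \<open>N\<close> of
  \<open>L\<close> prime to \<open>p\<close> survives, since roots of unity of
  \<open>p\<close>-power order are congruent to 1 modulo \<open>Q\<close>.\<close>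

locale unital_subring =
  fixes W :: "'a::comm_ring_1 set"
  assumes one_mem [simp, intro]: "1 \<in> W"
    and diff_mem [intro]: "x \<in> W \<Longrightarrow> y \<in> W \<Longrightarrow> x - y \<in> W"
    and mult_mem [intro]: "x \<in> W \<Longrightarrow> y \<in> W \<Longrightarrow> x * y \<in> W"
begin

lemma zero_mem [simp, intro]: "0 \<in> W"
  using diff_mem[OF one_mem one_mem] by simp

lemma uminus_mem [intro]: "x \<in> W \<Longrightarrow> - x \<in> W"
  using diff_mem[OF zero_mem] by fastforce

lemma add_mem [intro]: "x \<in> W \<Longrightarrow> y \<in> W \<Longrightarrow> x + y \<in> W"
  using diff_mem[of x "- y"] uminus_mem by simp

lemma power_mem [intro]: "x \<in> W \<Longrightarrow> x ^ k \<in> W"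
  by (induction k) auto

lemma sum_mem [intro]: "(\<And>i. i \<in> A \<Longrightarrow> f i \<in> W) \<Longrightarrow> sum f A \<in> W"
  by (induction A rule: infinite_finite_induct) auto

lemma prod_mem [intro]: "(\<And>i. i \<in> A \<Longrightarrow> f i \<in> W) \<Longrightarrow> prod f A \<in> W"
  by (induction A rule: infinite_finite_induct) auto

lemma of_nat_mem [simp, intro]: "of_nat k \<in> W"
  by (induction k) auto

lemma of_int_mem [simp, intro]: "of_int k \<in> W"
  by (cases k) (auto simp: uminus_mem simp del: of_nat_Suc)

lemma poly_mem: "(\<And>i. coeff f i \<in> W) \<Longrightarrow> x \<in> W \<Longrightarrow> poly f x \<in> W"
  unfolding poly_altdef by auto

end

locale ideal_of = unital_subring W for W :: "'a::comm_ring_1 set" +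
  fixes Q :: "'a set"
  assumes sub: "Q \<subseteq> W"
    and zero_in [simp, intro]: "0 \<in> Q"
    and diff_in [intro]: "x \<in> Q \<Longrightarrow> y \<in> Q \<Longrightarrow> x - y \<in> Q"
    and mult_in [intro]: "x \<in> W \<Longrightarrow> y \<in> Q \<Longrightarrow> x * y \<in> Q"
begin

lemma uminus_in [intro]: "x \<in> Q \<Longrightarrow> - x \<in> Q"
  using diff_in[OF zero_in] by fastforce

lemma add_in [intro]: "x \<in> Q \<Longrightarrow> y \<in> Q \<Longrightarrow> x + y \<in> Q"
  using diff_in[of x "- y"] uminus_in by simp

lemma mult_in' [intro]: "x \<in> Q \<Longrightarrow> y \<in> W \<Longrightarrow> x * y \<in> Q"
  using mult_in[of y x] by (simp add: mult.commute)

lemma sum_in [intro]: "(\<And>i. i \<in> A \<Longrightarrow> f i \<in> Q) \<Longrightarrow> sum f A \<in> Q"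
  by (induction A rule: infinite_finite_induct) auto

lemma diff_trans: "x - y \<in> Q \<Longrightarrow> y - z \<in> Q \<Longrightarrow> x - z \<in> Q"
  using add_in[of "x - y" "y - z"] by simp

lemma diff_sym: "x - y \<in> Q \<Longrightarrow> y - x \<in> Q"
  using uminus_in[of "x - y"] by simp

lemma diff_mem_iff: "x - y \<in> Q \<Longrightarrow> x \<in> Q \<longleftrightarrow> y \<in> Q"
  using diff_in[of x "x - y"] add_in[of "x - y" y] by auto

lemma diff_power: "x \<in> W \<Longrightarrow> y \<in> W \<Longrightarrow> x - y \<in> Q \<Longrightarrow> x ^ k - y ^ k \<in> Q"
proof (induction k)
  case (Suc k)
  have "x ^ Suc k - y ^ Suc k = x * (x ^ k - y ^ k) + (x - y) * y ^ k"
    by (simp add: algebra_simps)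
  also have "\<dots> \<in> Q" using Suc by auto
  finally show ?case .
qed auto

lemma diff_mult:
  "x \<in> W \<Longrightarrow> y' \<in> W \<Longrightarrow> x - x' \<in> Q \<Longrightarrow> y - y' \<in> Q \<Longrightarrow> x * y - x' * y' \<in> Q"
  using add_in[of "x * (y - y')" "(x - x') * y'"] mult_in[of x "y - y'"] mult_in'[of "x - x'" y']
  by (simp add: algebra_simps)

lemma power_in_ideal: "x \<in> Q \<Longrightarrow> 0 < k \<Longrightarrow> x ^ k \<in> Q"
  using sub by (cases k) (auto intro: mult_in' power_mem)

lemma diff_sum: "(\<And>i. i \<in> A \<Longrightarrow> f i - g i \<in> Q) \<Longrightarrow> sum f A - sum g A \<in> Q"
  by (subst sum_subtractf[symmetric]) auto

lemma of_int_power_prime: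
  assumes p: "Factorial_Ring.prime p" and pQ: "of_nat p \<in> Q"
  shows "of_int c ^ p - of_int c \<in> Q"
proof -
  have p1: "p > 1" using p prime_gt_1_nat by blast
  define i where "i = nat (c mod int p)"
  have ci: "[c = int i] (mod int p)" using p1 by (simp add: i_def cong_def)
  have "[i ^ p = i] (mod p)"
  proof (cases "p dvd i")
    case True
    then show ?thesis using p1
      by (auto simp: cong_def simp flip: dvd_eq_mod_eq_0 intro: dvd_trans[OF _ dvd_power])
  next
    case False
    then have "[i ^ (p - 1) = 1] (mod p)" using p by (rule fermat_theorem[rotated])
    then have "[i ^ (p - 1) * i = 1 * i] (mod p)" by (rule cong_scalar_right)
    moreover have "i ^ (p - 1) * i = i ^ p" using p1
      by (metis Suc_diff_1 not_less_zero power_Suc2 gr0I)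
    ultimately show ?thesis by simp
  qed
  then have "[int (i ^ p) = int i] (mod int p)" by (simp only: cong_int_iff)
  then have "[c ^ p = c] (mod int p)" using ci by (metis cong_pow cong_sym cong_trans of_nat_power)
  then obtain m where "c ^ p - c = int p * m" by (auto simp: cong_iff_dvd_diff)
  then have "(of_int (c ^ p - c) :: 'a) = of_int (int p * m)" by simp
  then have "of_int c ^ p - (of_int c :: 'a) = of_nat p * of_int m" by simp
  then show ?thesis using pQ by auto
qed

lemma of_nat_power_prime:
  assumes "Factorial_Ring.prime p" "of_nat p \<in> Q"
  shows "of_nat i ^ p - of_nat i \<in> Q"
  using of_int_power_prime[OF assms, of "int i"] by simp

text \<open>The binomial coefficients strictly between the ends are multiples of \<open>p\<close>,
  which lies in \<open>Q\<close>. This is the Frobenius endomorphism of the quotient by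
  \<open>Q\<close>, written as a congruence. It holds for every ideal containing \<open>p\<close>;
  \<open>root_conjugate_prime\<close> applies it to a principal one.\<close>

lemma frobenius_sum:
  assumes p: "Factorial_Ring.prime p" and pQ: "of_nat p \<in> Q"
    and "\<And>i. i \<in> A \<Longrightarrow> f i \<in> W"
  shows "(\<Sum>i\<in>A. f i) ^ p ^ k - (\<Sum>i\<in>A. f i ^ p ^ k) \<in> Q"
proof -
  have one: "(x + y) ^ p - (x ^ p + y ^ p) \<in> Q" if "x \<in> W" "y \<in> W" for x y
  proof -
    have p1: "p > 1" using p prime_gt_1_nat by blast
    have "(x + y) ^ p = (\<Sum>k\<le>p. of_nat (p choose k) * x ^ k * y ^ (p - k))"
      by (rule binomial_ring)
    also have "{..p} = insert 0 (insert p {0<..<p})" by auto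
    also have "(\<Sum>k\<in>\<dots>. of_nat (p choose k) * x ^ k * y ^ (p - k)) =
      y ^ p + (x ^ p + (\<Sum>k\<in>{0<..<p}. of_nat (p choose k) * x ^ k * y ^ (p - k)))"
      using p1 by (subst sum.insert; simp)
    finally have "(x + y) ^ p - (x ^ p + y ^ p) =
      (\<Sum>k\<in>{0<..<p}. of_nat (p choose k) * x ^ k * y ^ (p - k))" by (simp add: algebra_simps)
    also have "\<dots> \<in> Q"
    proof (rule sum_in)
      fix k assume "k \<in> {0<..<p}"
      then have "p dvd (p choose k)" using p by (intro dvd_choose_prime) auto
      then obtain m where "p choose k = p * m" by blast
      then have "of_nat (p choose k) * x ^ k * y ^ (p - k) = of_nat p * (of_nat m * x ^ k * y ^ (p - k))"
        by (simp add: mult_ac)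
      then show "of_nat (p choose k) * x ^ k * y ^ (p - k) \<in> Q" using pQ that by auto
    qed
    finally show ?thesis .
  qed
  have base: "(\<Sum>i\<in>A. f i) ^ p - (\<Sum>i\<in>A. f i ^ p) \<in> Q" if "\<And>i. i \<in> A \<Longrightarrow> f i \<in> W" for f A
    using that
  proof (induction A rule: infinite_finite_induct)
    case (insert a A)
    have "(f a + sum f A) ^ p - (f a ^ p + sum f A ^ p) \<in> Q"
      using insert by (intro one) auto
    moreover have "(f a ^ p + sum f A ^ p) - (f a ^ p + (\<Sum>i\<in>A. f i ^ p)) \<in> Q"
      using insert by simp
    ultimately show ?case using insert by (simp add: diff_trans)
  qed (use p prime_gt_0_nat in \<open>auto simp: zero_power\<close>)
  show ?thesis
  proof (induction k)
    case (Suc k)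
    have "((\<Sum>i\<in>A. f i) ^ p ^ k) ^ p - (\<Sum>i\<in>A. f i ^ p ^ k) ^ p \<in> Q"
      using assms(3) Suc by (intro diff_power) auto
    moreover have "(\<Sum>i\<in>A. f i ^ p ^ k) ^ p - (\<Sum>i\<in>A. (f i ^ p ^ k) ^ p) \<in> Q"
      using assms(3) by (intro base) auto
    ultimately have "((\<Sum>i\<in>A. f i) ^ p ^ k) ^ p - (\<Sum>i\<in>A. (f i ^ p ^ k) ^ p) \<in> Q"
      by (rule diff_trans)
    then show ?case by (simp add: mult.commute flip: power_mult)
  qed simp
qed

end

locale prime_ideal_of = ideal_of +
  assumes one_notin [simp]: "1 \<notin> Q"
    and prime_in: "x \<in> W \<Longrightarrow> y \<in> W \<Longrightarrow> x * y \<in> Q \<Longrightarrow> x \<in> Q \<or> y \<in> Q"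
begin

lemma power_in: "x \<in> W \<Longrightarrow> x ^ k \<in> Q \<Longrightarrow> x \<in> Q"
  by (induction k) (use prime_in in auto)

lemma prod_in_imp:
  "finite A \<Longrightarrow> (\<And>i. i \<in> A \<Longrightarrow> f i \<in> W) \<Longrightarrow> prod f A \<in> Q \<Longrightarrow> \<exists>i\<in>A. f i \<in> Q"
proof (induction A rule: finite_induct)
  case (insert a A)
  have "f a \<in> Q \<or> prod f A \<in> Q"
    using insert by (intro prime_in) auto
  then show ?case using insert by auto
qed auto

lemma coprime_of_nat_notin:
  assumes "of_nat p \<in> Q" "coprime p k"
  shows "of_nat k \<notin> Q"
proof
  assume k: "of_nat k \<in> Q"
  obtain a b :: int where "a * int p + b * int k = 1"
    using assms(2) by (metis bezout_int coprime_int_iff coprime_imp_gcd_eq_1)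
  then have "(of_int (a * int p + b * int k) :: 'a) = 1" by simp
  then have "of_int a * of_nat p + of_int b * of_nat k = (1 :: 'a)" by simp
  moreover have "of_int a * of_nat p + of_int b * of_nat k \<in> Q"
    using assms k by auto
  ultimately show False by simp
qed

text \<open>The multipliers \<open>\<Prod>z\<in>Z. y - z\<close> with \<open>Z\<close> the set of the other nodes isolate a single
  coefficient, a determinant-free form of the invertibility of Vandermonde matrices.\<close>

lemma vandermonde_mod:
  assumes fin: "finite Y" and YW: "Y \<subseteq> W"
    and dist: "\<And>x y. x \<in> Y \<Longrightarrow> y \<in> Y \<Longrightarrow> x \<noteq> y \<Longrightarrow> x - y \<notin> Q"
    and cW: "\<And>y. y \<in> Y \<Longrightarrow> c y \<in> W"
    and sums: "\<And>j. (\<Sum>y\<in>Y. c y * y ^ j) \<in> Q"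
    and y0: "y0 \<in> Y"
  shows "c y0 \<in> Q"
proof -
  have gen: "(\<Sum>y\<in>Y. c y * y ^ j * (\<Prod>z\<in>Z. y - z)) \<in> Q" if "finite Z" "Z \<subseteq> W" for Z j
    using that
  proof (induction Z arbitrary: j rule: finite_induct)
    case empty
    then show ?case using sums by simp
  next
    case (insert a Z)
    have "(\<Sum>y\<in>Y. c y * y ^ j * (\<Prod>z\<in>insert a Z. y - z)) =
      (\<Sum>y\<in>Y. c y * y ^ Suc j * (\<Prod>z\<in>Z. y - z)) - a * (\<Sum>y\<in>Y. c y * y ^ j * (\<Prod>z\<in>Z. y - z))"
      using insert(1,2) by (simp add: sum_distrib_left flip: sum_subtractf) (simp add: algebra_simps)
    also have "\<dots> \<in> Q" using insert.IH[of j] insert.IH[of "Suc j"] insert.prems by (intro diff_in mult_in) auto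
    finally show ?case .
  qed
  let ?Z = "Y - {y0}"
  have "(\<Sum>y\<in>Y. c y * y ^ 0 * (\<Prod>z\<in>?Z. y - z)) = c y0 * (\<Prod>z\<in>?Z. y0 - z)"
  proof (subst sum.remove[OF fin y0])
    have "(\<Prod>z\<in>?Z. y - z) = 0" if "y \<in> ?Z" for y
      using that fin by (intro prod_zero) auto
    then have "(\<Sum>y\<in>?Z. c y * y ^ 0 * (\<Prod>z\<in>?Z. y - z)) = 0"
      by (intro sum.neutral ballI) simp
    then show "c y0 * y0 ^ 0 * (\<Prod>z\<in>?Z. y0 - z) + (\<Sum>y\<in>?Z. c y * y ^ 0 * (\<Prod>z\<in>?Z. y - z))
      = c y0 * (\<Prod>z\<in>?Z. y0 - z)" by simp
  qed
  then have "c y0 * (\<Prod>z\<in>?Z. y0 - z) \<in> Q"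
    using gen[of ?Z 0] fin YW by auto
  then have "c y0 \<in> Q \<or> (\<Prod>z\<in>?Z. y0 - z) \<in> Q"
    using YW cW[OF y0] y0 by (intro prime_in) auto
  moreover have "(\<Prod>z\<in>?Z. y0 - z) \<notin> Q"
  proof
    assume "(\<Prod>z\<in>?Z. y0 - z) \<in> Q"
    then obtain z where "z \<in> ?Z" "y0 - z \<in> Q"
      using prod_in_imp[of ?Z "\<lambda>z. y0 - z"] fin YW y0 by auto
    then show False using dist y0 by auto
  qed
  ultimately show ?thesis by blast
qed

text \<open>The usual induction over a domain, with equality replaced by congruence modulo the prime
  \<open>Q\<close>: split off the factor belonging to one root and cancel it at all others. Being
  monic keeps the polynomial nonzero modulo \<open>Q\<close>.\<close>

lemma card_roots_mod_le_degree:
  assumes "finite Z" "Z \<subseteq> W"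
    and "\<And>x y. x \<in> Z \<Longrightarrow> y \<in> Z \<Longrightarrow> x \<noteq> y \<Longrightarrow> x - y \<notin> Q"
    and "\<And>i. coeff f i \<in> W" "lead_coeff f = 1"
    and "\<And>z. z \<in> Z \<Longrightarrow> poly f z \<in> Q"
  shows "card Z \<le> degree f"
  using assms
proof (induction "degree f" arbitrary: f Z)
  case 0
  then have "f = 1" by (metis degree_eq_zeroE lead_coeff_pCons(2) one_pCons pCons_0_0 coeff_pCons_0)
  then have "Z = {}" using 0 by auto
  then show ?case by simp
next
  case (Suc d)
  show ?case
  proof (cases "Z = {}")
    case False
    then obtain z0 where z0: "z0 \<in> Z" by auto
    define g where "g = synthetic_div f z0"
    \<comment> \<open>The division leaves the remainder \<open>poly f z0\<close>, which lies in
      \<open>Q\<close> but may be nonzero.\<close>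
    have fg: "f = pCons (- 0) 0 + ([:-z0, 1:] * g) + [:poly f z0:]"
      using synthetic_div_correct'[of z0 f] by (simp add: g_def)
    have dg: "degree g = d"
      using Suc(2) by (simp add: g_def degree_synthetic_div)
    have dfg: "degree f = Suc d" using Suc(2) by simp
    have cf: "coeff f (Suc i) = coeff g i - z0 * coeff g (Suc i)" for i
      by (subst fg) (simp add: coeff_pCons)
    have lg: "lead_coeff g = 1"
    proof -
      have "coeff g (Suc d) = 0" using dg by (simp add: coeff_eq_0)
      then show ?thesis using cf[of d] Suc.prems(5) dg dfg by simp
    qed
    \<comment> \<open>Descending induction: every coefficient of the quotient is obtained from the
      next higher one, starting with the vanishing coefficient of index
      \<open>Suc d\<close>.\<close>
    have cg: "coeff g i \<in> W" for i
    proof (cases "i \<le> Suc d")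
      case True
      then show ?thesis
      proof (induction i rule: inc_induct)
        case base
        then show ?case using dg by (simp add: coeff_eq_0)
      next
        case (step i)
        have "coeff g i = coeff f (Suc i) + z0 * coeff g (Suc i)" using cf[of i] by simp
        moreover have "coeff f (Suc i) \<in> W" "z0 \<in> W" using Suc.prems(2,4) z0 by auto
        ultimately show ?case using step by auto
      qed
    qed (use dg in \<open>simp add: coeff_eq_0\<close>)
    have "card (Z - {z0}) \<le> degree g"
    proof (rule Suc.hyps(1))
      show "d = degree g" using dg by simp
      fix z assume z: "z \<in> Z - {z0}"
      have "poly f z - poly f z0 = (z - z0) * poly g z"
        by (subst (1) fg) (simp add: algebra_simps)
      moreover have "poly f z - poly f z0 \<in> Q" using Suc.prems(6) z z0 by auto
      ultimately have "(z - z0) * poly g z \<in> Q" by simp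
      then have "z - z0 \<in> Q \<or> poly g z \<in> Q"
        using z z0 Suc.prems(2) cg by (intro prime_in) (auto intro: poly_mem)
      then show "poly g z \<in> Q" using Suc.prems(3)[of z z0] z z0 by auto
    qed (use Suc.prems cg lg in auto)
    then show ?thesis using z0 Suc.prems(1) dg dfg by simp
  qed simp
qed

text \<open>\<open>X^p - X\<close> already has the \<open>p\<close> pairwise incongruent roots
  \<open>0, ..., p - 1\<close> modulo \<open>Q\<close>, so a root incongruent to all of them would
  be one too many.\<close>

lemma prime_power_fixed_imp_integer:
  assumes p: "Factorial_Ring.prime p" and pQ: "of_nat p \<in> Q" and x: "x \<in> W" "x ^ p - x \<in> Q"
  shows "\<exists>k::nat. x - of_nat k \<in> Q"
proof (rule ccontr)
  assume neg: "\<not> ?thesis"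
  define f :: "'a poly" where "f = Polynomial.monom 1 p - Polynomial.monom 1 1"
  have p1: "p > 1" using p prime_gt_1_nat by blast
  have natdist: "of_nat i - (of_nat j :: 'a) \<notin> Q" if "i < p" "j < p" "i \<noteq> j" for i j :: nat
  proof -
    have *: "of_nat i - (of_nat j :: 'a) \<notin> Q" if "j < i" "i < p" for i j
    proof -
      have "\<not> p dvd (i - j)" using that by (auto dest: dvd_imp_le)
      then have "coprime p (i - j)" using p prime_imp_coprime_nat by blast
      from coprime_of_nat_notin[OF pQ this] show ?thesis using that by (simp add: of_nat_diff)
    qed
    show ?thesis using *[of i j] *[of j i] that diff_sym by (cases "j < i") auto
  qed
  have notin: "x - of_nat i \<notin> Q" "of_nat i - x \<notin> Q" for i using neg diff_sym by blast+
  let ?N = "of_nat ` {..<p} :: 'a set"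
  have inj: "inj_on (of_nat :: nat \<Rightarrow> 'a) {..<p}"
    using natdist by (intro inj_onI) (metis cancel_comm_monoid_add_class.diff_cancel lessThan_iff zero_in)
  have xN: "x \<notin> ?N" using notin by (metis cancel_comm_monoid_add_class.diff_cancel imageE zero_in)
  have deg: "degree f = p" "lead_coeff f = 1"
  proof -
    show "degree f = p" unfolding f_def using p1
      using degree_add_eq_left[of "- Polynomial.monom 1 1" "Polynomial.monom (1::'a) p"]
      by (simp add: degree_monom_eq)
    then show "lead_coeff f = 1" using p1 by (simp add: f_def)
  qed
  have "card (insert x ?N) \<le> degree f"
  proof (rule card_roots_mod_le_degree)
    fix u v assume "u \<in> insert x ?N" "v \<in> insert x ?N" "u \<noteq> v"
    then show "u - v \<notin> Q" using notin natdist by auto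
  next
    fix z assume "z \<in> insert x ?N"
    then consider "z = x" | i where "z = of_nat i" by auto
    then show "poly f z \<in> Q"
    proof cases
      case 1
      then show ?thesis using x by (simp add: f_def poly_monom)
    next
      case (2 i)
      then show ?thesis using of_nat_power_prime[OF p pQ, of i] by (simp add: f_def poly_monom)
    qed
  qed (use x deg in \<open>auto simp: f_def\<close>)
  then show False using deg xN inj by (simp add: card_image)
qed

end

section \<open>Determinants\<close>

text \<open>The eigenvalue is a root of the characteristic polynomial of an integer matrix, which is
  monic with integer coefficients.\<close>

lemma algebraic_int_if_integral_eigenvector:
  fixes w :: complex and v :: "nat \<Rightarrow> complex" and c :: "nat \<Rightarrow> nat \<Rightarrow> int"
  assumes eq: "\<And>i. i < n \<Longrightarrow> w * v i = (\<Sum>j<n. of_int (c i j) * v j)"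
    and nz: "i0 < n" "v i0 \<noteq> 0"
  shows "algebraic_int w"
proof -
  define A where "A = mat n n (\<lambda>(i, j). c i j)"
  have A: "A \<in> carrier_mat n n" by (simp add: A_def)
  let ?A = "map_mat of_int A :: complex mat"
  have A': "?A \<in> carrier_mat n n" using A by simp
  have "eigenvector ?A (vec n v) w"
    unfolding eigenvector_def
  proof (intro conjI)
    show "vec n v \<in> carrier_vec (dim_row ?A)" using A by simp
    show "vec n v \<noteq> 0\<^sub>v (dim_row ?A)"
      using nz A by (metis carrier_matD(1) index_map_mat(2) index_vec index_zero_vec(1))
    show "?A *\<^sub>v vec n v = w \<cdot>\<^sub>v vec n v"
      by (rule eq_vecI) (auto simp: A_def scalar_prod_def eq lessThan_atLeast0)
  qed
  then have "eigenvalue ?A w" unfolding eigenvalue_def by blast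
  then have "poly (char_poly ?A) w = 0" using eigenvalue_root_char_poly[OF A'] by simp
  then have "poly (map_poly of_int (char_poly A)) w = 0"
    by (simp add: of_int_hom.char_poly_hom[OF A])
  moreover have "lead_coeff (char_poly A) = 1" using degree_monic_char_poly[OF A] by simp
  ultimately show ?thesis unfolding algebraic_int_altdef_ipoly by blast
qed

context unital_subring
begin

lemma det_mem:
  assumes "A \<in> carrier_mat n n" "\<And>i j. i < n \<Longrightarrow> j < n \<Longrightarrow> A $$ (i, j) \<in> W"
  shows "det A \<in> W"
proof -
  have "signof \<pi> * (\<Prod>i = 0..<n. A $$ (i, \<pi> i)) \<in> W" if "\<pi> permutes {0..<n}" for \<pi> :: "nat \<Rightarrow> nat"
    using that assms(2) by (intro mult_mem prod_mem) (auto simp: sign_def permutes_in_image[of \<pi> "{0..<n}"] uminus_mem dest: permutes_in_image)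
  then show ?thesis unfolding det_def'[OF assms(1)] by (intro sum_mem) auto
qed

lemma cofactor_mem:
  assumes "A \<in> carrier_mat n n" "\<And>i j. i < n \<Longrightarrow> j < n \<Longrightarrow> A $$ (i, j) \<in> W" "i < n" "j < n"
  shows "cofactor A i j \<in> W"
proof -
  have "det (mat_delete A i j) \<in> W"
  proof (rule det_mem)
    show "mat_delete A i j \<in> carrier_mat (n - 1) (n - 1)"
      using assms by (intro mat_delete_carrier) auto
    fix k l assume "k < n - 1" "l < n - 1"
    then show "mat_delete A i j $$ (k, l) \<in> W"
      using assms by (auto simp: mat_delete_def)
  qed
  then show ?thesis unfolding cofactor_def by (intro mult_mem power_mem uminus_mem) auto
qed

end

text \<open>The columns \<open>F _ x\<close> form an eigenbasis of \<open>M\<close>, with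
  \<open>F'\<close> its inverse up to the factor \<open>c\<close>. Hence \<open>det M\<close> is the
  product of the \<open>d x\<close>, and the adjugate, whose entries are signed minors and thus in
  \<open>W\<close>, gives \<open>B\<close>. The eigenvectors themselves may lie outside
  \<open>W\<close>. Applied to convolution by an element of a group ring.\<close>

lemma diagonalizable_adjugate:
  fixes W :: "'a::idom set" and M :: "'i \<Rightarrow> 'i \<Rightarrow> 'a" and F :: "'i \<Rightarrow> 'x \<Rightarrow> 'a"
  assumes W: "unital_subring W"
    and fin: "finite I" "finite S" "card I = card S"
    and M: "\<And>i j. i \<in> I \<Longrightarrow> j \<in> I \<Longrightarrow> M i j \<in> W"
    and eig: "\<And>i x. i \<in> I \<Longrightarrow> x \<in> S \<Longrightarrow> (\<Sum>j\<in>I. M i j * F j x) = d x * F i x"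
    and inv: "\<And>x y. x \<in> S \<Longrightarrow> y \<in> S \<Longrightarrow> (\<Sum>i\<in>I. F' x i * F i y) = (if x = y then c else 0)"
    and c: "c \<noteq> 0"
  shows "(\<Prod>x\<in>S. d x) \<in> W"
    and "\<exists>B. (\<forall>i\<in>I. \<forall>j\<in>I. B i j \<in> W) \<and>
      (\<forall>i\<in>I. \<forall>k\<in>I. (\<Sum>j\<in>I. M i j * B j k) = (if i = k then \<Prod>x\<in>S. d x else 0))"
proof -
  interpret unital_subring W by fact
  define n where "n = card I"
  obtain e where e: "bij_betw e {0..<n} I" using ex_bij_betw_nat_finite[OF fin(1)] n_def by auto
  obtain f where f: "bij_betw f {0..<n} S" using ex_bij_betw_nat_finite[OF fin(2)] n_def fin(3) by auto
  have eI: "i < n \<Longrightarrow> e i \<in> I" for i using e by (auto simp: bij_betw_def)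
  have fX: "i < n \<Longrightarrow> f i \<in> S" for i using f by (auto simp: bij_betw_def)
  have sumI: "(\<Sum>j\<in>{0..<n}. h (e j)) = sum h I" for h :: "'i \<Rightarrow> 'a"
    by (rule sum.reindex_bij_betw[OF e])
  have finj: "f i = f j \<longleftrightarrow> i = j" if "i < n" "j < n" for i j
    using f that by (auto simp: bij_betw_def inj_on_def)
  have einj: "e i = e j \<longleftrightarrow> i = j" if "i < n" "j < n" for i j
    using e that by (auto simp: bij_betw_def inj_on_def)
  define A where "A = mat n n (\<lambda>(i, j). M (e i) (e j))"
  define E where "E = mat n n (\<lambda>(i, j). F (e i) (f j))"
  define E' where "E' = mat n n (\<lambda>(i, j). F' (f i) (e j))"
  define D where "D = mat n n (\<lambda>(i, j). if i = j then d (f i) else 0)"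
  have cA: "A \<in> carrier_mat n n" and cE: "E \<in> carrier_mat n n" and cE': "E' \<in> carrier_mat n n"
    and cD: "D \<in> carrier_mat n n" by (simp_all add: A_def E_def E'_def D_def)
  have AE: "A * E = E * D"
  proof (rule eq_matI)
    fix i j assume "i < dim_row (E * D)" "j < dim_col (E * D)"
    then have ij: "i < n" "j < n" using cE cD by auto
    have "(A * E) $$ (i, j) = (\<Sum>k = 0..<n. M (e i) (e k) * F (e k) (f j))"
      using ij by (simp add: A_def E_def scalar_prod_def)
    also have "\<dots> = d (f j) * F (e i) (f j)"
      using sumI[of "\<lambda>k. M (e i) k * F k (f j)"] eig eI fX ij by simp
    also have "\<dots> = (\<Sum>k = 0..<n. F (e i) (f k) * (if k = j then d (f k) else 0))"
      using ij by (simp add: if_distrib[of "\<lambda>x. _ * x"] mult.commute cong: if_cong)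
    also have "\<dots> = (E * D) $$ (i, j)"
      using ij by (simp add: E_def D_def scalar_prod_def)
    finally show "(A * E) $$ (i, j) = (E * D) $$ (i, j)" .
  qed (use cA cE cD in auto)
  have EE: "E' * E = c \<cdot>\<^sub>m 1\<^sub>m n"
  proof (rule eq_matI)
    fix i j assume "i < dim_row (c \<cdot>\<^sub>m 1\<^sub>m n)" "j < dim_col (c \<cdot>\<^sub>m 1\<^sub>m n)"
    then have ij: "i < n" "j < n" by auto
    have "(E' * E) $$ (i, j) = (\<Sum>k = 0..<n. F' (f i) (e k) * F (e k) (f j))"
      using ij by (simp add: E'_def E_def scalar_prod_def)
    also have "\<dots> = (if f i = f j then c else 0)"
      using sumI[of "\<lambda>k. F' (f i) k * F k (f j)"] inv fX ij by simp
    finally show "(E' * E) $$ (i, j) = (c \<cdot>\<^sub>m 1\<^sub>m n) $$ (i, j)" using ij finj by simp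
  qed (use cE cE' in auto)
  have "det E' * det E = c ^ n"
    using det_mult[OF cE' cE] EE by simp
  \<comment> \<open>Only \<open>det E \<noteq> 0\<close> is wanted, so that it can be cancelled from
    \<open>det A * det E = det E * det D\<close>.\<close>
  then have E0: "det E \<noteq> 0" using c by auto
  have "det A * det E = det E * det D"
    by (metis det_mult[OF cA cE] det_mult[OF cE cD] AE)
  then have "det A = det D" using E0 by (metis mult.commute mult_cancel_left)
  also have "det D = prod_list (diag_mat D)"
    by (rule det_upper_triangular[OF _ cD]) (auto simp: D_def)
  also have "\<dots> = (\<Prod>i = 0..<n. d (f i))"
    unfolding prod_list_diag_prod using cD by (intro prod.cong) (auto simp: D_def)
  also have "\<dots> = (\<Prod>x\<in>S. d x)" by (rule prod.reindex_bij_betw[OF f])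
  finally have detA: "det A = (\<Prod>x\<in>S. d x)" .
  have AW: "A $$ (i, j) \<in> W" if "i < n" "j < n" for i j using that M eI by (simp add: A_def)
  show "(\<Prod>x\<in>S. d x) \<in> W" using det_mem[OF cA AW] detA by simp
  let ?g = "the_inv_into {0..<n} e"
  have g: "?g i < n" "e (?g i) = i" if "i \<in> I" for i
    using that e by (auto simp: bij_betw_def the_inv_into_f_f)
  define B where "B = (\<lambda>i j. adj_mat A $$ (?g i, ?g j))"
  have ge: "?g (e k) = k" if "k < n" for k using that e by (auto simp: bij_betw_def the_inv_into_f_f)
  show "\<exists>B. (\<forall>i\<in>I. \<forall>j\<in>I. B i j \<in> W) \<and>
      (\<forall>i\<in>I. \<forall>k\<in>I. (\<Sum>j\<in>I. M i j * B j k) = (if i = k then \<Prod>x\<in>S. d x else 0))"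
  proof (intro exI[of _ B] conjI ballI)
    fix i j assume ij: "i \<in> I" "j \<in> I"
    have "adj_mat A $$ (?g i, ?g j) = cofactor A (?g j) (?g i)"
      using g ij cA by (simp add: adj_mat_def)
    then show "B i j \<in> W" using cofactor_mem[OF cA AW] g ij by (simp add: B_def)
    have "(\<Sum>k\<in>I. M i k * B k j) = (\<Sum>k = 0..<n. A $$ (?g i, k) * adj_mat A $$ (k, ?g j))"
      unfolding sumI[symmetric] B_def using g ij by (intro sum.cong) (auto simp: A_def ge)
    also have "\<dots> = (A * adj_mat A) $$ (?g i, ?g j)"
      using g ij cA adj_mat(1)[OF cA] by (simp add: scalar_prod_def)
    also have "\<dots> = (if ?g i = ?g j then det A else 0)"
      using g ij adj_mat(2)[OF cA] by simp
    also have "\<dots> = (if i = j then \<Prod>x\<in>S. d x else 0)"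
      using g ij detA by metis
    finally show "(\<Sum>k\<in>I. M i k * B k j) = (if i = j then \<Prod>x\<in>S. d x else 0)" .
  qed
qed

section \<open>Roots of unity\<close>

abbreviation ipoly :: "int poly \<Rightarrow> complex \<Rightarrow> complex"
  where "ipoly f x \<equiv> poly (map_poly of_int f) x"

text \<open>This is Z[z]; the description by integer polynomials lets conjugation be expressed as a
  change of the evaluation point.\<close>

definition int_span :: "complex \<Rightarrow> complex set"
  where "int_span z = range (\<lambda>f. ipoly f z)"

lemma int_spanI: "ipoly f z \<in> int_span z"
  by (auto simp: int_span_def)

lemma int_spanE:
  assumes "x \<in> int_span z"
  obtains f :: "int poly" where "x = ipoly f z"
  using assms by (auto simp: int_span_def)

lemma unital_subring_int_span: "unital_subring (int_span z)"
proof
  have "1 = ipoly (1 :: int poly) z" by simp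
  then show "1 \<in> int_span z" unfolding int_span_def by blast
  fix x y assume "x \<in> int_span z" "y \<in> int_span z"
  then obtain f g :: "int poly" where fg: "x = ipoly f z" "y = ipoly g z"
    by (auto elim!: int_spanE)
  have "x - y = ipoly (f - g) z"
    by (simp add: fg of_int_poly_hom.hom_minus)
  then show "x - y \<in> int_span z" by (simp add: int_spanI)
  have "x * y = ipoly (f * g) z"
    by (simp add: fg of_int_poly_hom.hom_mult)
  then show "x * y \<in> int_span z" by (simp add: int_spanI)
qed

interpretation int_span: unital_subring "int_span z" for z
  by (rule unital_subring_int_span)

lemma self_in_int_span [simp, intro]: "z \<in> int_span z"
  using int_spanI[of "[:0, 1:]" z] by simp

lemma int_span_subset:
  assumes "unital_subring V" "z \<in> V"
  shows "int_span z \<subseteq> V"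
proof -
  interpret unital_subring V by fact
  show ?thesis by (auto elim!: int_spanE intro!: poly_mem assms simp: coeff_map_poly)
qed

lemma root_of_unity_power_mod:
  fixes z :: "'a :: monoid_mult"
  assumes "z ^ L = 1"
  shows "z ^ (k mod L) = z ^ k"
  using assms by (metis mod_mult_div_eq mult.right_neutral power_add power_mult power_one)

lemma root_of_unity_power:
  fixes z :: "'a :: monoid_mult"
  assumes "z ^ L = 1"
  shows "(z ^ j) ^ L = 1"
  using assms by (metis mult.commute power_mult power_one)

text \<open>Multiplication by \<open>w\<close> maps the span of \<open>1, z, ..., z^(L-1)\<close> to
  itself with integer coefficients \<open>c\<close>, exponents being reduced modulo
  \<open>L\<close>. The powers may be linearly dependent: what matters is that they form a nonzero
  eigenvector, and its entry of index 0 is 1.\<close>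

lemma algebraic_int_int_span:
  assumes z: "z ^ L = 1" "0 < L" and w: "w \<in> int_span z"
  shows "algebraic_int w"
proof -
  obtain f :: "int poly" where f: "w = ipoly f z" using w by (elim int_spanE)
  note zmod = root_of_unity_power_mod[OF z(1)]
  define c where "c = (\<lambda>i j. \<Sum>k\<le>degree f. if (i + k) mod L = j then coeff f k else 0)"
  show ?thesis
  proof (rule algebraic_int_if_integral_eigenvector[of L w "\<lambda>i. z ^ i" c 0])
    fix i assume "i < L"
    have "(\<Sum>j<L. of_int (c i j) * z ^ j) =
      (\<Sum>j<L. \<Sum>k\<le>degree f. if (i + k) mod L = j then of_int (coeff f k) * z ^ j else 0)"
      by (simp add: c_def sum_distrib_right if_distrib[of of_int] if_distrib[of "\<lambda>x. x * _"] cong: if_cong)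
    also have "\<dots> = (\<Sum>k\<le>degree f. of_int (coeff f k) * z ^ ((i + k) mod L))"
      by (subst sum.swap) (use z in simp)
    also have "\<dots> = w * z ^ i"
      by (simp add: f poly_altdef zmod coeff_map_poly degree_map_poly power_add sum_distrib_left sum_distrib_right mult_ac)
    finally show "w * z ^ i = (\<Sum>j<L. of_int (c i j) * z ^ j)" ..
  qed (use z in auto)
qed

text \<open>The quotient \<open>k / m\<close> is rational and an algebraic integer, hence an
  integer. This turns divisibility inside Z[z] back into divisibility of integers.\<close>

lemma int_dvd_if_dvd_in_int_span:
  assumes "z ^ L = 1" "0 < L" "w \<in> int_span z" "of_int m * w = of_int k" "m \<noteq> 0"
  shows "m dvd k"
proof -
  have w: "w = of_int k / of_int m" using assms by (simp add: field_simps)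
  then have "w \<in> \<int>"
    using algebraic_int_int_span[OF assms(1-3)] by (intro rational_algebraic_int_is_int) auto
  then obtain c where "w = of_int c" by (auto elim: Ints_cases)
  then have "of_int (m * c) = (of_int k :: complex)" using assms by simp
  then show ?thesis by (metis dvd_triv_left of_int_eq_iff)
qed

lemma sum_powers_root_of_unity:
  fixes q :: "'a :: idom"
  assumes "q ^ L = 1" "q \<noteq> 1"
  shows "(\<Sum>i<L. q ^ i) = 0"
  using one_diff_power_eq[of q L] assms by simp

text \<open>\<open>L\<close> is the value at \<open>1\<close> of the derivative of \<open>X\<^sup>L - 1\<close>, and so a multiple of every difference
  of two of its roots.\<close>

lemma root_of_unity_diff_dvd:
  fixes x y :: complex
  assumes W: "unital_subring W" and xy: "x \<in> W" "y \<in> W"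
    and L: "x ^ L = 1" "y ^ L = 1" "x \<noteq> y" "0 < L"
  shows "\<exists>w\<in>W. (x - y) * w = of_nat L"
proof -
  interpret unital_subring W by fact
  define q where "q = y * x ^ (L - 1)"
  have xL: "x * x ^ (L - 1) = 1" using L by (metis power_minus_mult mult.commute)
  \<comment> \<open>Thus \<open>q\<close> is \<open>y / x\<close>, as \<open>x ^ (L - 1)\<close> is
    the inverse of \<open>x\<close>.\<close>
  have xq: "x * q = y" using xL by (simp add: q_def mult.left_commute)
  have q1: "q \<noteq> 1" using xq L by auto
  have "q ^ L = 1" unfolding q_def using L
    by (simp add: power_mult_distrib flip: power_mult) (simp add: mult.commute power_mult)
  then have sum0: "(\<Sum>i<L. q ^ i) = 0" using q1 by (rule sum_powers_root_of_unity)
  \<comment> \<open>The geometric series gives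
    \<open>(1 - q) * (\<Sum>j<i. q ^ j) = 1 - q ^ i\<close>; summed over \<open>i < L\<close> this
    is \<open>L\<close>, because the powers of \<open>q\<close> sum to 0.\<close>
  let ?w = "x ^ (L - 1) * (\<Sum>i<L. \<Sum>j<i. q ^ j)"
  have "(x - y) * ?w = (x * x ^ (L - 1) - y * x ^ (L - 1)) * (\<Sum>i<L. \<Sum>j<i. q ^ j)"
    by (simp add: algebra_simps)
  also have "\<dots> = (1 - q) * (\<Sum>i<L. \<Sum>j<i. q ^ j)"
    by (simp only: xL q_def)
  also have "\<dots> = (\<Sum>i<L. 1 - q ^ i)"
    by (simp add: sum_distrib_left one_diff_power_eq)
  also have "\<dots> = of_nat L" using sum0 by (simp add: sum_subtractf)
  finally have "(x - y) * ?w = of_nat L" .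
  moreover have "?w \<in> W" using xy unfolding q_def by (intro mult_mem sum_mem power_mem)
  ultimately show ?thesis by blast
qed

lemma primitive_root_of_unity_eq_power_iff:
  fixes z :: complex
  assumes z: "primitive_root_of_unity L z"
  shows "z ^ i = z ^ j \<longleftrightarrow> [i = j] (mod L)"
proof -
  have L: "0 < L" "z ^ L = 1" and min: "\<And>k. 0 < k \<Longrightarrow> k < L \<Longrightarrow> z ^ k \<noteq> 1"
    using z by (auto simp: primitive_root_of_unity_def)
  have z0: "z \<noteq> 0" using L by (auto simp: power_0_left)
  note zmod = root_of_unity_power_mod[OF L(2)]
  have aux: False if "z ^ i = z ^ j" "i < j" "j < L" for i j
  proof -
    have "z ^ j = z ^ i * z ^ (j - i)" using that power_add[of z i "j - i"] by simp
    then have "z ^ (j - i) = 1" using that z0 by simp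
    then show False using min[of "j - i"] that by simp
  qed
  show ?thesis
  proof
    assume "z ^ i = z ^ j"
    then have "z ^ (i mod L) = z ^ (j mod L)" by (simp add: zmod)
    then show "[i = j] (mod L)"
      using aux[of "i mod L" "j mod L"] aux[of "j mod L" "i mod L"] L
      by (auto simp: cong_def) (metis linorder_neqE_nat mod_less_divisor)
  next
    assume "[i = j] (mod L)"
    then show "z ^ i = z ^ j" unfolding cong_def using zmod by metis
  qed
qed

lemma primitive_root_of_unity_power_eq_1_iff:
  fixes z :: complex
  assumes z: "primitive_root_of_unity L z"
  shows "z ^ i = 1 \<longleftrightarrow> L dvd i"
  using primitive_root_of_unity_eq_power_iff[OF z, of i 0] by (simp add: cong_0_iff)

lemma primitive_root_of_unity_power:
  fixes z :: complex
  assumes z: "primitive_root_of_unity L z" and a: "coprime a L"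
  shows "primitive_root_of_unity L (z ^ a)"
  using z a primitive_root_of_unity_power_eq_1_iff[OF z]
  unfolding primitive_root_of_unity_def
  by (auto simp: coprime_commute coprime_dvd_mult_right_iff simp flip: power_mult dest: dvd_imp_le)

lemma primitive_root_of_unity_power_dvd:
  fixes z :: complex
  assumes z: "primitive_root_of_unity (d * k) z"
  shows "primitive_root_of_unity d (z ^ k)"
  using z primitive_root_of_unity_power_eq_1_iff[OF z]
  unfolding primitive_root_of_unity_def
  by (auto simp: mult.commute simp flip: power_mult dest: dvd_imp_le)

text \<open>The \<open>L\<close> powers of \<open>z\<close> are distinct and exhaust the set of
  \<open>L\<close>-th roots of unity, which has exactly \<open>L\<close> elements.\<close>

lemma root_of_unity_eq_power:
  fixes z y :: complex
  assumes z: "primitive_root_of_unity L z" and y: "y ^ L = 1"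
  shows "\<exists>k. y = z ^ k"
proof -
  have L: "0 < L" "z ^ L = 1" using z by (auto simp: primitive_root_of_unity_def)
  have inj: "inj_on (\<lambda>k. z ^ k) {..<L}"
    using L by (auto intro!: inj_onI simp: primitive_root_of_unity_eq_power_iff[OF z] cong_def)
  have "(\<lambda>k. z ^ k) ` {..<L} = {y. y ^ L = 1}"
  proof (rule card_subset_eq)
    show "finite {y :: complex. y ^ L = 1}" using L by (intro finite_nth_roots)
    show "(\<lambda>k. z ^ k) ` {..<L} \<subseteq> {y. y ^ L = 1}"
      using root_of_unity_power[OF L(2)] by auto
    show "card ((\<lambda>k. z ^ k) ` {..<L}) = card {y :: complex. y ^ L = 1}"
      using L card_nth_roots[of 1 L] by (simp add: card_image[OF inj])
  qed
  then show ?thesis using y by auto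
qed

lemma cis_root_of_unity_neq_1:
  assumes "0 < k" "k < m"
  shows "cis (2 * pi * real k / real m) \<noteq> 1"
proof
  assume "cis (2 * pi * real k / real m) = 1"
  then have "cis (2 * pi * real k / real m) = cis (2 * pi * real 0 / real m)" by simp
  then have "k = 0"
    using assms inj_onD[OF bij_betw_imp_inj_on[OF bij_betw_roots_unity[of m]], of k 0] by auto
  then show False using assms by simp
qed

lemma primitive_root_of_unity_cis:
  assumes "0 < L"
  shows "primitive_root_of_unity L (cis (2 * pi / real L))"
proof -
  have "cis (2 * pi / real L) ^ k = cis (2 * pi * real k / real L)" for k
    by (simp add: DeMoivre mult_ac)
  then show ?thesis
    using assms cis_root_of_unity_neq_1[of _ L] by (auto simp: primitive_root_of_unity_def)
qed

lemma (in unital_subring) coeff_prod_mem: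
  "(\<And>i k. i \<in> A \<Longrightarrow> coeff (f i) k \<in> W) \<Longrightarrow> coeff (prod f A) k \<in> W"
  by (induction A arbitrary: k rule: infinite_finite_induct) (auto simp: coeff_mult one_pCons coeff_pCons split: nat.splits intro!: sum_mem mult_mem)

section \<open>Conjugation of roots of unity: irreducibility of the cyclotomic polynomials\<close>

interpretation of_rat_poly: map_poly_idom_hom "of_rat :: rat \<Rightarrow> complex" ..

text \<open>If \<open>z\<^sup>l\<close> were not a root of the minimal polynomial \<open>g\<close> of \<open>z\<close>, then \<open>g(z\<^sup>l)\<close>, a multiple of
  \<open>l\<close> because it is congruent to \<open>g(z)\<^sup>l = 0\<close>, would divide a power of \<open>L\<close>, being a product of
  differences of \<open>L\<close>-th roots of unity.\<close>

lemma root_conjugate_prime: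
  fixes z :: complex and F :: "int poly"
  assumes prim: "primitive_root_of_unity L z" and l: "Factorial_Ring.prime l" "\<not> l dvd L"
    and F: "ipoly F z = 0"
  shows "ipoly F (z ^ l) = 0"
proof -
  have z: "z ^ L = 1" "0 < L" using prim by (auto simp: primitive_root_of_unity_def)
  let ?r = "map_poly of_rat :: rat poly \<Rightarrow> complex poly"
  \<comment> \<open>The nonzero rational polynomials vanishing at \<open>z\<close>; the monic
    multiple \<open>g\<close> of one of least degree is the minimal polynomial.\<close>
  define A where "A = {h :: rat poly. h \<noteq> 0 \<and> poly (?r h) z = 0}"
  have xL: "Polynomial.monom 1 L - 1 \<in> A"
    unfolding A_def using z
    by (auto simp: of_rat_poly.hom_minus map_poly_monom poly_monom monom_eq_1_iff)
  define g0 where "g0 = arg_min degree (\<lambda>h. h \<in> A)"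
  have g0: "g0 \<in> A" "\<And>h. h \<in> A \<Longrightarrow> degree g0 \<le> degree h"
    using arg_min_natI[of "\<lambda>h. h \<in> A", OF xL] arg_min_nat_le[of "\<lambda>h. h \<in> A"] by (auto simp: g0_def)
  define g where "g = smult (inverse (lead_coeff g0)) g0"
  have g: "g \<in> A" "lead_coeff g = 1" "degree g = degree g0"
    using g0(1) by (auto simp: g_def A_def of_rat_hom.map_poly_hom_smult)
  have dvd: "g dvd h" if "poly (?r h) z = 0" for h
  proof (rule ccontr)
    assume "\<not> g dvd h"
    then have nz: "h mod g \<noteq> 0" by (simp add: dvd_eq_mod_eq_0)
    have "?r h = ?r (h div g) * ?r g + ?r (h mod g)"
      by (metis div_mult_mod_eq of_rat_poly.hom_add of_rat_poly.hom_mult)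
    then have "poly (?r (h mod g)) z = 0" using that g(1) by (simp add: A_def)
    then have "degree g0 \<le> degree (h mod g)" using nz g0(2) by (simp add: A_def)
    moreover have "degree (h mod g) < degree g" using nz g(1) by (intro degree_mod_less') (auto simp: A_def)
    ultimately show False using g(3) by simp
  qed
  define gC where "gC = ?r g"
  have gC: "poly gC z = 0" "lead_coeff gC = 1" using g by (auto simp: gC_def A_def)
  obtain h where h: "Polynomial.monom 1 L - 1 = g * h" using dvd xL by (auto simp: A_def elim: dvdE)
  have gCh: "Polynomial.monom 1 L - 1 = gC * ?r h"
    using arg_cong[OF h, of ?r] by (simp add: gC_def of_rat_poly.hom_minus of_rat_poly.hom_mult map_poly_monom)
  obtain root where root: "smult (lead_coeff gC) (\<Prod>i<degree gC. [:-root i, 1:]) = gC"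
    by (rule complex_poly_decompose')
  then have gprod: "gC = (\<Prod>i<degree gC. [:-root i, 1:])" using gC by simp
  have polyg: "poly gC x = (\<Prod>i<degree gC. x - root i)" for x
    by (subst gprod) (simp add: poly_prod)
  have rootL: "root i ^ L = 1" if "i < degree gC" for i
  proof -
    have "poly gC (root i) = 0" using that by (auto simp: polyg)
    then have "poly (Polynomial.monom 1 L - 1) (root i) = 0" by (simp add: gCh)
    then show ?thesis by (simp add: poly_monom)
  qed
  have rootV: "root i \<in> int_span z" if "i < degree gC" for i
    using root_of_unity_eq_power[OF prim rootL[OF that]] by (auto intro!: int_span.power_mem)
  \<comment> \<open>In place of Gauss's lemma: the roots of \<open>g\<close> are powers of
    \<open>z\<close>, so its rational coefficients are also in Z[z], hence algebraic integers, and
    therefore integers.\<close>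
  have "coeff gC k \<in> int_span z" for k
    using rootV
    by (subst gprod, intro int_span.coeff_prod_mem) (auto simp: coeff_pCons split: nat.splits)
  then have gCint: "coeff gC k \<in> \<int>" for k
    using algebraic_int_int_span[OF z] by (intro rational_algebraic_int_is_int) (auto simp: gC_def coeff_map_poly)
  have gint: "coeff g k \<in> \<int>" for k
  proof -
    obtain m where "coeff gC k = of_int m" using gCint[of k] by (auto elim: Ints_cases)
    then have "of_rat (coeff g k) = (of_rat (of_int m) :: complex)" by (simp add: gC_def coeff_map_poly)
    then have "coeff g k = of_int m" by (simp only: of_rat_eq_iff)
    then show ?thesis by simp
  qed
  define gZ where "gZ = map_poly floor g"
  have gZ: "gC = map_poly of_int gZ"
  proof (rule poly_eqI)
    fix k
    obtain m where "coeff g k = of_int m" using gint[of k] by (auto elim: Ints_cases)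
    then show "coeff gC k = coeff (map_poly of_int gZ) k"
      by (simp add: gC_def gZ_def coeff_map_poly)
  qed
  define Q where "Q = {of_nat l * w | w. w \<in> int_span z}"
  interpret Q: ideal_of "int_span z" Q
  proof
    show "Q \<subseteq> int_span z" by (auto simp: Q_def)
    show "0 \<in> Q" unfolding Q_def using int_span.zero_mem by force
    show "x - y \<in> Q" if "x \<in> Q" "y \<in> Q" for x y
      using that unfolding Q_def by (auto simp flip: right_diff_distrib)
    show "x * y \<in> Q" if "x \<in> int_span z" "y \<in> Q" for x y
      using that unfolding Q_def by (auto simp: mult.left_commute)
  qed
  have lQ: "of_nat l \<in> Q" unfolding Q_def using int_span.one_mem by force
  have polyC: "poly gC x = (\<Sum>i\<le>degree gZ. of_int (coeff gZ i) * x ^ i)" for x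
    by (simp add: gZ poly_altdef coeff_map_poly degree_map_poly)
  have "(\<Sum>i\<le>degree gZ. of_int (coeff gZ i) * z ^ i) ^ l ^ 1 - (\<Sum>i\<le>degree gZ. (of_int (coeff gZ i) * z ^ i) ^ l ^ 1) \<in> Q"
    using l lQ by (intro Q.frobenius_sum) auto
  moreover have "(\<Sum>i\<le>degree gZ. (of_int (coeff gZ i) * z ^ i) ^ l ^ 1) - (\<Sum>i\<le>degree gZ. of_int (coeff gZ i) * (z ^ l) ^ i) \<in> Q"
  proof (rule Q.diff_sum)
    fix i
    have "(of_int (coeff gZ i) * z ^ i) ^ l ^ 1 - of_int (coeff gZ i) * (z ^ l) ^ i =
      (of_int (coeff gZ i) ^ l - of_int (coeff gZ i)) * (z ^ l) ^ i"
      by (simp add: algebra_simps flip: power_mult)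
    also have "\<dots> \<in> Q" using Q.of_int_power_prime[OF l(1) lQ] by auto
    finally show "(of_int (coeff gZ i) * z ^ i) ^ l ^ 1 - of_int (coeff gZ i) * (z ^ l) ^ i \<in> Q" .
  qed
  ultimately have "(\<Sum>i\<le>degree gZ. of_int (coeff gZ i) * z ^ i) ^ l ^ 1 - (\<Sum>i\<le>degree gZ. of_int (coeff gZ i) * (z ^ l) ^ i) \<in> Q"
    by (rule Q.diff_trans)
  then have "poly gC z ^ l - poly gC (z ^ l) \<in> Q"
    by (simp only: polyC power_one_right)
  then have "poly gC (z ^ l) \<in> Q"
    using gC l Q.diff_mem_iff[of 0 "poly gC (z ^ l)"] by (simp add: zero_power prime_gt_0_nat)
  then obtain u where u: "u \<in> int_span z" "poly gC (z ^ l) = of_nat l * u" by (auto simp: Q_def)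
  have gl: "poly gC (z ^ l) = 0"
  proof (rule ccontr)
    assume nz: "poly gC (z ^ l) \<noteq> 0"
    have "\<exists>w\<in>int_span z. (z ^ l - root i) * w = of_nat L" if "i < degree gC" for i
    proof (rule root_of_unity_diff_dvd[OF unital_subring_int_span])
      show "z ^ l \<noteq> root i" using nz that by (auto simp: polyg)
      show "(z ^ l) ^ L = 1" using z(1) by (rule root_of_unity_power)
    qed (use that rootV rootL z in auto)
    then obtain w where w: "\<And>i. i < degree gC \<Longrightarrow> w i \<in> int_span z"
      "\<And>i. i < degree gC \<Longrightarrow> (z ^ l - root i) * w i = of_nat L" by metis
    have "poly gC (z ^ l) * (\<Prod>i<degree gC. w i) = (\<Prod>i<degree gC. of_nat L)"
      unfolding polyg by (simp add: w(2) flip: prod.distrib)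
    then have "of_int (int l) * (u * (\<Prod>i<degree gC. w i)) = of_int (int L ^ degree gC)"
      using u by (simp add: mult.assoc)
    then have "int l dvd int L ^ degree gC"
      using z u w l by (intro int_dvd_if_dvd_in_int_span[of z L "u * (\<Prod>i<degree gC. w i)"]) auto
    then show False using l by (metis of_nat_dvd_iff of_nat_power prime_dvd_power_nat)
  qed
  have rF: "?r (map_poly of_int F) = map_poly of_int F"
    by (intro poly_eqI) (simp add: coeff_map_poly)
  then obtain q where "map_poly of_int F = g * q" using dvd[of "map_poly of_int F"] F by (auto elim: dvdE)
  then have "map_poly of_int F = gC * ?r q" by (metis gC_def of_rat_poly.hom_mult rF)
  then show ?thesis using gl by simp
qed

text \<open>The prime case is iterated along the factorization of \<open>a\<close>, each partial
  power of \<open>z\<close> being again primitive. Thus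
  \<open>ipoly F z \<mapsto> ipoly F (z ^ a)\<close> is well defined, which is how automorphisms of
  the cyclotomic field enter.\<close>

lemma root_conjugate:
  fixes z :: complex and F :: "int poly"
  assumes z: "primitive_root_of_unity L z" and a: "coprime a L"
    and F: "ipoly F z = 0"
  shows "ipoly F (z ^ a) = 0"
proof (cases "a = 0")
  case True
  then show ?thesis using a z F by (simp add: primitive_root_of_unity_def)
next
  case False
  then show ?thesis using a
  proof (induction a rule: prime_divisors_induct)
    case (factor p x)
    have "ipoly F ((z ^ x) ^ p) = 0"
    proof (rule root_conjugate_prime[where L = L])
      show "primitive_root_of_unity L (z ^ x)" using factor.prems z by (intro primitive_root_of_unity_power) auto
      show "Factorial_Ring.prime p" using factor by simp
      show "\<not> p dvd L" using factor.prems factor.hyps(1)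
        by (metis coprime_common_divisor_nat coprime_mult_left_iff dvd_refl not_prime_1)
    qed (use factor z in auto)
    then show ?case by (simp add: mult.commute flip: power_mult)
  qed (use F in auto)
qed

section \<open>Orders and powers modulo \<open>N\<close>\<close>

text \<open>A divisor of \<open>n\<close> prime to \<open>p\<close> divides the cofactor of the full
  power of \<open>p\<close>, so the maximum is that cofactor.\<close>

lemma Max_coprime_divisor:
  fixes n p :: nat
  assumes "0 < n" "Factorial_Ring.prime p" and d: "d = Max {d. d dvd n \<and> \<not> p dvd d}"
  shows "\<exists>k. n = p ^ k * d" "\<not> p dvd d" "0 < d"
proof -
  obtain r where r: "n = p ^ multiplicity p n * r" "\<not> p dvd r"
    using multiplicity_decompose'[of n p] assms
    by (metis not_prime_unit not_gr_zero)
  have "d = r" unfolding d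
  proof (rule Max_eqI)
    show "finite {d. d dvd n \<and> \<not> p dvd d}" using assms by simp
    show "r \<in> {d. d dvd n \<and> \<not> p dvd d}" using r by (metis CollectI dvd_triv_right)
    fix y assume y: "y \<in> {d. d dvd n \<and> \<not> p dvd d}"
    then have "coprime y (p ^ multiplicity p n)"
      using assms(2) by (simp add: prime_imp_coprime coprime_commute)
    moreover have "y dvd p ^ multiplicity p n * r" using y r by simp
    ultimately have "y dvd r" by (simp add: coprime_dvd_mult_right_iff)
    moreover have "r > 0" using r assms(1) by (metis mult_0_right not_gr_zero)
    ultimately show "y \<le> r" by (rule dvd_imp_le)
  qed
  then show "\<exists>k. n = p ^ k * d" "\<not> p dvd d" using r by auto
  then show "0 < d" using assms(1) by (cases d) auto
qed

text \<open>Translates the three maxima of the theorem into \<open>N = n0 * m' * n1\<close>, the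
  part of \<open>lcm n M\<close> prime to \<open>p\<close>. Besides coprimality, the later count
  relies on every prime factor of \<open>m'\<close> dividing \<open>n0\<close>.\<close>

lemma lcm_decomposition:
  fixes n p M n0 n1 m' :: nat
  assumes n: "0 < n" "0 < M" and p: "Factorial_Ring.prime p"
    and n0: "n0 = Max {d. d dvd n \<and> \<not> p dvd d}"
    and n1: "n1 = Max {d. d dvd M \<and> \<not> p dvd d \<and> gcd d n0 = 1}"
    and m': "m' = Max {d. d dvd lcm M n0 div (n0 * n1) \<and> \<not> p dvd d}"
  shows "\<exists>k. n = p ^ k * n0" "\<exists>k. lcm n M = p ^ k * (n0 * m' * n1)" "\<not> p dvd n0 * m' * n1"
    and "coprime n1 (n0 * m')" "\<And>l. Factorial_Ring.prime l \<Longrightarrow> l dvd m' \<Longrightarrow> l dvd n0"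
    and "0 < n0 * m' * n1"
proof -
  obtain k1 where k1: "n = p ^ k1 * n0" and pn0: "\<not> p dvd n0" "0 < n0"
    using Max_coprime_divisor[OF n(1) p n0] by auto
  let ?S = "{d. d dvd M \<and> \<not> p dvd d \<and> gcd d n0 = 1}"
  have finS: "finite ?S" using n by simp
  have "1 \<in> ?S" using p by (auto dest: prime_gt_1_nat)
  then have "?S \<noteq> {}" by (metis empty_iff)
  then have n1S: "n1 \<in> ?S" unfolding n1 by (rule Max_in[OF finS])
  have n1max: "d \<le> n1" if "d \<in> ?S" for d unfolding n1 using finS that by (rule Max_ge)
  have n1M: "n1 dvd M" and pn1: "\<not> p dvd n1" and g1: "gcd n1 n0 = 1" using n1S by simp_all
  have n1pos: "0 < n1" using n1M n(2) by (rule dvd_pos_nat[rotated])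
  have cop10: "coprime n1 n0" using g1 by (simp only: coprime_iff_gcd_eq_1)
  have "n1 dvd lcm M n0" using n1M by (rule dvd_trans) simp
  then have "n0 * n1 dvd lcm M n0"
    using cop10 by (intro divides_mult) (simp_all only: coprime_commute dvd_lcm2)
  then obtain t where t: "lcm M n0 = n0 * n1 * t" by blast
  have tpos: "0 < t" using t n pn0 by (metis lcm_pos_nat mult_0_right not_gr_zero)
  have "lcm M n0 div (n0 * n1) = t" using t pn0 n1pos by simp
  then have m't: "m' = Max {d. d dvd t \<and> \<not> p dvd d}" using m' by simp
  obtain k where k: "t = p ^ k * m'" and pm: "\<not> p dvd m'" "0 < m'"
    using Max_coprime_divisor[OF tpos p m't] by auto
  show "\<exists>k. n = p ^ k * n0" using k1 by blast
  show pN: "\<not> p dvd n0 * m' * n1" using pn0 pm pn1 p by (simp add: prime_dvd_mult_iff)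
  show "0 < n0 * m' * n1" using pn0 pm n1pos by simp
  \<comment> \<open>Otherwise \<open>l * n1\<close> would be a larger admissible divisor of
    \<open>M\<close> than the maximum \<open>n1\<close>.\<close>
  show lm: "l dvd n0" if l: "Factorial_Ring.prime l" "l dvd m'" for l
  proof (rule ccontr)
    assume nl: "\<not> l dvd n0"
    have cl: "coprime (l * n1) n0" using nl l cop10 by (simp add: prime_imp_coprime)
    have "l dvd n0 * t" using l(2) k by simp
    then have "l * n1 dvd n0 * t * n1" by (rule mult_dvd_mono) simp
    also have "n0 * t * n1 = lcm M n0" using t by (simp add: ac_simps)
    also have "lcm M n0 dvd M * n0" by simp
    finally have "l * n1 dvd M" using cl by (simp add: coprime_dvd_mult_left_iff)
    moreover have "\<not> p dvd l * n1"
    proof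
      assume "p dvd l * n1"
      then have "p dvd l" using pn1 p by (simp add: prime_dvd_mult_iff)
      then have "p dvd m'" using l(2) by (rule dvd_trans)
      then show False using pm by simp
    qed
    ultimately have "l * n1 \<le> n1" using coprime_imp_gcd_eq_1[OF cl] by (intro n1max) simp
    then show False using n1pos prime_gt_1_nat[OF l(1)] by simp
  qed
  have "coprime n1 m'"
  proof (rule ccontr)
    assume "\<not> coprime n1 m'"
    then have "gcd n1 m' \<noteq> 1" by (simp only: coprime_iff_gcd_eq_1 not_False_eq_True)
    then obtain l where l: "Factorial_Ring.prime l" "l dvd gcd n1 m'"
      using prime_factor_nat by blast
    then have "l dvd gcd n1 n0" using lm[of l] by simp
    then show False using g1 l(1) not_prime_1 by simp
  qed
  then show "coprime n1 (n0 * m')" using cop10 by simp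
  have "lcm n M = lcm (p ^ k1) (lcm M n0)"
  proof -
    have "coprime (p ^ k1) n0" using pn0 p by (simp add: prime_imp_coprime)
    then have "n = lcm (p ^ k1) n0" using k1 by (simp add: lcm_coprime)
    then show ?thesis by (simp add: lcm.assoc lcm.commute[of n0 M])
  qed
  also have "lcm M n0 = p ^ k * (n0 * m' * n1)" using t k by (simp add: mult_ac)
  also have "\<dots> = lcm (p ^ k) (n0 * m' * n1)"
    using pN p prime_imp_coprime[of p "n0 * m' * n1"] by (simp add: lcm_coprime)
  also have "lcm (p ^ k1) \<dots> = lcm (p ^ max k1 k) (n0 * m' * n1)"
    by (simp add: lcm.assoc[symmetric] max_def le_imp_power_dvd lcm_proj1_if_dvd lcm_proj2_if_dvd)
  also have "\<dots> = p ^ max k1 k * (n0 * m' * n1)"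
    using pN p prime_imp_coprime[of p "n0 * m' * n1"] by (simp add: lcm_coprime)
  finally show "\<exists>k. lcm n M = p ^ k * (n0 * m' * n1)" by blast
qed

text \<open>One prime \<open>l\<close> at a time: for \<open>y\<close> congruent to 1 modulo
  \<open>k * m\<close>, the cofactor of \<open>y - 1\<close> in \<open>y ^ l - 1\<close> is a sum of
  \<open>l\<close> terms congruent to 1 modulo \<open>l\<close>, hence a multiple of
  \<open>l\<close>. This is where the prime factors of \<open>m\<close> have to divide
  \<open>k\<close>.\<close>

lemma cong_1_power_mult:
  fixes x k m :: nat
  assumes "[x = 1] (mod k)" "\<And>l. Factorial_Ring.prime l \<Longrightarrow> l dvd m \<Longrightarrow> l dvd k" "0 < m"
  shows "[x ^ m = 1] (mod k * m)"
  using assms(2,3)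
proof (induction m rule: prime_divisors_induct)
  case (factor l m)
  define y where "y = int (x ^ m)"
  have m: "0 < m" "l dvd k" using factor.prems factor.hyps by auto
  have "[x ^ m = 1] (mod k * m)" using factor m by simp
  then have "[int (x ^ m) = int 1] (mod int (k * m))" by (simp only: cong_int_iff)
  then have y1: "int (k * m) dvd y - 1" by (simp add: y_def cong_iff_dvd_diff)
  then have "[y = 1] (mod int l)"
    using m by (auto simp: cong_iff_dvd_diff intro: dvd_trans[of "int l" "int (k * m)"])
  then have "[(\<Sum>i<l. y ^ i) = (\<Sum>i<l. 1 ^ i)] (mod int l)"
    by (intro cong_sum cong_pow)
  then have "int l dvd (\<Sum>i<l. y ^ i)" by (simp add: cong_dvd_iff)
  then have "int (k * m) * int l dvd (y - 1) * (\<Sum>i<l. y ^ i)" using y1 by (intro mult_dvd_mono)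
  also have "(y - 1) * (\<Sum>i<l. y ^ i) = y ^ l - 1" by (simp add: power_diff_1_eq)
  finally have "[int (x ^ (l * m)) = int 1] (mod int (k * (l * m)))"
    by (simp add: cong_iff_dvd_diff y_def mult_ac flip: power_mult)
  then show ?case by (simp only: cong_int_iff)
qed (use assms in \<open>auto simp: cong_def\<close>)

section \<open>Counting the units congruent to 1 modulo \<open>n0\<close>\<close>

lemma bij_betw_residue_class:
  fixes k m c :: nat
  assumes "0 < k"
  shows "bij_betw (\<lambda>j. c mod k + k * j) {..<m} {a. a < k * m \<and> [a = c] (mod k)}"
proof (rule bij_betw_imageI)
  show "inj_on (\<lambda>j. c mod k + k * j) {..<m}" using assms by (auto intro!: inj_onI)
  show "(\<lambda>j. c mod k + k * j) ` {..<m} = {a. a < k * m \<and> [a = c] (mod k)}"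
  proof (intro equalityI subsetI)
    fix x assume "x \<in> (\<lambda>j. c mod k + k * j) ` {..<m}"
    then obtain j where j: "j < m" "x = c mod k + k * j" by auto
    have "x < k + k * j" using j assms by simp
    also have "k + k * j = k * Suc j" by simp
    also have "\<dots> \<le> k * m" using j by (intro mult_le_mono) auto
    finally show "x \<in> {a. a < k * m \<and> [a = c] (mod k)}" using j by (simp add: cong_def)
  next
    fix x assume x: "x \<in> {a. a < k * m \<and> [a = c] (mod k)}"
    then have "x mod k = c mod k" by (simp only: cong_def mem_Collect_eq)
    then have "x = c mod k + k * (x div k)" using mod_mult_div_eq[of x k] by linarith
    moreover have "x div k < m" using x by (simp add: less_mult_imp_div_less mult.commute)
    ultimately show "x \<in> (\<lambda>j. c mod k + k * j) ` {..<m}" by (metis image_eqI lessThan_iff)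
  qed
qed

text \<open>Chinese remainders for \<open>n0 * m\<close> and \<open>n1\<close>. A class that is 1
  modulo \<open>n0\<close> is automatically a unit modulo \<open>n0 * m\<close>, since the primes of
  \<open>m\<close> divide \<open>n0\<close>; there are \<open>m\<close> such classes.\<close>

lemma card_cong_1_totatives:
  fixes n0 m n1 :: nat
  assumes pos: "0 < n0 * m * n1" and cop: "coprime n1 (n0 * m)"
    and pm: "\<And>l. Factorial_Ring.prime l \<Longrightarrow> l dvd m \<Longrightarrow> l dvd n0"
  shows "card {a. a < n0 * m * n1 \<and> coprime a (n0 * m * n1) \<and> [a = 1] (mod n0)} = m * totient n1"
    (is "card ?A = _")
proof -
  let ?A1 = "{a. a < n0 * m \<and> [a = 1] (mod n0)}"
  let ?A2 = "{a. a < n1 \<and> coprime a n1}"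
  have copA1: "coprime a (n0 * m)" if "[a = 1] (mod n0)" for a
  proof -
    have c0: "coprime a n0" using that by (metis cong_imp_coprime cong_sym coprime_1_left)
    have "coprime a m"
    proof (rule ccontr)
      assume "\<not> coprime a m"
      then have "gcd a m \<noteq> 1" by (simp only: coprime_iff_gcd_eq_1 not_False_eq_True)
      then obtain l where l: "Factorial_Ring.prime l" "l dvd gcd a m"
        using prime_factor_nat by blast
      then have "l dvd gcd a n0" using pm[of l] by simp
      then show False using coprime_imp_gcd_eq_1[OF c0] l(1) not_prime_1 by simp
    qed
    then show ?thesis using c0 by simp
  qed
  have "bij_betw (\<lambda>a. (a mod (n0 * m), a mod n1)) ?A (?A1 \<times> ?A2)"
  proof (rule bij_betw_imageI)
    show "inj_on (\<lambda>a. (a mod (n0 * m), a mod n1)) ?A"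
    proof (rule inj_onI)
      fix a b assume ab: "a \<in> ?A" "b \<in> ?A" "(a mod (n0 * m), a mod n1) = (b mod (n0 * m), b mod n1)"
      then have "[a = b] (mod n0 * m)" "[a = b] (mod n1)" by (simp_all only: cong_def prod.inject)
      then have "[a = b] (mod n0 * m * n1)"
        using cop by (metis coprime_cong_mult_nat coprime_commute)
      then show "a = b" using ab by (simp add: cong_def)
    qed
    show "(\<lambda>a. (a mod (n0 * m), a mod n1)) ` ?A = ?A1 \<times> ?A2"
    proof (intro equalityI subsetI)
      fix x assume "x \<in> (\<lambda>a. (a mod (n0 * m), a mod n1)) ` ?A"
      then show "x \<in> ?A1 \<times> ?A2" using pos by (auto simp: cong_def mod_mod_cancel)
    next
      fix x assume x: "x \<in> ?A1 \<times> ?A2"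
      obtain b c where bc: "x = (b, c)" by (cases x)
      obtain a where a: "[a = b] (mod n0 * m)" "[a = c] (mod n1)"
        using binary_chinese_remainder_nat[of "n0 * m" n1 b c] cop by (auto simp: coprime_commute)
      let ?a = "a mod (n0 * m * n1)"
      have a': "[?a = b] (mod n0 * m)" "[?a = c] (mod n1)"
        using a by (simp_all add: cong_def mod_mod_cancel)
      have "[?a = b] (mod n0)" using a'(1) by (rule cong_dvd_modulus_nat) simp
      then have a1: "[?a = 1] (mod n0)" using x bc by (auto intro: cong_trans)
      have "coprime ?a n1" using a'(2) x bc by (auto intro: cong_imp_coprime cong_sym)
      then have "?a \<in> ?A" using pos a1 copA1[OF a1] by auto
      moreover have "x = (?a mod (n0 * m), ?a mod n1)" using a' x bc by (auto simp: cong_def)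
      ultimately show "x \<in> (\<lambda>a. (a mod (n0 * m), a mod n1)) ` ?A" by blast
    qed
  qed
  then have "card ?A = card ?A1 * card ?A2"
    by (simp add: bij_betw_same_card card_cartesian_product)
  also have "card ?A1 = m"
    using bij_betw_same_card[OF bij_betw_residue_class[of n0 1 m]] pos by simp
  also have "card ?A2 = totient n1"
  \<comment> \<open>Modulo 1 the representative below \<open>n1\<close> is 0, whereas
    \<open>totatives 1\<close> is {1}.\<close>
  proof (cases "n1 = 1")
    case True
    then have "?A2 = {0}" by auto
    then show ?thesis using True by (simp del: One_nat_def)
  next
    case False
    then have n1: "n1 > 1" using pos by (cases n1) auto
    have "x \<in> ?A2 \<longleftrightarrow> x \<in> totatives n1" for x
      using n1 by (cases "x = 0"; cases "x = n1") (auto simp: in_totatives_iff)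
    then have "?A2 = totatives n1" by blast
    then show ?thesis by (simp add: totient_def)
  qed
  finally show ?thesis .
qed

text \<open>The powers of \<open>p\<close> congruent to 1 modulo \<open>n0\<close> are the powers of
  \<open>p ^ f\<close>; modulo \<open>N\<close> there are \<open>ord N p div f\<close> of them,
  against \<open>m * totient n1\<close> units to be hit. So the left side says that
  \<open>ord N p\<close>, the least common multiple of two orders bounded by
  \<open>totient n1\<close> and \<open>m * f\<close>, reaches the product of the bounds. This forces
  both bounds to be attained and the gcd to be 1.\<close>

lemma powers_fill_kernel_iff:
  fixes p n0 m n1 :: nat
  defines "N \<equiv> n0 * m * n1"
  assumes pos: "0 < N" and cop: "coprime n1 (n0 * m)" and cp: "coprime p N"
    and pm: "\<And>l. Factorial_Ring.prime l \<Longrightarrow> l dvd m \<Longrightarrow> l dvd n0"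
  shows "(\<forall>a. coprime a N \<and> [a = 1] (mod n0) \<longrightarrow> (\<exists>i. [a = p ^ i] (mod N))) \<longleftrightarrow>
    ord n1 p = totient n1 \<and> ord (n0 * m) p = m * ord n0 p \<and> gcd (ord n1 p) (ord (n0 * m) p) = 1"
    (is "?P \<longleftrightarrow> ?O")
proof -
  define f where "f = ord n0 p"
  define A where "A = {a. a < N \<and> coprime a N \<and> [a = 1] (mod n0)}"
  have copn: "coprime n0 p" "coprime n1 p" "coprime (n0 * m) p" "coprime N p"
    using cp by (auto simp: N_def coprime_commute)
  have fpos: "f > 0" unfolding f_def using copn by (simp only: ord_gt_0_iff)
  have Npos: "ord N p > 0" using copn by (simp only: ord_gt_0_iff)
  have n0N: "n0 dvd N" by (simp add: N_def)
  have "[p ^ ord N p = 1] (mod n0)" using ord[of p N] n0N by (rule cong_dvd_modulus_nat)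
  then have "f dvd ord N p" unfolding f_def ord_divides .
  then obtain r where r: "ord N p = f * r" by blast
  have rpos: "r > 0" using r Npos by (cases r) auto
  define B where "B = (\<lambda>i. p ^ (f * i) mod N) ` {..<r}"
  have "inj_on (\<lambda>i. p ^ (f * i) mod N) {..<r}"
  proof (rule inj_onI)
    fix i j assume ij: "i \<in> {..<r}" "j \<in> {..<r}" "p ^ (f * i) mod N = p ^ (f * j) mod N"
    then have "[f * i = f * j] (mod f * r)"
      using order_divides_expdiff[of N p "f * i" "f * j"] copn r by (auto simp: cong_def)
    then show "i = j" using ij fpos by (simp add: cong_def)
  qed
  then have cardB: "card B = r" unfolding B_def by (simp add: card_image)
  have BA: "B \<subseteq> A"
  proof
    fix x assume "x \<in> B"
    then obtain i where i: "x = p ^ (f * i) mod N" by (auto simp: B_def)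
    have "[p ^ (f * i) = 1] (mod n0)" unfolding ord_divides by (simp add: f_def)
    then have "[x = 1] (mod n0)" using i n0N by (simp add: cong_def mod_mod_cancel)
    moreover have "coprime x N" using i cp by (simp add: pos)
    ultimately show "x \<in> A" using i pos by (simp add: A_def)
  qed
  have finA: "finite A" unfolding A_def by simp
  have "?P \<longleftrightarrow> A \<subseteq> B"
  proof
    assume P: ?P
    show "A \<subseteq> B"
    proof
      fix a assume a: "a \<in> A"
      then obtain i where i: "[a = p ^ i] (mod N)" using P by (auto simp: A_def)
      then have "[a = p ^ i] (mod n0)" using n0N by (rule cong_dvd_modulus_nat)
      then have "[p ^ i = 1] (mod n0)" using a by (auto simp: A_def intro: cong_trans cong_sym)
      then have "f dvd i" unfolding ord_divides f_def .
      then obtain j where j: "i = f * j" by blast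
      have "[p ^ (f * j) = p ^ (f * (j mod r))] (mod N)"
        using order_divides_expdiff[of N p "f * j" "f * (j mod r)"] copn r
        by (simp add: cong_def mod_mult_mult1)
      then have "a = p ^ (f * (j mod r)) mod N" using i j a by (simp add: A_def cong_def)
      then show "a \<in> B" using rpos by (auto simp: B_def)
    qed
  next
    assume AB: "A \<subseteq> B"
    show ?P
    proof (intro allI impI)
      fix a assume "coprime a N \<and> [a = 1] (mod n0)"
      then have "a mod N \<in> A" using pos n0N by (simp add: A_def cong_def mod_mod_cancel)
      then have "a mod N \<in> B" using AB by auto
      then show "\<exists>i. [a = p ^ i] (mod N)" by (auto simp: B_def cong_def)
    qed
  qed
  also have "\<dots> \<longleftrightarrow> card A = card B"
    using BA finA by (metis card_subset_eq finite_subset order_refl subset_antisym)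
  also have "\<dots> \<longleftrightarrow> m * totient n1 = r"
    using card_cong_1_totatives[of n0 m n1] pos cop pm cardB by (simp add: A_def N_def)
  also have "\<dots> \<longleftrightarrow> ord N p = totient n1 * (m * f)"
    using r fpos by (auto simp: mult_ac)
  also have "ord N p = lcm (ord n1 p) (ord (n0 * m) p)"
    unfolding N_def using ord_modulus_mult_coprime[of "n0 * m" n1 p] cop
    by (simp add: coprime_commute lcm.commute)
  also have "\<dots> = totient n1 * (m * f) \<longleftrightarrow> ?O"
  proof -
    define x where "x = ord n1 p"
    define y where "y = ord (n0 * m) p"
    have mpos: "0 < m" "0 < n1" using pos by (auto simp: N_def intro!: Nat.gr0I)
    have "x dvd totient n1" unfolding x_def using copn by (intro order_divides_totient)
    then have xle: "x \<le> totient n1" using mpos by (intro dvd_imp_le) auto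
    have "[p ^ f = 1] (mod n0)" unfolding f_def by (rule ord)
    then have "[(p ^ f) ^ m = 1] (mod n0 * m)" using pm mpos by (intro cong_1_power_mult)
    then have "y dvd f * m" unfolding y_def by (simp only: power_mult[symmetric] ord_divides)
    then have yle: "y \<le> m * f" using mpos fpos by (intro dvd_imp_le) (auto simp: mult.commute)
    have xy: "x > 0" "y > 0" unfolding x_def y_def using copn by (simp_all only: ord_gt_0_iff)
    have "lcm x y = totient n1 * (m * f) \<longleftrightarrow> x = totient n1 \<and> y = m * f \<and> gcd x y = 1"
    proof
      assume l: "lcm x y = totient n1 * (m * f)"
      have le: "x * y \<le> totient n1 * (m * f)" using xle yle by (rule mult_le_mono)
      have "gcd x y * (totient n1 * (m * f)) = x * y" using l prod_gcd_lcm_nat[of x y] by simp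
      then have "gcd x y * (totient n1 * (m * f)) \<le> 1 * (totient n1 * (m * f))" using le by simp
      moreover have tp: "0 < totient n1 * (m * f)" using mpos fpos by simp
      ultimately have "gcd x y \<le> 1" by (metis mult_le_cancel2)
      moreover have "0 < gcd x y" using xy by simp
      ultimately have g1: "gcd x y = 1" by linarith
      then have eq: "x * y = totient n1 * (m * f)" using l prod_gcd_lcm_nat[of x y] by simp
      have "x = totient n1"
      proof (rule ccontr)
        assume "x \<noteq> totient n1"
        then have "x < totient n1" using xle by simp
        then have "x * y < totient n1 * (m * f)" using yle xy by (intro mult_less_le_imp_less) auto
        then show False using eq by simp
      qed
      then show "x = totient n1 \<and> y = m * f \<and> gcd x y = 1" using eq g1 xy by simp
    next
      assume "x = totient n1 \<and> y = m * f \<and> gcd x y = 1"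
      then show "lcm x y = totient n1 * (m * f)" by (metis prod_gcd_lcm_nat mult_1)
    qed
    then show ?thesis by (simp add: x_def y_def f_def)
  qed
  finally show ?thesis .
qed

text \<open>A geometric series in \<open>z ^ n0\<close> times \<open>z ^ (c mod n0)\<close>: either
  \<open>z ^ n0 = 1\<close>, and all terms lie in \<open>W\<close>, or the series vanishes.\<close>

lemma sum_root_powers_residue_class_in:
  fixes z :: complex
  assumes W: "unital_subring W" and mu: "\<And>y. y ^ n0 = 1 \<Longrightarrow> y \<in> W"
    and N: "n0 dvd N" "0 < N" and z: "z ^ N = 1"
  shows "(\<Sum>a | a < N \<and> [a = c] (mod n0). z ^ a) \<in> W"
proof -
  interpret unital_subring W by fact
  obtain m where m: "N = n0 * m" using N by blast
  have n0: "0 < n0" using N m by (cases n0) auto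
  have bij: "bij_betw (\<lambda>j. c mod n0 + n0 * j) {..<m} {a. a < N \<and> [a = c] (mod n0)}"
    unfolding m using n0 by (rule bij_betw_residue_class)
  have "(\<Sum>a | a < N \<and> [a = c] (mod n0). z ^ a) = (\<Sum>j<m. z ^ (c mod n0 + n0 * j))"
    by (rule sum.reindex_bij_betw[OF bij, symmetric])
  also have "\<dots> = z ^ (c mod n0) * (\<Sum>j<m. (z ^ n0) ^ j)"
    by (simp add: power_add power_mult sum_distrib_left)
  also have "\<dots> \<in> W"
  proof (cases "z ^ n0 = 1")
    case True
    then show ?thesis using mu by (intro mult_mem power_mem sum_mem) auto
  next
    case False
    have "(z ^ n0) ^ m = 1" using z m by (simp flip: power_mult)
    then have "(\<Sum>j<m. (z ^ n0) ^ j) = 0" using False by (rule sum_powers_root_of_unity)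
    then show ?thesis by simp
  qed
  finally show ?thesis .
qed

lemma sum_coprime_residue_class_by_gcd:
  fixes f :: "nat \<Rightarrow> complex"
  assumes N: "N = d * N'" "0 < N" and n0: "n0 dvd N" "coprime d n0"
    and c': "[d * c' = c] (mod n0)"
  shows "(\<Sum>a | a < N \<and> gcd a N = d \<and> [a = c] (mod n0). f a) =
    (\<Sum>a | a < N' \<and> coprime a N' \<and> [a = c'] (mod n0). f (d * a))"
proof -
  have d: "0 < d" using N by (cases d) auto
  show ?thesis
  proof (rule sum.reindex_bij_witness[of _ "\<lambda>a. d * a" "\<lambda>a. a div d"])
    fix a assume a: "a \<in> {a. a < N \<and> gcd a N = d \<and> [a = c] (mod n0)}"
    then have "d dvd a" by (metis (mono_tags, lifting) gcd_dvd1 mem_Collect_eq)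
    then obtain b where b: "a = d * b" by blast
    have "gcd a N = d * gcd b N'" using b N by (simp add: gcd_mult_distrib_nat)
    then have "gcd b N' = 1" using a d by simp
    then have "coprime b N'" by (rule gcd_eq_1_imp_coprime)
    moreover have "[b = c'] (mod n0)"
    proof -
      have "[d * b = d * c'] (mod n0)" using a b c' by (auto intro: cong_trans cong_sym)
      then show ?thesis using n0 by (simp add: cong_mult_lcancel_nat)
    qed
    moreover have "b < N'" using a b N d by simp
    moreover have "a div d = b" using b d by simp
    ultimately show "d * (a div d) = a" "a div d \<in> {a. a < N' \<and> coprime a N' \<and> [a = c'] (mod n0)}"
      "f (d * (a div d)) = f a"
      using b by simp_all
  next
    fix b assume b: "b \<in> {a. a < N' \<and> coprime a N' \<and> [a = c'] (mod n0)}"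
    have "gcd (d * b) N = d" using b N by (simp add: gcd_mult_distrib_nat[symmetric] coprime_imp_gcd_eq_1)
    moreover have "[d * b = c] (mod n0)"
      using b c' by (auto intro: cong_trans[OF cong_scalar_left])
    ultimately show "d * b \<in> {a. a < N \<and> gcd a N = d \<and> [a = c] (mod n0)}" using b N d by simp
    show "d * b div d = b" using d by simp
  qed
qed

text \<open>Traces from \<open>\<rat>(\<zeta>\<^sub>N)\<close> to \<open>\<rat>(\<zeta>\<^sub>n\<^sub>0)\<close>; sorting by \<open>gcd a N\<close> reduces the sum over units to sums over
  full residue classes, which are geometric.\<close>

lemma sum_root_powers_units_in:
  fixes z :: complex
  assumes W: "unital_subring W" and mu: "\<And>y. y ^ n0 = 1 \<Longrightarrow> y \<in> W"
    and "n0 dvd N" "0 < N" "z ^ N = 1" "coprime c n0"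
  shows "(\<Sum>a | a < N \<and> coprime a N \<and> [a = c] (mod n0). z ^ a) \<in> W"
  using assms(3-)
proof (induction N arbitrary: z c rule: less_induct)
  case (less N)
  interpret unital_subring W by fact
  let ?S = "\<lambda>d. {a. a < N \<and> gcd a N = d \<and> [a = c] (mod n0)}"
  have fin: "finite (?S d)" for d by simp
  have "(\<Sum>a | a < N \<and> [a = c] (mod n0). z ^ a) = (\<Sum>d | d dvd N. \<Sum>a\<in>?S d. z ^ a)"
  proof -
    have "(\<Sum>d | d dvd N. \<Sum>a\<in>{a \<in> {a. a < N \<and> [a = c] (mod n0)}. gcd a N = d}. z ^ a) =
      (\<Sum>a | a < N \<and> [a = c] (mod n0). z ^ a)"
      using less.prems by (intro sum.group) auto
    moreover have "{a \<in> {a. a < N \<and> [a = c] (mod n0)}. gcd a N = d} = ?S d" for d by auto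
    ultimately show ?thesis by simp
  qed
  also have "\<dots> = (\<Sum>a\<in>?S 1. z ^ a) + (\<Sum>d\<in>{d. d dvd N} - {1}. \<Sum>a\<in>?S d. z ^ a)"
    using less.prems by (subst sum.remove[of _ 1]) auto
  finally have eq: "(\<Sum>a\<in>?S 1. z ^ a) = (\<Sum>a | a < N \<and> [a = c] (mod n0). z ^ a) -
    (\<Sum>d\<in>{d. d dvd N} - {1}. \<Sum>a\<in>?S d. z ^ a)" by simp
  \<comment> \<open>If some \<open>a\<close> has gcd \<open>d\<close> with \<open>N\<close> and is
    congruent to the unit \<open>c\<close>, then \<open>d\<close> is prime to \<open>n0\<close>,
    hence \<open>n0\<close> divides \<open>N / d\<close>. Dividing \<open>a\<close> by
    \<open>d\<close> gives the same kind of sum for \<open>z ^ d\<close> and the smaller modulus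
    \<open>N / d\<close>.\<close>
  have sub: "(\<Sum>a\<in>?S d. z ^ a) \<in> W" if d: "d dvd N" "d \<noteq> 1" for d
  proof (cases "?S d = {}")
    case True
    then show ?thesis by (simp only: sum.empty zero_mem)
  next
    case False
    then obtain a where "a \<in> ?S d" by (metis ex_in_conv)
    then have a: "gcd a N = d" "[a = c] (mod n0)" by simp_all
    have "coprime a n0" using cong_imp_coprime[OF cong_sym[OF a(2)] less.prems(4)] .
    then have cop: "coprime d n0" using a(1) by (metis coprime_divisors dvd_refl gcd_dvd1)
    obtain N' where N': "N = d * N'" using d by blast
    obtain b where b: "[d * b = 1] (mod n0)" using cong_solve_coprime_nat[OF cop] by auto
    define c' where "c' = b * c"
    have c': "[d * c' = c] (mod n0)"
      using cong_scalar_right[OF b, of c] by (simp add: c'_def mult.assoc)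
    have "coprime (d * c') n0" using cong_imp_coprime[OF cong_sym[OF c'] less.prems(4)] .
    then have "coprime c' n0" by simp
    moreover have "N' < N" "0 < N'" using N' d less.prems(2) by (cases d; auto)+
    moreover have "n0 dvd N'"
      using less.prems(1) cop unfolding N' by (metis coprime_commute coprime_dvd_mult_right_iff)
    moreover have "(z ^ d) ^ N' = 1" using less.prems(3) N' by (simp flip: power_mult)
    ultimately have "(\<Sum>a | a < N' \<and> coprime a N' \<and> [a = c'] (mod n0). (z ^ d) ^ a) \<in> W"
      by (intro less.IH)
    then show ?thesis
      using sum_coprime_residue_class_by_gcd[OF N' less.prems(2,1) cop c', of "\<lambda>a. z ^ a"]
      by (simp add: power_mult)
  qed
  have "(\<Sum>d\<in>{d. d dvd N} - {1}. \<Sum>a\<in>?S d. z ^ a) \<in> W"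
    by (rule sum_mem, rule sub) auto
  moreover have "(\<Sum>a | a < N \<and> [a = c] (mod n0). z ^ a) \<in> W"
    using less.prems by (intro sum_root_powers_residue_class_in W mu)
  ultimately have "(\<Sum>a\<in>?S 1. z ^ a) \<in> W" unfolding eq by (rule diff_mem[rotated])
  moreover have "?S 1 = {a. a < N \<and> coprime a N \<and> [a = c] (mod n0)}"
    by (auto simp only: coprime_iff_gcd_eq_1)
  ultimately show ?case by simp
qed

section \<open>Prime ideals lying over a given one\<close>

text \<open>An ideal \<open>Q\<close> maximal subject to \<open>Q \<inter> A \<subseteq> P\<close> contains \<open>P\<close>: otherwise \<open>s = q + x w\<close> with
  \<open>x \<in> P\<close>, \<open>s \<notin> P\<close>, and an integral equation of \<open>w\<close> scaled by a power of \<open>x\<close> puts a power of \<open>s\<close>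
  into \<open>P\<close>.\<close>

lemma lying_over:
  fixes A W :: "complex set"
  assumes P: "prime_ideal_of A P" and W: "unital_subring W" and AW: "A \<subseteq> W"
    and int: "\<And>w. w \<in> W \<Longrightarrow> algebraic_int w"
  shows "\<exists>Q. prime_ideal_of W Q \<and> Q \<inter> A = P"
proof -
  interpret P: prime_ideal_of A P by fact
  interpret W: unital_subring W by fact
  define \<I> where "\<I> = {I. ideal_of W I \<and> I \<inter> A \<subseteq> P}"
  have "ideal_of W {0}" by unfold_locales auto
  then have ne: "\<I> \<noteq> {}" unfolding \<I>_def by force
  have "\<Union>\<C> \<in> \<I>" if \<C>: "\<C> \<noteq> {}" "subset.chain \<I> \<C>" for \<C>
  proof -
    have id: "ideal_of W I" "I \<inter> A \<subseteq> P" if "I \<in> \<C>" for I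
      using \<C> that by (auto simp: subset.chain_def \<I>_def)
    have "ideal_of W (\<Union>\<C>)"
    proof
      show "\<Union>\<C> \<subseteq> W" using id(1) ideal_of.sub by blast
      show "0 \<in> \<Union>\<C>" using \<C>(1) id(1) ideal_of.zero_in by blast
      show "x * y \<in> \<Union>\<C>" if "x \<in> W" "y \<in> \<Union>\<C>" for x y
        using that id(1) ideal_of.mult_in by blast
      fix x y assume "x \<in> \<Union>\<C>" "y \<in> \<Union>\<C>"
      then obtain I J where IJ: "x \<in> I" "I \<in> \<C>" "y \<in> J" "J \<in> \<C>" by auto
      then have "I \<subseteq> J \<or> J \<subseteq> I" using \<C>(2) by (auto simp: subset.chain_def)
      then show "x - y \<in> \<Union>\<C>"
      proof
        assume "I \<subseteq> J"
        then show ?thesis using IJ ideal_of.diff_in[OF id(1)[OF IJ(4)], of x y] by blast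
      next
        assume "J \<subseteq> I"
        then show ?thesis using IJ ideal_of.diff_in[OF id(1)[OF IJ(2)], of x y] by blast
      qed
    qed
    then show ?thesis using id(2) by (auto simp: \<I>_def)
  qed
  then obtain Q where Q: "Q \<in> \<I>" and max: "\<And>I. I \<in> \<I> \<Longrightarrow> Q \<subseteq> I \<Longrightarrow> I = Q"
    using subset_Zorn_nonempty[OF ne] by metis
  interpret Q: ideal_of W Q using Q by (simp add: \<I>_def)
  have QA: "Q \<inter> A \<subseteq> P" using Q by (simp add: \<I>_def)
  \<comment> \<open>Maximality of \<open>Q\<close>: the ideal generated by \<open>Q\<close> and
    \<open>x\<close> must meet \<open>A\<close> outside \<open>P\<close>.\<close>
  have enlarge: "\<exists>q\<in>Q. \<exists>w\<in>W. q + x * w \<in> A - P" if x: "x \<in> W" "x \<notin> Q" for x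
  proof (rule ccontr)
    assume neg: "\<not> ?thesis"
    let ?I = "{q + x * w | q w. q \<in> Q \<and> w \<in> W}"
    have "ideal_of W ?I"
    proof
      show "?I \<subseteq> W" using Q.sub x by auto
      show "0 \<in> ?I" using Q.zero_in W.zero_mem by force
      show "u - v \<in> ?I" if "u \<in> ?I" "v \<in> ?I" for u v
      proof -
        from that obtain q w q' w' where "u = q + x * w" "v = q' + x * w'" "q \<in> Q" "q' \<in> Q" "w \<in> W" "w' \<in> W"
          by auto
        moreover from this have "u - v = (q - q') + x * (w - w')" by (simp add: algebra_simps)
        ultimately show ?thesis by blast
      qed
      show "u * v \<in> ?I" if "u \<in> W" "v \<in> ?I" for u v
      proof -
        from that obtain q w where "v = q + x * w" "q \<in> Q" "w \<in> W" by auto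
        moreover from this have "u * v = u * q + x * (u * w)" by (simp add: algebra_simps)
        ultimately show ?thesis using that by blast
      qed
    qed
    moreover have "?I \<inter> A \<subseteq> P" using neg by auto
    ultimately have "?I \<in> \<I>" by (simp add: \<I>_def)
    moreover have "Q \<subseteq> ?I" using W.zero_mem by force
    ultimately have "?I = Q" by (rule max)
    moreover have "x \<in> ?I" using Q.zero_in W.one_mem by force
    ultimately show False using x by simp
  qed
  have "prime_ideal_of W Q"
  proof
    show "1 \<notin> Q" using QA P.one_mem P.one_notin by blast
    fix x y assume xy: "x \<in> W" "y \<in> W" "x * y \<in> Q"
    show "x \<in> Q \<or> y \<in> Q"
    proof (rule ccontr)
      assume "\<not> ?thesis"
      then obtain q w q' w' where *: "q \<in> Q" "w \<in> W" "q + x * w \<in> A - P"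
          "q' \<in> Q" "w' \<in> W" "q' + y * w' \<in> A - P"
        using enlarge[OF xy(1)] enlarge[OF xy(2)] by blast
      have "(q + x * w) * (q' + y * w') = q * (q' + y * w') + (x * w) * q' + (w * w') * (x * y)"
        by (simp add: algebra_simps)
      also have "\<dots> \<in> Q"
      proof (intro Q.add_in)
        show "q * (q' + y * w') \<in> Q" using *(1,6) AW by (intro Q.mult_in') auto
        show "(x * w) * q' \<in> Q" using *(2,4) xy(1) by (intro Q.mult_in W.mult_mem)
        show "(w * w') * (x * y) \<in> Q" using *(2,5) xy(3) by (simp add: Q.mult_in W.mult_mem)
      qed
      finally have "(q + x * w) * (q' + y * w') \<in> P" using * QA by auto
      then show False using P.prime_in * by blast
    qed
  qed
  moreover have PQ: "P \<subseteq> Q"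
  proof
    fix x assume x: "x \<in> P"
    then have xA: "x \<in> A" using P.sub by blast
    show "x \<in> Q"
    proof (rule ccontr)
      assume "x \<notin> Q"
      then obtain q w where qw: "q \<in> Q" "w \<in> W" "q + x * w \<in> A - P" using enlarge[of x] xA AW by blast
      define s where "s = q + x * w"
      have s: "s \<in> A" "s \<notin> P" "s - x * w \<in> Q" using qw by (auto simp: s_def)
      obtain f :: "int poly" where f: "ipoly f w = 0" "lead_coeff f = 1"
        using int[OF qw(2)] unfolding algebraic_int_altdef_ipoly by blast
      define k where "k = degree f"
      \<comment> \<open>\<open>?g y\<close> is \<open>x ^ k * f (y / x)\<close> with denominators
        cleared. It is monic in \<open>y\<close>, and its other coefficients are multiples of
        \<open>x\<close>, hence in \<open>P\<close>.\<close>
      let ?g = "\<lambda>y. \<Sum>i\<le>k. of_int (coeff f i) * x ^ (k - i) * y ^ i"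
      have "?g (x * w) = x ^ k * ipoly f w"
      proof -
        have "x ^ (k - i) * (x * w) ^ i = x ^ k * w ^ i" if "i \<le> k" for i
          using that by (simp add: power_mult_distrib mult.assoc[symmetric] flip: power_add)
        then have "?g (x * w) = (\<Sum>i\<le>k. of_int (coeff f i) * (x ^ k * w ^ i))"
          by (intro sum.cong) (auto simp: mult.assoc)
        then show ?thesis
          by (simp add: poly_altdef coeff_map_poly degree_map_poly k_def sum_distrib_left mult_ac)
      qed
      then have "?g (x * w) = 0" using f by simp
      moreover have "?g s - ?g (x * w) \<in> Q"
      proof (rule Q.diff_sum)
        fix i
        have "s ^ i - (x * w) ^ i \<in> Q" using s AW xA qw by (intro Q.diff_power) auto
        then have "of_int (coeff f i) * x ^ (k - i) * (s ^ i - (x * w) ^ i) \<in> Q"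
          using xA AW by (intro Q.mult_in) auto
        then show "of_int (coeff f i) * x ^ (k - i) * s ^ i - of_int (coeff f i) * x ^ (k - i) * (x * w) ^ i \<in> Q"
          by (simp add: algebra_simps)
      qed
      ultimately have "?g s \<in> Q" by simp
      then have gP: "?g s \<in> P" using QA s xA by (intro subsetD[OF QA] IntI) auto
      have "{..k} = insert k {..<k}" by auto
      then have gs: "?g s = s ^ k + (\<Sum>i<k. of_int (coeff f i) * x ^ (k - i) * s ^ i)"
        using f(2) by (simp add: k_def)
      have tP: "(\<Sum>i<k. of_int (coeff f i) * x ^ (k - i) * s ^ i) \<in> P"
      proof (rule P.sum_in)
        fix i assume i: "i \<in> {..<k}"
        then have "x ^ (k - i) \<in> P" using x by (intro P.power_in_ideal) auto
        then show "of_int (coeff f i) * x ^ (k - i) * s ^ i \<in> P" using s by auto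
      qed
      have "s ^ k \<in> P" using P.diff_in[OF gP tP] by (simp only: gs add_diff_cancel_right')
      then show False using P.power_in s by blast
    qed
  qed
  have "Q \<inter> A = P" using QA PQ P.sub by (intro equalityI) auto
  ultimately show ?thesis by (intro exI[of _ Q] conjI)
qed

section \<open>Primes of cyclotomic rings\<close>

text \<open>\<open>n0\<close> and \<open>N\<close> are the parts of \<open>n\<close> and
  \<open>L\<close> prime to \<open>p\<close>. The big ring Z[w] contains Z[\<zeta>] and, in the
  application, all character values of the group.\<close>

locale cyclotomic_setting =
  fixes n n0 N L p e k :: nat and \<zeta> w :: complex
  assumes p: "Factorial_Ring.prime p"
    and n: "n = p ^ e * n0" and L: "L = p ^ k * N"
    and n0N: "n0 dvd N" and nL: "n dvd L" and pN: "\<not> p dvd N"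
    and \<zeta>: "primitive_root_of_unity n \<zeta>" and w: "primitive_root_of_unity L w"
begin

lemma p_gt_1: "1 < p"
  using p prime_gt_1_nat by blast

lemma L_pos: "0 < L" and n_pos: "0 < n" and \<zeta>n: "\<zeta> ^ n = 1" and wL: "w ^ L = 1"
  using w \<zeta> by (auto simp: primitive_root_of_unity_def)

lemma N_pos: "0 < N"
  using L_pos L by (auto intro!: Nat.gr0I)

lemma coprime_pN: "coprime p N"
  using p pN by (rule prime_imp_coprime)

lemma coprime_n0p: "coprime n0 p"
  using coprime_pN n0N by (metis coprime_commute coprime_divisors dvd_refl)

lemma \<zeta>_root: "y ^ n = 1 \<Longrightarrow> y \<in> int_span \<zeta>"
  using root_of_unity_eq_power[OF \<zeta>, of y] by (auto intro!: int_span.power_mem)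

lemma w_root: "y ^ L = 1 \<Longrightarrow> y \<in> int_span w"
  using root_of_unity_eq_power[OF w, of y] by (auto intro!: int_span.power_mem)

lemma root_N_in: "y ^ N = 1 \<Longrightarrow> y \<in> int_span w"
  using w_root[of y] by (simp add: L power_mult mult.commute[of _ N])

lemma root_n0_in: "y ^ n0 = 1 \<Longrightarrow> y \<in> int_span \<zeta>"
  using \<zeta>_root[of y] by (simp add: n power_mult mult.commute[of _ n0])

lemma \<zeta>L: "\<zeta> ^ L = 1"
  using nL \<zeta>n by (auto elim!: dvdE simp: power_mult)

lemma \<zeta>_in: "\<zeta> \<in> int_span w"
  by (rule w_root[OF \<zeta>L])

lemma O_subset: "int_span \<zeta> \<subseteq> int_span w"
  by (intro int_span_subset unital_subring_int_span \<zeta>_in)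

end

locale cyclotomic_prime = cyclotomic_setting +
  fixes Q :: "complex set"
  assumes Q: "prime_ideal_of (int_span w) Q" and pQ: "of_nat p \<in> Q"
begin

sublocale Q: prime_ideal_of "int_span w" Q
  by (rule Q)

text \<open>The difference of two such roots divides \<open>N\<close>, which is prime to
  \<open>p\<close> and so not in \<open>Q\<close>.\<close>

lemma roots_incongruent:
  assumes xy: "x ^ N = 1" "y ^ N = 1" "x \<noteq> y"
  shows "x - y \<notin> Q"
proof
  assume d: "x - y \<in> Q"
  obtain v where v: "v \<in> int_span w" "(x - y) * v = of_nat N"
    using root_of_unity_diff_dvd[OF unital_subring_int_span root_N_in root_N_in xy(1,2,3) N_pos] xy by auto
  have "of_nat N \<in> Q" using Q.mult_in'[OF d v(1)] v(2) by simp
  then show False using Q.coprime_of_nat_notin[OF pQ coprime_pN] by simp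
qed

lemma of_int_power_fixed: "(of_int c :: complex) ^ p ^ i - of_int c \<in> Q"
proof (induction i)
  case (Suc i)
  have "(of_int c ^ p ^ i) ^ p - (of_int c :: complex) ^ p \<in> Q"
    using Suc by (intro Q.diff_power) auto
  moreover have "(of_int c :: complex) ^ p - of_int c \<in> Q" by (rule Q.of_int_power_prime[OF p pQ])
  ultimately have "(of_int c ^ p ^ i) ^ p - (of_int c :: complex) \<in> Q" by (rule Q.diff_trans)
  then show ?case by (simp add: mult.commute flip: power_mult)
qed simp

text \<open>Modulo \<open>Q\<close> the \<open>p ^ i\<close>-th power of \<open>y - 1\<close> is
  \<open>y ^ p ^ i - 1 = 0\<close>, and \<open>Q\<close> is prime.\<close>

lemma p_power_root_congruent_1:
  assumes y: "y \<in> int_span w" "y ^ p ^ i = 1"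
  shows "y - 1 \<in> Q"
proof -
  \<comment> \<open>The two-term sum \<open>y + (-1)\<close>, indexed by the booleans to fit
    \<open>frobenius_sum\<close>.\<close>
  define f where "f = (\<lambda>b. if b then y else (-1 :: complex))"
  have "(\<Sum>b\<in>UNIV. f b) ^ p ^ i - (\<Sum>b\<in>UNIV. f b ^ p ^ i) \<in> Q"
    using y(1) by (intro Q.frobenius_sum[OF p pQ]) (auto simp: f_def)
  then have 1: "(y - 1) ^ p ^ i - (1 + (- 1) ^ p ^ i) \<in> Q"
    using y(2) by (simp add: UNIV_bool f_def algebra_simps)
  \<comment> \<open>The congruence also covers \<open>p = 2\<close>, where for \<open>i > 0\<close>
    the value is 2, an element of \<open>Q\<close>.\<close>
  have 2: "(1 + (- 1) ^ p ^ i) - (0 :: complex) \<in> Q"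
    using of_int_power_fixed[of "-1" i] by (simp add: algebra_simps)
  have "(y - 1) ^ p ^ i \<in> Q" using Q.diff_trans[OF 1 2] by simp
  then show ?thesis using y(1) by (intro Q.power_in[of "y - 1"]) auto
qed

text \<open>Modulo \<open>Q\<close> the order of \<zeta> divides \<open>n0\<close>, and
  \<open>p ^ ord n0 p\<close> is 1 modulo \<open>n0\<close>, so this power fixes \<zeta>; by
  additivity and Fermat it fixes all of Z[\<zeta>].\<close>

lemma residue_field_frobenius:
  assumes x: "x \<in> int_span \<zeta>"
  shows "x ^ p ^ ord n0 p - x \<in> Q"
proof -
  define f where "f = ord n0 p"
  have "[p ^ f = 1] (mod n0)" unfolding f_def by (rule ord)
  then have n0f: "n0 dvd p ^ f - 1" by (rule cong_to_1_nat)
  have pf: "p ^ f = Suc (p ^ f - 1)" using p_gt_1 by simp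
  have \<zeta>f: "\<zeta> ^ p ^ f - \<zeta> \<in> Q"
  proof -
    \<comment> \<open>With this \<open>m\<close>, the \<open>p ^ e\<close>-th power of
      \<open>\<zeta> ^ (p ^ f - 1)\<close> is \<open>(\<zeta> ^ n) ^ m = 1\<close>: a root of unity
      of \<open>p\<close>-power order, hence congruent to 1.\<close>
    obtain m where m: "p ^ f - 1 = n0 * m" using n0f by blast
    have "(\<zeta> ^ (p ^ f - 1)) ^ p ^ e = (\<zeta> ^ n) ^ m" unfolding m n by (simp add: mult_ac flip: power_mult)
    then have "\<zeta> ^ (p ^ f - 1) - 1 \<in> Q"
      using \<zeta>n \<zeta>_in by (intro p_power_root_congruent_1[of _ e]) auto
    then have "\<zeta> * (\<zeta> ^ (p ^ f - 1) - 1) \<in> Q" using \<zeta>_in by (intro Q.mult_in)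
    moreover have "\<zeta> ^ p ^ f = \<zeta> * \<zeta> ^ (p ^ f - 1)" by (subst pf) simp
    ultimately show ?thesis by (simp add: algebra_simps)
  qed
  obtain F :: "int poly" where F: "x = ipoly F \<zeta>" using x by (elim int_spanE)
  have xF: "x = (\<Sum>i\<le>degree F. of_int (coeff F i) * \<zeta> ^ i)"
    by (simp add: F poly_altdef coeff_map_poly degree_map_poly)
  have "x ^ p ^ f - (\<Sum>i\<le>degree F. (of_int (coeff F i) * \<zeta> ^ i) ^ p ^ f) \<in> Q"
    unfolding xF using \<zeta>_in by (intro Q.frobenius_sum[OF p pQ]) (auto intro!: int_span.mult_mem int_span.power_mem)
  moreover have "(\<Sum>i\<le>degree F. (of_int (coeff F i) * \<zeta> ^ i) ^ p ^ f) - x \<in> Q"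
    unfolding xF
  proof (rule Q.diff_sum)
    fix i
    have "(\<zeta> ^ p ^ f) ^ i - \<zeta> ^ i \<in> Q" using \<zeta>_in \<zeta>f by (intro Q.diff_power) (auto intro!: int_span.power_mem)
    then have "of_int (coeff F i) ^ p ^ f * (\<zeta> ^ p ^ f) ^ i - of_int (coeff F i) * \<zeta> ^ i \<in> Q"
      using \<zeta>_in by (intro Q.diff_mult of_int_power_fixed) (auto intro!: int_span.power_mem)
    then show "(of_int (coeff F i) * \<zeta> ^ i) ^ p ^ f - of_int (coeff F i) * \<zeta> ^ i \<in> Q"
      by (simp add: power_mult_distrib mult.commute flip: power_mult)
  qed
  ultimately show ?thesis unfolding f_def[symmetric] by (rule Q.diff_trans)
qed

text \<open>The Galois group of the \<open>N\<close>-th over the \<open>n0\<close>-th cyclotomic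
  field, as exponents. Representatives are taken below \<open>N\<close>, so for \<open>N = 1\<close>
  the only one is 0; hence the \<open>1 mod N\<close> below.\<close>

definition unit_kernel :: "nat set"
  where "unit_kernel = {a. a < N \<and> coprime a N \<and> [a = 1] (mod n0)}"

lemma finite_unit_kernel: "finite unit_kernel"
  by (simp add: unit_kernel_def)

lemma one_in_unit_kernel: "1 mod N \<in> unit_kernel"
proof -
  have "1 mod N < N" using N_pos by simp
  moreover have "coprime (1 mod N) N" by (cases "N = 1") auto
  moreover have "[1 mod N = 1] (mod n0)" using n0N by (simp only: cong_def mod_mod_cancel)
  ultimately show ?thesis unfolding unit_kernel_def by blast
qed

lemma primitive_N: "primitive_root_of_unity N (w ^ p ^ k)"
  using w by (intro primitive_root_of_unity_power_dvd) (simp add: L mult.commute)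

text \<open>If all traces of powers of a primitive \<open>N\<close>-th root \<open>z\<close> were in
  \<open>Q\<close>, the Vandermonde argument with all coefficients 1 and the nodes
  \<open>z ^ a\<close>, which are incongruent modulo \<open>Q\<close>, would put 1 into
  \<open>Q\<close>. This reflects that \<open>p\<close> is unramified in the \<open>N\<close>-th
  cyclotomic field.\<close>

lemma trace_not_in_prime:
  "\<exists>t. t ^ N = 1 \<and> (\<Sum>a\<in>unit_kernel. t ^ a) \<notin> Q"
proof (rule ccontr)
  assume neg: "\<not> ?thesis"
  define z where "z = w ^ p ^ k"
  have z: "primitive_root_of_unity N z" "z ^ N = 1"
    using primitive_N by (auto simp: z_def primitive_root_of_unity_def)
  note zj = root_of_unity_power[OF z(2)]
  have inj: "inj_on (\<lambda>a. z ^ a) unit_kernel"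
    by (auto intro!: inj_onI simp: unit_kernel_def primitive_root_of_unity_eq_power_iff[OF z(1)] cong_def)
  have "1 \<in> Q"
  proof (rule Q.vandermonde_mod[of "(\<lambda>a. z ^ a) ` unit_kernel" "\<lambda>_. 1" "z ^ (1 mod N)"])
    show "finite ((\<lambda>a. z ^ a) ` unit_kernel)" using finite_unit_kernel by simp
    show "(\<lambda>a. z ^ a) ` unit_kernel \<subseteq> int_span w" using zj root_N_in by auto
    show "x - y \<notin> Q" if "x \<in> (\<lambda>a. z ^ a) ` unit_kernel" "y \<in> (\<lambda>a. z ^ a) ` unit_kernel" "x \<noteq> y" for x y
      using that zj by (intro roots_incongruent) auto
    show "z ^ (1 mod N) \<in> (\<lambda>a. z ^ a) ` unit_kernel" using one_in_unit_kernel by (rule imageI)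
    fix j
    have "(\<Sum>y\<in>(\<lambda>a. z ^ a) ` unit_kernel. 1 * y ^ j) = (\<Sum>a\<in>unit_kernel. (z ^ j) ^ a)"
      by (subst sum.reindex[OF inj]) (simp add: mult.commute flip: power_mult)
    then show "(\<Sum>y\<in>(\<lambda>a. z ^ a) ` unit_kernel. 1 * y ^ j) \<in> Q" using neg zj by simp
  qed auto
  then show False by simp
qed

text \<open>With \<open>t\<close> of trace outside \<open>Q\<close>, an invariant \<open>x\<close> is recovered from \<open>Tr (x t) = x Tr t\<close>;
  this avoids dividing by the degree, which \<open>p\<close> may divide.\<close>

lemma trace_descent:
  assumes v: "\<And>\<theta>. \<theta> \<in> T \<Longrightarrow> v \<theta> ^ N = 1"
    and inv: "\<And>a. a \<in> unit_kernel \<Longrightarrow> (\<Sum>\<theta>\<in>T. v \<theta> ^ a) = (\<Sum>\<theta>\<in>T. v \<theta>)"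
  shows "\<exists>x\<in>int_span \<zeta>. \<exists>y\<in>int_span \<zeta> - Q. (\<Sum>\<theta>\<in>T. v \<theta>) * y = x"
proof -
  have tr: "(\<Sum>a\<in>unit_kernel. t ^ a) \<in> int_span \<zeta>" if "t ^ N = 1" for t
    unfolding unit_kernel_def using root_n0_in n0N N_pos that
    by (intro sum_root_powers_units_in unital_subring_int_span) auto
  obtain t where t: "t ^ N = 1" "(\<Sum>a\<in>unit_kernel. t ^ a) \<notin> Q" using trace_not_in_prime by blast
  have "(\<Sum>\<theta>\<in>T. v \<theta>) * (\<Sum>a\<in>unit_kernel. t ^ a) = (\<Sum>a\<in>unit_kernel. (\<Sum>\<theta>\<in>T. v \<theta> ^ a) * t ^ a)"
    using inv by (simp add: sum_distrib_left)
  also have "\<dots> = (\<Sum>\<theta>\<in>T. \<Sum>a\<in>unit_kernel. (v \<theta> * t) ^ a)"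
    by (subst sum.swap) (simp add: sum_distrib_right power_mult_distrib)
  finally have "(\<Sum>\<theta>\<in>T. v \<theta>) * (\<Sum>a\<in>unit_kernel. t ^ a) = \<dots>" .
  moreover have "(\<Sum>\<theta>\<in>T. \<Sum>a\<in>unit_kernel. (v \<theta> * t) ^ a) \<in> int_span \<zeta>"
    using v t by (intro int_span.sum_mem tr) (simp add: power_mult_distrib)
  ultimately show ?thesis using tr[OF t(1)] t(2) by blast
qed

text \<open>In Galois terms: \<open>stable\<close> says that the automorphisms of Q(w) fixing
  \<zeta> all lie in the decomposition group of \<open>Q\<close>, which acts on \<open>N\<close>-th
  roots of unity through powers of the Frobenius.\<close>

lemma decomposition_group:
  assumes stable: "\<And>a F. coprime a L \<Longrightarrow> [a = 1] (mod n) \<Longrightarrow>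
      ipoly F w \<in> Q \<Longrightarrow> ipoly F (w ^ a) \<in> Q"
    and a: "coprime a N" "[a = 1] (mod n0)"
  shows "\<exists>i. [a = p ^ i] (mod N)"
proof (rule ccontr)
  assume neg: "\<not> ?thesis"
  \<comment> \<open>\<open>a\<close> is only prime to \<open>N\<close>; \<open>b\<close> is a lift
    to a unit modulo \<open>L\<close> that is 1 modulo \<open>n\<close>. The \<open>Suc\<close>
    keeps \<open>b\<close> prime to \<open>p\<close> even when \<open>e = k = 0\<close>.\<close>
  obtain b where b: "[b = a] (mod N)" "[b = 1] (mod p ^ Suc (e + k))"
    using binary_chinese_remainder_nat[of N "p ^ Suc (e + k)" a 1] coprime_pN by (auto simp: coprime_commute)
  have bN: "coprime b N" using b(1) a(1) by (metis cong_imp_coprime cong_sym)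
  have "[b = 1] (mod p)" using b(2) by (rule cong_dvd_modulus_nat) simp
  then have bp: "coprime b p" by (metis cong_imp_coprime cong_sym coprime_1_left)
  have bL: "coprime b L" using bN bp by (simp add: L)
  have "[b = 1] (mod p ^ e)" using b(2) by (rule cong_dvd_modulus_nat) (simp add: le_imp_power_dvd)
  moreover have "[b = 1] (mod n0)" using cong_dvd_modulus_nat[OF b(1) n0N] a(2) by (rule cong_trans)
  ultimately have bn: "[b = 1] (mod n)"
    unfolding n using coprime_n0p by (intro coprime_cong_mult_nat) (auto simp: coprime_commute)
  define r where "r = ord N p"
  have r: "0 < r" "[p ^ r = 1] (mod N)"
    using coprime_pN ord[of p N] by (auto simp: r_def coprime_commute)
  define z where "z = w ^ p ^ k"
  have z: "primitive_root_of_unity N z" "z ^ N = 1"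
    using primitive_N by (auto simp: z_def primitive_root_of_unity_def)
  note zj = root_of_unity_power[OF z(2)]
  have zin: "z ^ j \<in> int_span w" for j using root_N_in[OF zj] .
  \<comment> \<open>The Frobenius orbits of \<open>z\<close> and, with \<open>Y2\<close>, of its
    conjugate \<open>z ^ b\<close>.\<close>
  define Y1 where "Y1 = (\<lambda>i. z ^ p ^ i) ` {..<r}"
  define Y2 where "Y2 = (\<lambda>i. z ^ (b * p ^ i)) ` {..<r}"
  have pinj: "i = j" if "[p ^ i = p ^ j] (mod N)" "i < r" "j < r" for i j
    using that order_divides_expdiff[of N p i j] coprime_pN
    by (simp add: coprime_commute cong_def r_def)
  have inj1: "inj_on (\<lambda>i. z ^ p ^ i) {..<r}"
    using pinj by (auto intro!: inj_onI simp: primitive_root_of_unity_eq_power_iff[OF z(1)])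
  have inj2: "inj_on (\<lambda>i. z ^ (b * p ^ i)) {..<r}"
    using pinj bN by (auto intro!: inj_onI simp: primitive_root_of_unity_eq_power_iff[OF z(1)] cong_mult_lcancel_nat)
  have sums: "(\<Sum>y\<in>Y1. y ^ j) - (\<Sum>y\<in>Y2. y ^ j) \<in> Q" for j
  proof -
    \<comment> \<open>A power sum over the orbit of \<open>z\<close>. Raising to the
      \<open>p\<close>-th power permutes its terms cyclically modulo \<open>Q\<close>, so it is
      congruent to an integer, on which automorphisms act trivially.\<close>
    define \<tau> where "\<tau> = (\<Sum>i<r. (z ^ j) ^ p ^ i)"
    have \<tau>W: "\<tau> \<in> int_span w" unfolding \<tau>_def by (rule int_span.sum_mem, rule int_span.power_mem, rule zin)
    have "\<tau> ^ p ^ 1 - (\<Sum>i<r. ((z ^ j) ^ p ^ i) ^ p ^ 1) \<in> Q"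
      unfolding \<tau>_def by (rule Q.frobenius_sum[OF p pQ], rule int_span.power_mem, rule zin)
    moreover have "(\<Sum>i<r. ((z ^ j) ^ p ^ i) ^ p ^ 1) = \<tau>"
    proof -
      have "(\<Sum>i<r. ((z ^ j) ^ p ^ i) ^ p ^ 1) = (\<Sum>i<r. (z ^ j) ^ p ^ Suc i)"
        by (simp add: mult_ac flip: power_mult)
      also have "\<dots> = (\<Sum>i<Suc r. (z ^ j) ^ p ^ i) - (z ^ j) ^ p ^ 0"
        by (subst sum.lessThan_Suc_shift) simp
      also have "\<dots> = \<tau> + (z ^ j) ^ p ^ r - z ^ j" by (simp add: \<tau>_def)
      also have "(z ^ j) ^ p ^ r = z ^ j"
      proof -
        have "[j * p ^ r = j] (mod N)" using cong_scalar_left[OF r(2), of j] by simp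
        then show ?thesis by (simp only: power_mult[symmetric] primitive_root_of_unity_eq_power_iff[OF z(1)])
      qed
      finally show ?thesis by simp
    qed
    ultimately have "\<tau> ^ p - \<tau> \<in> Q" by simp
    then obtain c :: nat where c: "\<tau> - of_nat c \<in> Q"
      using Q.prime_power_fixed_imp_integer[OF p pQ \<tau>W] by blast
    \<comment> \<open>Represents \<open>\<tau> - c\<close> as a polynomial in \<open>w\<close>; at
      \<open>w ^ b\<close> the orbit of \<open>z\<close> is replaced by that of
      \<open>z ^ b\<close>.\<close>
    define F :: "int poly" where "F = (\<Sum>i<r. Polynomial.monom 1 (p ^ k * j * p ^ i)) - [:int c:]"
    have F: "ipoly F y = (\<Sum>i<r. y ^ (p ^ k * j * p ^ i)) - of_nat c" for y :: complex
      by (simp add: F_def of_int_poly_hom.hom_minus of_int_poly_hom.hom_sum map_poly_monom poly_monom poly_sum of_int_hom.map_poly_pCons_hom)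
    have "ipoly F w = \<tau> - of_nat c"
      by (simp add: F \<tau>_def z_def power_mult)
    then have "ipoly F (w ^ b) \<in> Q" using c by (intro stable bL bn) simp
    moreover have "ipoly F (w ^ b) = (\<Sum>i<r. (z ^ (b * p ^ i)) ^ j) - of_nat c"
      by (simp add: F z_def mult_ac flip: power_mult)
    ultimately have "\<tau> - (\<Sum>i<r. (z ^ (b * p ^ i)) ^ j) \<in> Q"
      using c Q.diff_trans[OF c Q.diff_sym] by simp
    moreover have "(\<Sum>y\<in>Y1. y ^ j) = \<tau>"
      unfolding Y1_def \<tau>_def by (subst sum.reindex[OF inj1]) (simp add: mult.commute flip: power_mult)
    moreover have "(\<Sum>y\<in>Y2. y ^ j) = (\<Sum>i<r. (z ^ (b * p ^ i)) ^ j)"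
      unfolding Y2_def by (subst sum.reindex[OF inj2]) simp
    ultimately show ?thesis by simp
  qed
  have zY1: "z \<in> Y1" using r(1) by (auto simp: Y1_def intro!: image_eqI[of _ _ 0])
  have zY2: "z \<notin> Y2"
  proof
    assume "z \<in> Y2"
    then obtain i where i: "i < r" "z ^ 1 = z ^ (b * p ^ i)" by (auto simp: Y2_def)
    then have "[b * p ^ i = 1] (mod N)"
      by (simp only: primitive_root_of_unity_eq_power_iff[OF z(1)] cong_sym)
    then have "[b * p ^ i * p ^ (r - i) = 1 * p ^ (r - i)] (mod N)" by (rule cong_scalar_right)
    moreover have "b * p ^ i * p ^ (r - i) = b * p ^ r" using i(1) by (simp add: mult.assoc flip: power_add)
    moreover have "[b * p ^ r = b * 1] (mod N)" using r(2) by (rule cong_scalar_left)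
    ultimately have "[b = p ^ (r - i)] (mod N)" by (simp add: cong_def)
    then have "[a = p ^ (r - i)] (mod N)" using b(1) by (metis cong_sym cong_trans)
    then show False using neg by blast
  qed
  \<comment> \<open>Both orbits have the same power sums modulo \<open>Q\<close>, so the Vandermonde
    argument applies to the difference of their indicator functions, which is 1 at
    \<open>z\<close>.\<close>
  define c :: "complex \<Rightarrow> complex" where "c = (\<lambda>y. of_bool (y \<in> Y1) - of_bool (y \<in> Y2))"
  have fin: "finite Y1" "finite Y2" by (auto simp: Y1_def Y2_def)
  have YN: "y ^ N = 1" if "y \<in> Y1 \<union> Y2" for y using that zj by (auto simp: Y1_def Y2_def)
  have "c z \<in> Q"
  proof (rule Q.vandermonde_mod[of "Y1 \<union> Y2" c])
    show "Y1 \<union> Y2 \<subseteq> int_span w" using YN root_N_in by blast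
    show "x - y \<notin> Q" if "x \<in> Y1 \<union> Y2" "y \<in> Y1 \<union> Y2" "x \<noteq> y" for x y
      using that YN by (intro roots_incongruent) auto
    show "c y \<in> int_span w" for y by (auto simp: c_def)
    show "z \<in> Y1 \<union> Y2" using zY1 by simp
    fix j
    have "(\<Sum>y\<in>Y1 \<union> Y2. c y * y ^ j) = (\<Sum>y\<in>Y1 \<union> Y2. if y \<in> Y1 then y ^ j else 0) - (\<Sum>y\<in>Y1 \<union> Y2. if y \<in> Y2 then y ^ j else 0)"
      by (simp add: c_def left_diff_distrib sum_subtractf of_bool_def if_distrib[of "\<lambda>x. x * _"] cong: if_cong)
    also have "\<dots> = (\<Sum>y\<in>Y1. y ^ j) - (\<Sum>y\<in>Y2. y ^ j)"
      using fin by (simp add: sum.inter_restrict[symmetric] Int_absorb1)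
    finally show "(\<Sum>y\<in>Y1 \<union> Y2. c y * y ^ j) \<in> Q" using sums by simp
  qed (use fin in auto)
  then show False using zY1 zY2 by (simp add: c_def)
qed

end

section \<open>Characters of finite abelian groups\<close>

locale finite_abelian_group = comm_group +
  assumes finite_carrier [simp, intro]: "finite (carrier G)"
begin

text \<open>Extensionality makes agreement on the group the same as equality of functions, so that
  characters can be counted and summed over.\<close>

definition characters :: "('a \<Rightarrow> complex) set"
  where "characters = {\<chi> \<in> extensional (carrier G). \<chi> \<one> = 1 \<and>
    (\<forall>x\<in>carrier G. \<forall>y\<in>carrier G. \<chi> (x \<otimes> y) = \<chi> x * \<chi> y)}"

lemma order_pos: "0 < Coset.order G"
  by (simp add: order_gt_0_iff_finite)

lemma character_one: "\<chi> \<in> characters \<Longrightarrow> \<chi> \<one> = 1"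
  by (simp add: characters_def)

lemma character_mult:
  "\<chi> \<in> characters \<Longrightarrow> x \<in> carrier G \<Longrightarrow> y \<in> carrier G \<Longrightarrow> \<chi> (x \<otimes> y) = \<chi> x * \<chi> y"
  by (simp add: characters_def)

lemma character_pow:
  "\<chi> \<in> characters \<Longrightarrow> x \<in> carrier G \<Longrightarrow> \<chi> (x [^] (k::nat)) = \<chi> x ^ k"
  by (induction k) (simp_all add: character_one character_mult)

lemma character_pow_order: "\<chi> \<in> characters \<Longrightarrow> x \<in> carrier G \<Longrightarrow> \<chi> x ^ Coset.order G = 1"
  by (metis character_one character_pow pow_order_eq_1)

lemma character_nonzero: "\<chi> \<in> characters \<Longrightarrow> x \<in> carrier G \<Longrightarrow> \<chi> x \<noteq> 0"
  using character_pow_order[of \<chi> x] order_pos by (auto simp: zero_power)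

lemma character_inv: "\<chi> \<in> characters \<Longrightarrow> x \<in> carrier G \<Longrightarrow> \<chi> x * \<chi> (inv x) = 1"
  by (metis character_mult character_one inv_closed r_inv)

lemma characterI:
  assumes "f \<one> = 1" "\<And>x y. x \<in> carrier G \<Longrightarrow> y \<in> carrier G \<Longrightarrow> f (x \<otimes> y) = f x * f y"
  shows "restrict f (carrier G) \<in> characters"
  using assms by (simp add: characters_def)

lemma finite_characters [simp, intro]: "finite characters"
proof (rule finite_subset)
  show "characters \<subseteq> carrier G \<rightarrow>\<^sub>E {w. w ^ Coset.order G = 1}"
    using character_pow_order by (auto simp: characters_def PiE_def)
  show "finite (carrier G \<rightarrow>\<^sub>E {w :: complex. w ^ Coset.order G = 1})"
    using order_pos by (intro finite_PiE finite_nth_roots) auto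
qed

lemma trivial_character: "restrict (\<lambda>_. 1) (carrier G) \<in> characters"
  by (rule characterI) auto

lemma character_power:
  "\<chi> \<in> characters \<Longrightarrow> restrict (\<lambda>x. \<chi> x ^ k) (carrier G) \<in> characters"
  by (rule characterI) (auto simp: character_one character_mult power_mult_distrib)

lemma character_times:
  "\<chi> \<in> characters \<Longrightarrow> \<psi> \<in> characters \<Longrightarrow> restrict (\<lambda>x. \<chi> x * \<psi> x) (carrier G) \<in> characters"
  by (rule characterI) (auto simp: character_one character_mult)

lemma sum_characters_subgroup:
  assumes H: "subgroup H G" and \<chi>: "\<chi> \<in> characters"
  shows "(\<Sum>h\<in>H. \<chi> h) = (if \<forall>h\<in>H. \<chi> h = 1 then of_nat (card H) else 0)"
proof (cases "\<forall>h\<in>H. \<chi> h = 1")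
  case False
  then obtain a where a: "a \<in> H" "\<chi> a \<noteq> 1" by blast
  have HG: "H \<subseteq> carrier G" using H by (rule subgroup.subset)
  have "(\<Sum>h\<in>H. \<chi> h) = (\<Sum>h\<in>H. \<chi> (a \<otimes> h))"
  proof (rule sum.reindex_bij_witness[of _ "\<lambda>h. a \<otimes> h" "\<lambda>h. inv a \<otimes> h"])
    fix h assume "h \<in> H"
    then show "a \<otimes> (inv a \<otimes> h) = h" "inv a \<otimes> (a \<otimes> h) = h"
      "inv a \<otimes> h \<in> H" "a \<otimes> h \<in> H" "\<chi> (a \<otimes> (inv a \<otimes> h)) = \<chi> h"
      using a HG H by (auto simp: m_assoc[symmetric] subset_iff subgroup.m_closed subgroup.m_inv_closed)
  qed
  also have "\<dots> = \<chi> a * (\<Sum>h\<in>H. \<chi> h)"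
    using a HG \<chi> by (auto simp: sum_distrib_left subset_iff character_mult intro!: sum.cong)
  finally have "(1 - \<chi> a) * (\<Sum>h\<in>H. \<chi> h) = 0" by (simp add: algebra_simps)
  then have "(\<Sum>h\<in>H. \<chi> h) = 0" using a by simp
  then show ?thesis using False by (simp only: if_False)
qed simp

lemma character_orthogonality:
  assumes H: "subgroup H G" and \<chi>: "\<chi> \<in> characters" and \<psi>: "\<psi> \<in> characters"
  shows "(\<Sum>h\<in>H. \<chi> h * \<psi> (inv h)) = (if \<forall>h\<in>H. \<chi> h = \<psi> h then of_nat (card H) else 0)"
proof -
  let ?q = "restrict (\<lambda>x. \<chi> x * \<psi> (inv x)) (carrier G)"
  have HG: "h \<in> carrier G" if "h \<in> H" for h using subgroup.subset[OF H] that by blast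
  have q: "?q \<in> characters"
    using \<chi> \<psi> by (intro characterI) (auto simp: character_one character_mult inv_mult)
  have "?q h = 1 \<longleftrightarrow> \<chi> h = \<psi> h" if "h \<in> H" for h
  proof -
    have "?q h = 1 \<longleftrightarrow> \<chi> h * \<psi> (inv h) = \<psi> h * \<psi> (inv h)"
      using HG[OF that] by (simp add: character_inv[OF \<psi>])
    then show ?thesis using character_nonzero[OF \<psi>, of "inv h"] HG[OF that] by auto
  qed
  moreover have "(\<Sum>h\<in>H. \<chi> h * \<psi> (inv h)) = (\<Sum>h\<in>H. ?q h)" using HG by (intro sum.cong) auto
  ultimately show ?thesis using sum_characters_subgroup[OF H q] by (simp cong: ball_cong)
qed

text \<open>Restricted to the translates by a new element \<open>h\<close>, the function is the average of its
  projections to the eigenspaces of \<open>h\<close>, so one of these is nonzero; it keeps the old eigenvalues.\<close>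

lemma simultaneous_eigenfunction:
  fixes w :: complex
  assumes g: "g \<in> carrier G" and w: "\<And>i::nat. g [^] i = \<one> \<Longrightarrow> w ^ i = 1"
    and A: "finite A" "A \<subseteq> carrier G"
  shows "\<exists>f :: 'a \<Rightarrow> complex. (\<exists>x\<in>carrier G. f x \<noteq> 0) \<and> (\<forall>x\<in>carrier G. f (x \<otimes> g) = w * f x) \<and>
    (\<forall>y\<in>A. \<exists>c. \<forall>x\<in>carrier G. f (x \<otimes> y) = c * f x)"
  using A
proof (induction A rule: finite_induct)
  case empty
  have wpow: "w ^ i = w ^ j" if "g [^] i = g [^] j" "i \<le> j" for i j :: nat
  proof -
    have "g [^] i \<otimes> g [^] (j - i) = g [^] i \<otimes> \<one>"
      using that g nat_pow_mult[of g i "j - i"] by simp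
    then have "g [^] (j - i) = \<one>" using g by (metis l_cancel nat_pow_closed one_closed)
    then have "w ^ (j - i) = 1" by (rule w)
    then show ?thesis using that by (metis le_add_diff_inverse mult.right_neutral power_add)
  qed
  \<comment> \<open>Extends \<open>g [^] i \<mapsto> w ^ i\<close> by 0 outside the cyclic group of
    \<open>g\<close>; by \<open>wpow\<close> the choice of \<open>i\<close> does not matter.\<close>
  define f where "f = (\<lambda>x. if \<exists>i::nat. x = g [^] i then w ^ (SOME i::nat. x = g [^] i) else 0)"
  have fpow: "f (g [^] i) = w ^ i" for i :: nat
  proof -
    let ?j = "SOME j::nat. g [^] i = g [^] j"
    have "g [^] i = g [^] ?j" by (rule someI) (rule refl)
    then have "w ^ i = w ^ ?j" using wpow[of i ?j] wpow[of ?j i] by (metis nat_le_linear)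
    then show ?thesis unfolding f_def by auto
  qed
  have "f (x \<otimes> g) = w * f x" if x: "x \<in> carrier G" for x
  proof (cases "\<exists>i::nat. x = g [^] i")
    case True
    then obtain i :: nat where "x = g [^] i" by blast
    then show ?thesis using fpow[of "Suc i"] fpow[of i] by (simp add: nat_pow_Suc)
  next
    case False
    have "\<not> (\<exists>i::nat. x \<otimes> g = g [^] i)"
    proof
      assume "\<exists>i::nat. x \<otimes> g = g [^] i"
      then obtain i :: nat where i: "x \<otimes> g = g [^] i" by blast
      have o: "Coset.order G = Suc (Coset.order G - 1)" using order_pos by simp
      have gg: "g \<otimes> g [^] (Coset.order G - 1) = \<one>"
        using g o nat_pow_Suc2[OF g, of "Coset.order G - 1"] by (simp add: pow_order_eq_1)
      have "x = x \<otimes> (g \<otimes> g [^] (Coset.order G - 1))" using x gg by simp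
      also have "\<dots> = g [^] i \<otimes> g [^] (Coset.order G - 1)"
        using x g i by (simp add: m_assoc[symmetric])
      also have "\<dots> = g [^] (i + (Coset.order G - 1))" using g by (simp add: nat_pow_mult)
      finally show False using False by blast
    qed
    then show ?thesis using False by (simp add: f_def)
  qed
  moreover have "f \<one> \<noteq> 0" using fpow[of 0] by simp
  ultimately show ?case by blast
next
  case (insert h A)
  then obtain f :: "'a \<Rightarrow> complex" and x0 where f: "x0 \<in> carrier G" "f x0 \<noteq> 0"
      "\<And>x. x \<in> carrier G \<Longrightarrow> f (x \<otimes> g) = w * f x"
      "\<And>y. y \<in> A \<Longrightarrow> \<exists>c. \<forall>x\<in>carrier G. f (x \<otimes> y) = c * f x"
    by auto
  have h: "h \<in> carrier G" and AG: "A \<subseteq> carrier G" using insert by auto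
  define m where "m = Coset.order G"
  have m: "0 < m" using order_pos by (simp add: m_def)
  have hm: "h [^] m = \<one>" using h by (simp add: m_def pow_order_eq_1)
  define z where "z = cis (2 * pi / m)"
  have zpow: "z ^ k = cis (2 * pi * real k / m)" for k
    by (simp add: z_def DeMoivre mult_ac)
  have zm: "z ^ m = 1" using m by (simp add: zpow)
  have z1: "z ^ k \<noteq> 1" if "0 < k" "k < m" for k
    unfolding zpow using that by (rule cis_root_of_unity_neq_1)
  \<comment> \<open>Up to the factor \<open>m\<close>, the projection of \<open>f\<close> to an
    eigenspace of translation by \<open>h\<close>; as \<open>h [^] m\<close> is neutral, the
    eigenvalues are \<open>m\<close>-th roots of unity.\<close>
  define F where "F = (\<lambda>j x. \<Sum>i<m. (z ^ j) ^ i * f (x \<otimes> h [^] i))"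
  have "(\<Sum>j<m. F j x0) = (\<Sum>i<m. (\<Sum>j<m. (z ^ i) ^ j) * f (x0 \<otimes> h [^] i))"
    unfolding F_def
    by (subst sum.swap) (simp add: sum_distrib_left sum_distrib_right mult.commute flip: power_mult)
  also have "\<dots> = (\<Sum>i<m. if i = 0 then of_nat m * f x0 else 0)"
  proof (intro sum.cong refl)
    fix i assume i: "i \<in> {..<m}"
    show "(\<Sum>j<m. (z ^ i) ^ j) * f (x0 \<otimes> h [^] i) = (if i = 0 then of_nat m * f x0 else 0)"
    proof (cases "i = 0")
      case False
      have "(\<Sum>j<m. (z ^ i) ^ j) = 0"
        using i False by (intro sum_powers_root_of_unity root_of_unity_power zm z1) auto
      then show ?thesis using False by simp
    qed (use f in simp)
  qed
  also have "\<dots> = of_nat m * f x0" using m by simp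
  finally have "(\<Sum>j<m. F j x0) \<noteq> 0" using m f by simp
  then obtain j where j: "F j x0 \<noteq> 0" by (meson sum.neutral)
  have shift: "F j (x \<otimes> y) = c * F j x"
    if "x \<in> carrier G" "y \<in> carrier G" "\<forall>x\<in>carrier G. f (x \<otimes> y) = c * f x" for x y c
  proof -
    have "f (x \<otimes> y \<otimes> h [^] i) = c * f (x \<otimes> h [^] i)" for i :: nat
    proof -
      have "x \<otimes> y \<otimes> h [^] i = x \<otimes> h [^] i \<otimes> y" using that h by (simp add: m_ac)
      then show ?thesis using that h by simp
    qed
    then show ?thesis by (simp add: F_def sum_distrib_left mult_ac)
  qed
  have hj: "(z ^ j) * F j (x \<otimes> h) = F j x" if x: "x \<in> carrier G" for x
  proof -
    let ?a = "\<lambda>i. (z ^ j) ^ i * f (x \<otimes> h [^] i)"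
    have "(z ^ j) * F j (x \<otimes> h) = (\<Sum>i<m. ?a (Suc i))"
      unfolding F_def using x h nat_pow_Suc2[OF h] by (simp add: sum_distrib_left m_assoc mult_ac del: nat_pow_Suc)
    also have "\<dots> = (\<Sum>i<Suc m. ?a i) - ?a 0" by (subst sum.lessThan_Suc_shift) simp
    also have "\<dots> = F j x + ?a m - ?a 0" by (simp add: F_def)
    also have "?a m = ?a 0" using hm zm x by (simp flip: power_mult) (metis mult.commute power_mult power_one)
    finally show ?thesis by simp
  qed
  have z0: "z ^ j \<noteq> 0" using zm m by (auto simp: zero_power)
  have "\<exists>c. \<forall>x\<in>carrier G. F j (x \<otimes> y) = c * F j x" if y: "y \<in> insert h A" for y
  proof (cases "y = h")
    case True
    have "F j (x \<otimes> h) = inverse (z ^ j) * F j x" if "x \<in> carrier G" for x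
      using hj[OF that] z0 by (simp add: field_simps)
    then show ?thesis using True by blast
  next
    case False
    then have yA: "y \<in> A" using y by simp
    then have "y \<in> carrier G" using AG by (rule subsetD[rotated])
    obtain c where "\<forall>x\<in>carrier G. f (x \<otimes> y) = c * f x" using f(4)[OF yA] by (rule exE)
    then have "\<forall>x\<in>carrier G. F j (x \<otimes> y) = c * F j x"
      using shift \<open>y \<in> carrier G\<close> by (intro ballI)
    then show ?thesis by (rule exI)
  qed
  moreover have "\<forall>x\<in>carrier G. F j (x \<otimes> g) = w * F j x"
    using shift[of _ g w] g f(3) by simp
  ultimately show ?case using j f(1) by (intro exI[of _ "F j"] conjI ballI bexI[of _ x0]) simp_all
qed

text \<open>For an eigenfunction of all translations, the eigenvalue as a function of the
  translating element is multiplicative; at \<open>g\<close> it is the prescribed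
  \<open>w\<close>.\<close>

lemma character_extension:
  fixes w :: complex
  assumes g: "g \<in> carrier G" and w: "\<And>i::nat. g [^] i = \<one> \<Longrightarrow> w ^ i = 1"
  shows "\<exists>\<chi>\<in>characters. \<chi> g = w"
proof -
  obtain f :: "'a \<Rightarrow> complex" and x0 where f: "x0 \<in> carrier G" "f x0 \<noteq> 0"
      "\<And>x. x \<in> carrier G \<Longrightarrow> f (x \<otimes> g) = w * f x"
      "\<And>y. y \<in> carrier G \<Longrightarrow> \<exists>c. \<forall>x\<in>carrier G. f (x \<otimes> y) = c * f x"
    using simultaneous_eigenfunction[OF g w finite_carrier] by auto
  define \<chi> where "\<chi> = (\<lambda>y. f (x0 \<otimes> y) / f x0)"
  have \<chi>: "f (x \<otimes> y) = \<chi> y * f x" if "x \<in> carrier G" "y \<in> carrier G" for x y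
    using f(4)[OF that(2)] that f(1,2) by (auto simp: \<chi>_def)
  have "restrict \<chi> (carrier G) \<in> characters"
  proof (rule characterI)
    show "\<chi> \<one> = 1" using f by (simp add: \<chi>_def)
    fix x y assume xy: "x \<in> carrier G" "y \<in> carrier G"
    have "f (x0 \<otimes> (x \<otimes> y)) = \<chi> y * (\<chi> x * f x0)"
      using \<chi>[of "x0 \<otimes> x" y] \<chi>[of x0 x] xy f(1) by (simp add: m_assoc)
    then have "\<chi> (x \<otimes> y) * f x0 = (\<chi> x * \<chi> y) * f x0"
      using \<chi>[of x0 "x \<otimes> y"] xy f(1) by (metis m_closed mult.assoc mult.commute)
    then show "\<chi> (x \<otimes> y) = \<chi> x * \<chi> y" using f(2) by (metis mult_cancel_right)
  qed
  moreover have "restrict \<chi> (carrier G) g = w" using g f by (simp add: \<chi>_def)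
  ultimately show ?thesis by blast
qed

text \<open>With \<open>k\<close> the order of \<open>g\<close>, a primitive \<open>k\<close>-th
  root of unity is an admissible value at \<open>g\<close>, and it is not 1.\<close>

lemma characters_separate:
  assumes g: "g \<in> carrier G" "g \<noteq> \<one>"
  shows "\<exists>\<chi>\<in>characters. \<chi> g \<noteq> 1"
proof -
  define k where "k = (LEAST k::nat. 0 < k \<and> g [^] k = \<one>)"
  have "0 < Coset.order G \<and> g [^] Coset.order G = \<one>" using g order_pos by (simp add: pow_order_eq_1)
  then have k: "0 < k \<and> g [^] k = \<one>" unfolding k_def by (rule LeastI)
  have kmin: "k \<le> i" if "0 < i" "g [^] i = \<one>" for i
    unfolding k_def using that by (intro Least_le) auto
  have k1: "1 < k" using k g by (cases "k = 1") auto
  define w where "w = cis (2 * pi / k)"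
  have wk: "w ^ k = 1" using k by (simp add: w_def DeMoivre)
  have "w \<noteq> 1" using cis_root_of_unity_neq_1[of 1 k] k1 by (simp add: w_def)
  moreover have "w ^ i = 1" if i: "g [^] i = \<one>" for i :: nat
  proof -
    have "g [^] i = g [^] (k * (i div k)) \<otimes> g [^] (i mod k)"
      using g by (simp add: nat_pow_mult)
    also have "g [^] (k * (i div k)) = \<one>" using g k by (simp flip: nat_pow_pow)
    finally have "g [^] (i mod k) = \<one>" using i g by simp
    then have "i mod k = 0" using kmin[of "i mod k"] k mod_less_divisor[of k i] by (metis not_gr_zero not_le)
    then have "k dvd i" by (simp add: dvd_eq_mod_eq_0)
    then show ?thesis using wk by (auto elim!: dvdE simp: power_mult)
  qed
  ultimately show ?thesis using character_extension[OF g(1), of w] by metis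
qed

lemma sum_over_characters:
  assumes g: "g \<in> carrier G"
  shows "(\<Sum>\<chi>\<in>characters. \<chi> g) = (if g = \<one> then of_nat (card characters) else 0)"
proof (cases "g = \<one>")
  case False
  then obtain \<psi> where \<psi>: "\<psi> \<in> characters" "\<psi> g \<noteq> 1" using characters_separate g by blast
  let ?t = "\<lambda>\<chi>. restrict (\<lambda>x. \<psi> x * \<chi> x) (carrier G)"
  have "inj_on ?t characters"
  proof (rule inj_onI)
    fix \<chi> \<chi>' assume c: "\<chi> \<in> characters" "\<chi>' \<in> characters" "?t \<chi> = ?t \<chi>'"
    show "\<chi> = \<chi>'"
    proof (rule extensionalityI[of _ "carrier G"])
      fix x assume x: "x \<in> carrier G"
      then show "\<chi> x = \<chi>' x" using fun_cong[OF c(3), of x] character_nonzero[OF \<psi>(1) x] by simp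
    qed (use c in \<open>auto simp: characters_def\<close>)
  qed
  moreover have "?t ` characters \<subseteq> characters" using character_times \<psi> by blast
  ultimately have bij: "bij_betw ?t characters characters"
    by (simp add: bij_betw_def endo_inj_surj)
  have "(\<Sum>\<chi>\<in>characters. \<chi> g) = (\<Sum>\<chi>\<in>characters. ?t \<chi> g)"
    by (rule sum.reindex_bij_betw[OF bij, symmetric])
  also have "\<dots> = \<psi> g * (\<Sum>\<chi>\<in>characters. \<chi> g)" using g by (simp add: sum_distrib_left)
  finally have "(1 - \<psi> g) * (\<Sum>\<chi>\<in>characters. \<chi> g) = 0" by (simp add: algebra_simps)
  then show ?thesis using \<psi> False by simp
qed (simp add: character_one)

text \<open>Summing \<open>\<chi> g\<close> over all \<open>g\<close> and \<chi> leaves, depending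
  on the order of summation, only the neutral element or only the trivial character.\<close>

lemma card_characters: "card characters = card (carrier G)"
proof -
  have triv: "(\<forall>x\<in>carrier G. \<chi> x = 1) \<longleftrightarrow> \<chi> = restrict (\<lambda>_. 1) (carrier G)" if "\<chi> \<in> characters" for \<chi>
    using that by (auto simp: characters_def intro!: extensionalityI[of _ "carrier G"])
  have "(of_nat (card characters) :: complex) = (\<Sum>g\<in>carrier G. \<Sum>\<chi>\<in>characters. \<chi> g)"
    by (simp add: sum_over_characters)
  also have "\<dots> = (\<Sum>\<chi>\<in>characters. \<Sum>g\<in>carrier G. \<chi> g)" by (rule sum.swap)
  also have "\<dots> = (\<Sum>\<chi>\<in>characters. if \<chi> = restrict (\<lambda>_. 1) (carrier G) then of_nat (card (carrier G)) else 0)"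
    using sum_characters_subgroup[OF subgroup_self] triv by (intro sum.cong) auto
  also have "\<dots> = of_nat (card (carrier G))" using trivial_character by simp
  finally show ?thesis by (simp only: of_nat_eq_iff)
qed

section \<open>The exponent of the group, and an element of that order\<close>

lemma group_exponent_pos: "0 < group_exponent G"
  and pow_group_exponent: "x \<in> carrier G \<Longrightarrow> x [^] group_exponent G = \<one>"
  and group_exponent_le:
    "0 < e \<Longrightarrow> (\<And>x. x \<in> carrier G \<Longrightarrow> x [^] e = \<one>) \<Longrightarrow> group_exponent G \<le> e"
proof -
  have "0 < Coset.order G \<and> (\<forall>x\<in>carrier G. x [^] Coset.order G = \<one>)"
    using order_pos by (simp add: pow_order_eq_1)
  then have *: "0 < group_exponent G \<and> (\<forall>x\<in>carrier G. x [^] group_exponent G = \<one>)"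
    unfolding group_exponent_def by (rule LeastI)
  then show "0 < group_exponent G" "x \<in> carrier G \<Longrightarrow> x [^] group_exponent G = \<one>" by auto
  show "0 < e \<Longrightarrow> (\<And>x. x \<in> carrier G \<Longrightarrow> x [^] e = \<one>) \<Longrightarrow> group_exponent G \<le> e"
    unfolding group_exponent_def by (rule Least_le) auto
qed

lemma pow_eq_one_dvd: "x \<in> carrier G \<Longrightarrow> x [^] (k::nat) = \<one> \<Longrightarrow> k dvd m \<Longrightarrow> x [^] m = \<one>"
  by (auto elim!: dvdE simp flip: nat_pow_pow)

lemma pow_gcd_eq_one:
  assumes "x \<in> carrier G" "x [^] (a::nat) = \<one>" "x [^] (b::nat) = \<one>"
  shows "x [^] gcd a b = \<one>"
  using assms pow_eq_id[OF assms(1)] by simp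

text \<open>It suffices that \<open>g [^] (M div l) \<noteq> \<one>\<close> for every prime
  \<open>l\<close> dividing \<open>M\<close>. By minimality of \<open>M\<close> each such prime is
  served by some element; the primary parts of these elements are multiplied together.\<close>

lemma element_of_order_group_exponent:
  "\<exists>g\<in>carrier G. \<forall>i::nat. g [^] i = \<one> \<longrightarrow> group_exponent G dvd i"
proof -
  define M where "M = group_exponent G"
  have M: "0 < M" "\<And>x. x \<in> carrier G \<Longrightarrow> x [^] M = \<one>"
    using group_exponent_pos pow_group_exponent by (auto simp: M_def)
  have decomp: "\<exists>k r. M = q ^ Suc k * r \<and> \<not> q dvd r" if q: "Factorial_Ring.prime q" "q dvd M" for q
  proof -
    have "multiplicity q M > 0" using q M by (simp add: prime_multiplicity_gt_zero_iff)
    moreover obtain r where "M = q ^ multiplicity q M * r" "\<not> q dvd r"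
      using multiplicity_decompose'[of M q] q M by (metis not_prime_unit not_gr_zero)
    ultimately show ?thesis by (metis Suc_pred')
  qed
  have "\<exists>g\<in>carrier G. \<forall>l\<in>S. g [^] (M div l) \<noteq> \<one>"
    if "finite S" "S \<subseteq> {l. Factorial_Ring.prime l \<and> l dvd M}" for S
  proof -
    \<comment> \<open>The second clause strengthens the induction: as \<open>g [^] (M div q)\<close>
      is still neutral for a new prime \<open>q\<close>, the product with the new factor is
      nontrivial there.\<close>
    have "\<exists>g\<in>carrier G. (\<forall>l\<in>S. g [^] (M div l) \<noteq> \<one>) \<and>
      (\<forall>l. Factorial_Ring.prime l \<and> l dvd M \<and> l \<notin> S \<longrightarrow> g [^] (M div l) = \<one>)"
      using that
    proof (induction S rule: finite_induct)
      case empty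
      show ?case by (intro bexI[of _ \<one>]) auto
    next
      case (insert q S)
      then obtain g where g: "g \<in> carrier G" "\<And>l. l \<in> S \<Longrightarrow> g [^] (M div l) \<noteq> \<one>"
          "\<And>l. Factorial_Ring.prime l \<Longrightarrow> l dvd M \<Longrightarrow> l \<notin> S \<Longrightarrow> g [^] (M div l) = \<one>" by auto
      have q: "Factorial_Ring.prime q" "q dvd M" using insert.prems by auto
      then obtain k r where kr: "M = q ^ Suc k * r" "\<not> q dvd r" using decomp by blast
      have Mq: "M div q = q ^ k * r" using q by (simp add: kr prime_gt_0_nat)
      have r0: "0 < r" using M kr by (cases r) auto
      have "0 < M div q" using Mq q r0 by (simp add: prime_gt_0_nat)
      moreover have "M div q < M" using M(1) q(1) by (intro div_less_dividend) (auto dest: prime_gt_1_nat)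
      then have "\<not> M \<le> M div q" by simp
      ultimately obtain x where x: "x \<in> carrier G" "x [^] (M div q) \<noteq> \<one>"
        using group_exponent_le[of "M div q"] unfolding M_def[symmetric] by blast
      \<comment> \<open>The \<open>q\<close>-part of \<open>x\<close>: its order divides a power of
        \<open>q\<close>, so it does not disturb the other primes.\<close>
      define y where "y = x [^] r"
      have y: "y \<in> carrier G" using x by (simp add: y_def)
      have yq: "y [^] (q ^ Suc k) = \<one>"
        using x M(2)[of x] by (simp add: y_def nat_pow_pow kr mult.commute del: power_Suc)
      have yM: "y [^] (M div q) \<noteq> \<one>"
      proof
        assume "y [^] (M div q) = \<one>"
        then have "y [^] gcd (q ^ k * r) (q ^ k * q) = \<one>"
          using yq y by (intro pow_gcd_eq_one) (simp_all add: Mq mult.commute)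
        moreover have "gcd (q ^ k * r) (q ^ k * q) = q ^ k"
        proof -
          have "gcd r q = 1" using kr(2) q(1) prime_imp_coprime[of q r]
            by (simp add: coprime_imp_gcd_eq_1 gcd.commute)
          then show ?thesis by (simp add: gcd_mult_distrib_nat[symmetric])
        qed
        ultimately have "x [^] (r * q ^ k) = \<one>" using x by (simp add: y_def nat_pow_pow)
        then show False using x Mq by (simp add: mult.commute)
      qed
      have yl: "y [^] (M div l) = \<one>" if l: "Factorial_Ring.prime l" "l dvd M" "l \<noteq> q" for l
      proof (rule pow_eq_one_dvd[OF y yq])
        have "coprime l (q ^ Suc k)" using l q primes_coprime by (intro coprime_power_right_iff[THEN iffD2]) auto
        moreover have "l * (M div l) = q ^ Suc k * r" using l kr by simp
        ultimately show "q ^ Suc k dvd M div l"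
          by (metis coprime_commute coprime_dvd_mult_right_iff dvd_triv_left)
      qed
      have pow: "(g \<otimes> y) [^] i = g [^] i \<otimes> y [^] i" for i :: nat
        using g y by (simp add: nat_pow_distrib)
      show ?case
      proof (intro bexI[of _ "g \<otimes> y"] conjI ballI allI impI)
        fix l assume l: "l \<in> insert q S"
        show "(g \<otimes> y) [^] (M div l) \<noteq> \<one>"
        proof (cases "l = q")
          case True
          then show ?thesis using pow g(3)[OF q insert.hyps(2)] yM y by simp
        next
          case False
          then have "y [^] (M div l) = \<one>" using l insert.prems by (intro yl) auto
          then show ?thesis using pow g l False by simp
        qed
      next
        fix l assume "Factorial_Ring.prime l \<and> l dvd M \<and> l \<notin> insert q S"
        then show "(g \<otimes> y) [^] (M div l) = \<one>" using pow g yl by auto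
      qed (use g y in auto)
    qed
    then show ?thesis by blast
  qed
  from this[of "{l. Factorial_Ring.prime l \<and> l dvd M}"]
  obtain g where g: "g \<in> carrier G" "\<And>l. Factorial_Ring.prime l \<Longrightarrow> l dvd M \<Longrightarrow> g [^] (M div l) \<noteq> \<one>"
    using M(1) by auto
  have "M dvd i" if i: "g [^] i = \<one>" for i :: nat
  proof -
    define d where "d = gcd i M"
    have gd: "g [^] d = \<one>" unfolding d_def using g i M by (intro pow_gcd_eq_one) auto
    have dM: "d dvd M" by (simp add: d_def)
    have "M div d = 1"
    proof (rule ccontr)
      assume "M div d \<noteq> 1"
      then obtain l where l: "Factorial_Ring.prime l" "l dvd M div d" using prime_factor_nat by blast
      have "l * d dvd M" using l dM M by (metis dvd_div_iff_mult dvd_0_left_iff mult.commute not_gr_zero)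
      then have "d dvd M div l" "l dvd M" using l
        by (metis dvd_div_iff_mult dvd_mult_left not_prime_0 mult.commute, metis dvd_mult_left)
      then show False using pow_eq_one_dvd[OF g(1) gd] g(2) l by blast
    qed
    then have "M = d" using dM by (metis dvd_mult_div_cancel mult.right_neutral)
    then show ?thesis unfolding d_def by (metis gcd_dvd1)
  qed
  then show ?thesis using g by (auto simp: M_def)
qed

end

section \<open>Subrings of the complex numbers as rings with carrier\<close>

abbreviation complex_subring :: "complex set \<Rightarrow> complex ring"
  where "complex_subring A \<equiv> ring_of_type_algebra\<lparr>carrier := A\<rparr>"

lemma ring_of_type_algebra_simps [simp]:
  "carrier ring_of_type_algebra = UNIV"
  "x \<otimes>\<^bsub>ring_of_type_algebra\<^esub> y = x * y" "\<one>\<^bsub>ring_of_type_algebra\<^esub> = 1"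
  "x \<oplus>\<^bsub>ring_of_type_algebra\<^esub> y = x + y" "\<zero>\<^bsub>ring_of_type_algebra\<^esub> = 0"
  by (simp_all add: ring_of_type_algebra_def)

lemma complex_subring_simps [simp]:
  "carrier (complex_subring A) = A"
  "x \<otimes>\<^bsub>complex_subring A\<^esub> y = x * y" "\<one>\<^bsub>complex_subring A\<^esub> = 1"
  "x \<oplus>\<^bsub>complex_subring A\<^esub> y = x + y" "\<zero>\<^bsub>complex_subring A\<^esub> = 0"
  by (simp_all add: ring_of_type_algebra_def)

lemma a_inv_ring_of_type_algebra [simp]: "\<ominus>\<^bsub>ring_of_type_algebra\<^esub> x = - (x :: complex)"
proof -
  interpret ring "ring_of_type_algebra :: complex ring" by (rule ring_from_type_algebra)
  show ?thesis by (rule minus_equality) simp_all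
qed

lemma m_inv_complex:
  assumes "x \<in> F" "inverse x \<in> F" "x \<noteq> 0"
  shows "inv\<^bsub>complex_subring F\<^esub> x = inverse x"
  unfolding m_inv_def
proof (rule the_equality)
  fix y assume "y \<in> carrier (complex_subring F) \<and> x \<otimes>\<^bsub>complex_subring F\<^esub> y = \<one>\<^bsub>complex_subring F\<^esub> \<and>
    y \<otimes>\<^bsub>complex_subring F\<^esub> x = \<one>\<^bsub>complex_subring F\<^esub>"
  then have "x * y = 1" by simp
  then show "y = inverse x" using assms(3) by (simp add: field_simps)
qed (use assms in simp)

lemma m_inv_ring_of_type_algebra:
  "x \<noteq> 0 \<Longrightarrow> inv\<^bsub>ring_of_type_algebra\<^esub> x = inverse (x :: complex)"
proof -
  assume "x \<noteq> 0"
  moreover have "complex_subring UNIV = ring_of_type_algebra" by (simp add: ring_of_type_algebra_def)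
  ultimately show ?thesis by (metis UNIV_I m_inv_complex)
qed

lemma unital_subring_if_subring: "subring A (ring_of_type_algebra :: complex ring) \<Longrightarrow> unital_subring A"
proof
  assume A: "subring A (ring_of_type_algebra :: complex ring)"
  show "1 \<in> A" using subringE(3)[OF A] by simp
  fix x y assume xy: "x \<in> A" "y \<in> A"
  show "x * y \<in> A" using subringE(6)[OF A xy] by simp
  show "x - y \<in> A" using subringE(7)[OF A xy(1) subringE(5)[OF A xy(2)]] by simp
qed

lemma generate_ring_eq_int_span: "generate_ring ring_of_type_algebra {z} = int_span z"
proof
  show "generate_ring ring_of_type_algebra {z} \<subseteq> int_span z"
  proof
    fix x assume "x \<in> generate_ring ring_of_type_algebra {z}"
    then show "x \<in> int_span z"
      by induction (auto intro: int_span.uminus_mem int_span.add_mem int_span.mult_mem)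
  qed
  have "unital_subring (generate_ring ring_of_type_algebra {z} :: complex set)"
    by (intro unital_subring_if_subring ring.generate_ring_is_subring ring_from_type_algebra) simp
  then show "int_span z \<subseteq> generate_ring ring_of_type_algebra {z}"
    by (rule int_span_subset) (rule generate_ring.incl, simp)
qed

lemma int_adjoin_eq: "int_adjoin z = complex_subring (int_span z)"
  by (simp add: int_adjoin_def generate_ring_eq_int_span)

lemma int_span_subset_generate_field: "int_span z \<subseteq> generate_field ring_of_type_algebra {z}"
proof (rule int_span_subset)
  show "unital_subring (generate_field ring_of_type_algebra {z} :: complex set)"
    by (intro unital_subring_if_subring subfieldE(1)[OF field.generate_field_is_subfield]
        field_from_type_algebra) simp
  show "z \<in> generate_field ring_of_type_algebra {z}" by (rule generate_field.incl) simp
qed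

text \<open>Numerators and denominators may come from different rings: besides Z[\<zeta>], also Z[w]
  is localized at a multiplicative subset of Z[\<zeta>].\<close>

definition fractions :: "complex set \<Rightarrow> complex set \<Rightarrow> complex set"
  where "fractions A S = {a / s | a s. a \<in> A \<and> s \<in> S}"

lemma fractionsI: "a \<in> A \<Longrightarrow> s \<in> S \<Longrightarrow> a / s \<in> fractions A S"
  by (auto simp: fractions_def)

text \<open>The generated field is closed under complex inverses, so its inverses are the complex
  ones; \<open>0 \<in> P\<close> keeps 0 out of the denominators.\<close>

lemma localization_in_eq_fractions:
  assumes "0 \<in> P"
  shows "localization_in (rat_adjoin z) (int_span z) P = complex_subring (fractions (int_span z) (int_span z - P))"
proof -
  let ?F = "generate_field ring_of_type_algebra {z} :: complex set"
  have "inv\<^bsub>complex_subring ?F\<^esub> s = inverse s" if "s \<in> int_span z - P" for s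
  proof (rule m_inv_complex)
    show s0: "s \<noteq> 0" using that assms by auto
    show sF: "s \<in> ?F" using that int_span_subset_generate_field by auto
    show "inverse s \<in> ?F"
      using generate_field.m_inv[OF sF] s0 by (simp add: m_inv_ring_of_type_algebra)
  qed
  then have "{a * inv\<^bsub>complex_subring ?F\<^esub> s | a s. a \<in> int_span z \<and> s \<in> int_span z - P} =
      fractions (int_span z) (int_span z - P)"
    unfolding fractions_def by (auto simp: divide_inverse) metis+
  then show ?thesis unfolding localization_in_def rat_adjoin_def by simp
qed

lemma prime_ideal_of_primeideal:
  assumes "primeideal P (complex_subring A)" "unital_subring A"
  shows "prime_ideal_of A P"
proof -
  interpret primeideal P "complex_subring A" by fact
  interpret unital_subring A by fact
  show ?thesis
  proof
    show "P \<subseteq> A" using a_subset by simp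
    show "0 \<in> P" using subgroup.one_closed[OF a_subgroup] by simp
    show "x - y \<in> P" if "x \<in> P" "y \<in> P" for x y
    proof -
      have "- 1 \<in> A" by (rule uminus_mem) simp
      then have "- y \<in> P" using I_l_closed[OF that(2), of "- 1"] by simp
      then show ?thesis using additive_subgroup.a_closed[OF additive_subgroup_axioms that(1), of "- y"] by simp
    qed
    show "x * y \<in> P" if "x \<in> A" "y \<in> P" for x y
      using I_l_closed[OF that(2)] that by simp
    show "1 \<notin> P" using one_imp_carrier I_notcarr by auto
    show "x \<in> P \<or> y \<in> P" if "x \<in> A" "y \<in> A" "x * y \<in> P" for x y
      using I_prime that by simp
  qed
qed

lemma unital_subring_fractions:
  assumes "prime_ideal_of A P" "A \<subseteq> W" "unital_subring W"
  shows "unital_subring (fractions W (A - P))"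
proof -
  interpret P: prime_ideal_of A P by fact
  interpret W: unital_subring W by fact
  have mult: "s * t \<in> A - P" if "s \<in> A - P" "t \<in> A - P" for s t
    using that P.prime_in by auto
  have nz: "s \<noteq> 0" if "s \<in> A - P" for s using that by auto
  show ?thesis
  proof
    show "1 \<in> fractions W (A - P)" using fractionsI[of 1 W 1 "A - P"] by simp
    fix x y assume "x \<in> fractions W (A - P)" "y \<in> fractions W (A - P)"
    then obtain a s b t where *: "x = a / s" "y = b / t" "a \<in> W" "b \<in> W" "s \<in> A - P" "t \<in> A - P"
      by (auto simp: fractions_def)
    have "x * y = (a * b) / (s * t)" using * by simp
    then show "x * y \<in> fractions W (A - P)" using * mult by (auto intro!: fractionsI)
    have "x - y = (a * t - b * s) / (s * t)" using * nz[of s] nz[of t] by (simp add: diff_frac_eq)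
    moreover have "a * t - b * s \<in> W" using * assms(2) by (intro W.diff_mem W.mult_mem) auto
    ultimately show "x - y \<in> fractions W (A - P)" using * mult by (auto intro!: fractionsI)
  qed
qed

lemma common_denominator:
  assumes "prime_ideal_of A P" "finite I" "\<And>i. i \<in> I \<Longrightarrow> f i \<in> fractions A (A - P)"
  shows "\<exists>s\<in>A - P. \<forall>i\<in>I. s * f i \<in> A"
proof -
  interpret P: prime_ideal_of A P by fact
  from assms(2,3) show ?thesis
  proof (induction I rule: finite_induct)
    case empty
    then show ?case using P.one_mem P.one_notin by blast
  next
    case (insert i I)
    then obtain s where s: "s \<in> A - P" "\<And>i. i \<in> I \<Longrightarrow> s * f i \<in> A" by blast
    obtain a t where t: "f i = a / t" "a \<in> A" "t \<in> A - P"
      using insert.prems[of i] by (auto simp: fractions_def)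
    have "t \<noteq> 0" using t by auto
    have "s * t \<in> A - P" using s t P.prime_in by auto
    moreover have "s * t * f j \<in> A" if "j \<in> insert i I" for j
    proof (cases "j = i")
      case True
      have "s * t * f j = s * a" using t(1) True \<open>t \<noteq> 0\<close> by simp
      moreover have "s * a \<in> A" using s t by (intro P.mult_mem) auto
      ultimately show ?thesis by (simp only:)
    next
      case False
      then have "t * (s * f j) \<in> A" using s t that False by (intro P.mult_mem[of t "s * f j"]) auto
      then show ?thesis by (simp add: mult_ac)
    qed
    ultimately show ?case by blast
  qed
qed

section \<open>Group rings\<close>

context finite_abelian_group
begin

abbreviation funs :: "complex set \<Rightarrow> ('a \<Rightarrow> complex) set"
  where "funs A \<equiv> carrier G \<rightarrow>\<^sub>E A"

definition convolution :: "('a \<Rightarrow> complex) \<Rightarrow> ('a \<Rightarrow> complex) \<Rightarrow> 'a \<Rightarrow> complex"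
  where "convolution f h = (\<lambda>x\<in>carrier G. \<Sum>y\<in>carrier G. f y * h (inv y \<otimes> x))"

text \<open>For a character \<chi>, the value at \<open>f\<close> of the algebra homomorphism from
  the complex group algebra that extends \<chi>.\<close>

definition fourier :: "('a \<Rightarrow> complex) \<Rightarrow> ('a \<Rightarrow> complex) \<Rightarrow> complex"
  where "fourier f \<chi> = (\<Sum>g\<in>carrier G. f g * \<chi> g)"

lemma fourier_convolution:
  assumes \<chi>: "\<chi> \<in> characters"
  shows "fourier (convolution f h) \<chi> = fourier f \<chi> * fourier h \<chi>"
proof -
  have "fourier (convolution f h) \<chi> = (\<Sum>y\<in>carrier G. \<Sum>x\<in>carrier G. f y * h (inv y \<otimes> x) * \<chi> x)"
    by (simp add: fourier_def convolution_def sum_distrib_right) (rule sum.swap)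
  also have "\<dots> = (\<Sum>y\<in>carrier G. \<Sum>x\<in>carrier G. (f y * \<chi> y) * (h x * \<chi> x))"
  proof (rule sum.cong[OF refl])
    fix y assume y: "y \<in> carrier G"
    show "(\<Sum>x\<in>carrier G. f y * h (inv y \<otimes> x) * \<chi> x) = (\<Sum>x\<in>carrier G. (f y * \<chi> y) * (h x * \<chi> x))"
      by (rule sum.reindex_bij_witness[of _ "\<lambda>x. y \<otimes> x" "\<lambda>x. inv y \<otimes> x"])
        (use y \<chi> in \<open>auto simp: m_assoc[symmetric] character_mult[symmetric]\<close>)
  qed
  also have "\<dots> = fourier f \<chi> * fourier h \<chi>"
    by (simp add: fourier_def sum_product)
  finally show ?thesis .
qed

lemma fourier_inversion:
  assumes g: "g \<in> carrier G"
  shows "(\<Sum>\<chi>\<in>characters. fourier f \<chi> * \<chi> (inv g)) = of_nat (card characters) * f g"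
proof -
  have "(\<Sum>\<chi>\<in>characters. fourier f \<chi> * \<chi> (inv g)) = (\<Sum>\<chi>\<in>characters. \<Sum>x\<in>carrier G. f x * \<chi> (x \<otimes> inv g))"
    using g by (simp add: fourier_def sum_distrib_right character_mult mult.assoc)
  also have "\<dots> = (\<Sum>x\<in>carrier G. f x * (\<Sum>\<chi>\<in>characters. \<chi> (x \<otimes> inv g)))"
    by (subst sum.swap) (simp add: sum_distrib_left)
  also have "\<dots> = (\<Sum>x\<in>carrier G. if x = g then f x * of_nat (card characters) else 0)"
  proof (intro sum.cong refl)
    fix x assume x: "x \<in> carrier G"
    have "x \<otimes> inv g = \<one> \<longleftrightarrow> x = g" using x g by (metis inv_solve_right' l_one one_closed r_inv)
    then show "f x * (\<Sum>\<chi>\<in>characters. \<chi> (x \<otimes> inv g)) = (if x = g then f x * of_nat (card characters) else 0)"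
      using x g by (simp add: sum_over_characters)
  qed
  finally show ?thesis using g by simp
qed

lemma fourier_injective:
  assumes "f \<in> extensional (carrier G)" "h \<in> extensional (carrier G)"
    and "\<And>\<chi>. \<chi> \<in> characters \<Longrightarrow> fourier f \<chi> = fourier h \<chi>"
  shows "f = h"
proof (rule extensionalityI[OF assms(1,2)])
  fix g assume g: "g \<in> carrier G"
  have "0 < card characters" using order_pos by (simp add: card_characters Coset.order_def)
  then have "(of_nat (card characters) :: complex) \<noteq> 0" by (metis of_nat_eq_0_iff less_irrefl)
  moreover have "of_nat (card characters) * f g = of_nat (card characters) * h g"
    unfolding fourier_inversion[OF g, symmetric] using assms(3) by (intro sum.cong) simp_all
  ultimately show "f g = h g" by (metis mult_cancel_left)
qed

lemma fourier_add: "fourier (\<lambda>x\<in>carrier G. f x + h x) \<chi> = fourier f \<chi> + fourier h \<chi>"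
  by (simp add: fourier_def distrib_right sum.distrib)

lemma fourier_diff: "fourier (\<lambda>x\<in>carrier G. f x - h x) \<chi> = fourier f \<chi> - fourier h \<chi>"
  by (simp add: fourier_def left_diff_distrib sum_subtractf)

lemma fourier_scale: "fourier (\<lambda>x\<in>carrier G. c * f x) \<chi> = c * fourier f \<chi>"
  by (simp add: fourier_def sum_distrib_left mult.assoc)

lemma fourier_delta:
  assumes "\<chi> \<in> characters" "g \<in> carrier G"
  shows "fourier (\<lambda>x\<in>carrier G. if x = g then c else 0) \<chi> = c * \<chi> g"
  using assms by (simp add: fourier_def if_distrib[of "\<lambda>x. x * _"] cong: if_cong)

lemma convolution_closed:
  assumes "unital_subring A" "f \<in> funs A" "h \<in> funs A"
  shows "convolution f h \<in> funs A"
proof -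
  interpret unital_subring A by fact
  show ?thesis using assms(2,3) by (auto simp: convolution_def PiE_iff intro!: sum_mem mult_mem)
qed

section \<open>Group rings over subrings of the complex numbers\<close>

lemma abelian_monoid_complex_subring:
  assumes "unital_subring A"
  shows "abelian_monoid (complex_subring A)"
proof -
  interpret unital_subring A by fact
  show ?thesis by (rule abelian_monoidI) (auto simp: add.assoc add.commute)
qed

lemma finsum_complex_subring:
  assumes A: "unital_subring A" and I: "finite I" "\<And>i. i \<in> I \<Longrightarrow> f i \<in> A"
  shows "finsum (complex_subring A) f I = sum f I"
proof -
  interpret abelian_monoid "complex_subring A" by (rule abelian_monoid_complex_subring[OF A])
  from I show ?thesis
    by (induction I rule: finite_induct) (auto simp: Pi_def)
qed

lemma group_ring_simps:
  assumes A: "unital_subring A"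
  defines "R \<equiv> group_ring (complex_subring A) G"
  shows "carrier R = funs A"
    and "f \<in> funs A \<Longrightarrow> h \<in> funs A \<Longrightarrow> f \<otimes>\<^bsub>R\<^esub> h = convolution f h"
    and "\<one>\<^bsub>R\<^esub> = (\<lambda>x\<in>carrier G. if x = \<one> then 1 else 0)"
    and "\<zero>\<^bsub>R\<^esub> = (\<lambda>x\<in>carrier G. 0)"
    and "f \<oplus>\<^bsub>R\<^esub> h = (\<lambda>x\<in>carrier G. f x + h x)"
proof -
  interpret unital_subring A by fact
  show "carrier R = funs A" by (simp add: R_def group_ring_def)
  show "\<one>\<^bsub>R\<^esub> = (\<lambda>x\<in>carrier G. if x = \<one> then 1 else 0)"
    by (simp add: R_def group_ring_def cong: if_cong)
  show "\<zero>\<^bsub>R\<^esub> = (\<lambda>x\<in>carrier G. 0)" by (simp add: R_def group_ring_def)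
  show "f \<oplus>\<^bsub>R\<^esub> h = (\<lambda>x\<in>carrier G. f x + h x)" by (simp add: R_def group_ring_def)
  assume f: "f \<in> funs A" and h: "h \<in> funs A"
  have "(\<Oplus>\<^bsub>complex_subring A\<^esub>y\<in>{g \<in> carrier G. f g \<noteq> 0}. f y * h (inv y \<otimes> x)) =
      (\<Sum>y\<in>carrier G. f y * h (inv y \<otimes> x))" if x: "x \<in> carrier G" for x
  proof -
    have "(\<Oplus>\<^bsub>complex_subring A\<^esub>y\<in>{g \<in> carrier G. f g \<noteq> 0}. f y * h (inv y \<otimes> x)) =
      (\<Sum>y\<in>{g \<in> carrier G. f g \<noteq> 0}. f y * h (inv y \<otimes> x))"
      using f h x by (intro finsum_complex_subring A) auto
    also have "\<dots> = (\<Sum>y\<in>carrier G. f y * h (inv y \<otimes> x))"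
      by (rule sum.mono_neutral_left) auto
    finally show ?thesis .
  qed
  then show "f \<otimes>\<^bsub>R\<^esub> h = convolution f h"
    by (auto simp: R_def group_ring_def convolution_def)
qed

text \<open>By injectivity of the Fourier transform, the axioms about multiplication are checked at
  each character, where convolution is a product of complex numbers.\<close>

lemma ring_group_ring:
  assumes A: "unital_subring A"
  shows "ring (group_ring (complex_subring A) G)"
proof -
  interpret unital_subring A by fact
  note simps = group_ring_simps[OF A]
  let ?R = "group_ring (complex_subring A) G"
  note c = convolution_closed[OF A]
  have one: "(\<lambda>x\<in>carrier G. if x = \<one> then 1 else 0) \<in> funs A" by auto
  have add: "(\<lambda>x\<in>carrier G. f x + h x) \<in> funs A"
    if "f \<in> funs A" "h \<in> funs A" for f h using that by auto
  have ext: "f \<in> extensional (carrier G)" if "f \<in> funs A" for f using that by (simp add: PiE_def)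
  note four = fourier_convolution fourier_add fourier_delta
  have eqI: "f = h" if "f \<in> funs A" "h \<in> funs A"
    "\<And>\<chi>. \<chi> \<in> characters \<Longrightarrow> fourier f \<chi> = fourier h \<chi>" for f h
    using that ext by (intro fourier_injective) auto
  show ?thesis
  proof (rule ringI)
    show "abelian_group ?R"
    proof (rule abelian_groupI)
      fix f h k assume "f \<in> carrier ?R" "h \<in> carrier ?R" "k \<in> carrier ?R"
      then have *: "f \<in> funs A" "h \<in> funs A" "k \<in> funs A" by (simp_all add: simps)
      show "f \<oplus>\<^bsub>?R\<^esub> h \<in> carrier ?R" using * add by (simp add: simps)
      show "f \<oplus>\<^bsub>?R\<^esub> h \<oplus>\<^bsub>?R\<^esub> k = f \<oplus>\<^bsub>?R\<^esub> (h \<oplus>\<^bsub>?R\<^esub> k)"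
        by (auto simp: simps add.assoc)
      show "f \<oplus>\<^bsub>?R\<^esub> h = h \<oplus>\<^bsub>?R\<^esub> f" by (auto simp: simps add.commute)
      show "\<zero>\<^bsub>?R\<^esub> \<oplus>\<^bsub>?R\<^esub> f = f"
        using * by (auto simp: simps PiE_def intro!: extensionalityI[of _ "carrier G"])
      show "\<exists>h\<in>carrier ?R. h \<oplus>\<^bsub>?R\<^esub> f = \<zero>\<^bsub>?R\<^esub>"
        using * by (intro bexI[of _ "\<lambda>x\<in>carrier G. - f x"]) (auto simp: simps)
    next
      show "\<zero>\<^bsub>?R\<^esub> \<in> carrier ?R" by (auto simp: simps)
    qed
    show "Group.monoid ?R"
    proof (rule monoidI)
      fix f h k assume "f \<in> carrier ?R" "h \<in> carrier ?R" "k \<in> carrier ?R"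
      then have *: "f \<in> funs A" "h \<in> funs A" "k \<in> funs A" by (simp_all add: simps)
      show "f \<otimes>\<^bsub>?R\<^esub> h \<in> carrier ?R" using * c by (simp add: simps)
      show "f \<otimes>\<^bsub>?R\<^esub> h \<otimes>\<^bsub>?R\<^esub> k = f \<otimes>\<^bsub>?R\<^esub> (h \<otimes>\<^bsub>?R\<^esub> k)"
        using * c by (intro eqI) (simp_all add: simps four mult.assoc)
      show "\<one>\<^bsub>?R\<^esub> \<otimes>\<^bsub>?R\<^esub> f = f"
        by (rule eqI) (use * c[OF one *(1)] one in \<open>simp_all add: simps four character_one\<close>)
      show "f \<otimes>\<^bsub>?R\<^esub> \<one>\<^bsub>?R\<^esub> = f"
        by (rule eqI) (use * c[OF *(1) one] one in \<open>simp_all add: simps four character_one\<close>)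
    next
      show "\<one>\<^bsub>?R\<^esub> \<in> carrier ?R" using one by (simp add: simps)
    qed
    fix f h k assume "f \<in> carrier ?R" "h \<in> carrier ?R" "k \<in> carrier ?R"
    then have *: "f \<in> funs A" "h \<in> funs A" "k \<in> funs A" by (simp_all add: simps)
    show "(f \<oplus>\<^bsub>?R\<^esub> h) \<otimes>\<^bsub>?R\<^esub> k = f \<otimes>\<^bsub>?R\<^esub> k \<oplus>\<^bsub>?R\<^esub> h \<otimes>\<^bsub>?R\<^esub> k"
      using * c add by (intro eqI) (simp_all add: simps four distrib_right)
    show "k \<otimes>\<^bsub>?R\<^esub> (f \<oplus>\<^bsub>?R\<^esub> h) = k \<otimes>\<^bsub>?R\<^esub> f \<oplus>\<^bsub>?R\<^esub> k \<otimes>\<^bsub>?R\<^esub> h"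
      using * c add by (intro eqI) (simp_all add: simps four distrib_left)
  qed
qed

text \<open>The inverse \<open>v\<close> is required explicitly with coefficients in
  \<open>A\<close>: nonzero values of \<open>u\<close> alone would only give an inverse over the
  complex numbers.\<close>

definition fourier_clean :: "complex set \<Rightarrow> ('a \<Rightarrow> complex) \<Rightarrow> bool"
  where "fourier_clean A f \<longleftrightarrow> (\<exists>u\<in>funs A. \<exists>v\<in>funs A. \<exists>e\<in>funs A. \<forall>\<chi>\<in>characters.
    fourier u \<chi> * fourier v \<chi> = 1 \<and> fourier e \<chi> \<in> {0, 1} \<and> fourier f \<chi> = fourier u \<chi> + fourier e \<chi>)"

lemma clean_group_ring_iff:
  assumes A: "unital_subring A"
  shows "clean_ring (group_ring (complex_subring A) G) \<longleftrightarrow> (\<forall>a\<in>funs A. fourier_clean A a)"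
proof -
  interpret unital_subring A by fact
  let ?R = "group_ring (complex_subring A) G"
  interpret R: ring ?R by (rule ring_group_ring[OF A])
  note simps = group_ring_simps[OF A]
  have ext: "f \<in> extensional (carrier G)" if "f \<in> funs A" for f using that by (simp add: PiE_def)
  have eq_iff: "f = h \<longleftrightarrow> (\<forall>\<chi>\<in>characters. fourier f \<chi> = fourier h \<chi>)"
    if "f \<in> funs A" "h \<in> funs A" for f h
    using that ext fourier_injective by auto
  have one: "\<one>\<^bsub>?R\<^esub> \<in> funs A" using R.one_closed by (simp only: simps)
  have f1: "fourier \<one>\<^bsub>?R\<^esub> \<chi> = 1" if "\<chi> \<in> characters" for \<chi>
    using that by (simp add: simps fourier_delta character_one)
  have mult: "f \<otimes>\<^bsub>?R\<^esub> h = k \<longleftrightarrow> (\<forall>\<chi>\<in>characters. fourier f \<chi> * fourier h \<chi> = fourier k \<chi>)"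
    if "f \<in> funs A" "h \<in> funs A" "k \<in> funs A" for f h k
    using that eq_iff[OF convolution_closed[OF A that(1,2)] that(3)] by (simp add: simps fourier_convolution)
  have add: "k = f \<oplus>\<^bsub>?R\<^esub> h \<longleftrightarrow> (\<forall>\<chi>\<in>characters. fourier k \<chi> = fourier f \<chi> + fourier h \<chi>)"
    if "f \<in> funs A" "h \<in> funs A" "k \<in> funs A" for f h k
  proof -
    have "f \<oplus>\<^bsub>?R\<^esub> h \<in> funs A" using R.add.m_closed[of f h] that by (simp add: simps(1))
    then show ?thesis using eq_iff[OF that(3)] by (simp add: simps(5) fourier_add)
  qed
  have unit: "u \<in> Units ?R \<longleftrightarrow> u \<in> funs A \<and>
      (\<exists>v\<in>funs A. \<forall>\<chi>\<in>characters. fourier u \<chi> * fourier v \<chi> = 1)" for u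
  proof
    assume "u \<in> Units ?R"
    then obtain v where v: "u \<in> carrier ?R" "v \<in> carrier ?R" "u \<otimes>\<^bsub>?R\<^esub> v = \<one>\<^bsub>?R\<^esub>" by (auto simp: Units_def)
    then have "u \<in> funs A" "v \<in> funs A" by (simp_all only: simps)
    then show "u \<in> funs A \<and>
        (\<exists>v\<in>funs A. \<forall>\<chi>\<in>characters. fourier u \<chi> * fourier v \<chi> = 1)"
      using mult[of u v "\<one>\<^bsub>?R\<^esub>"] one v(3) f1 by auto
  next
    assume "u \<in> funs A \<and>
        (\<exists>v\<in>funs A. \<forall>\<chi>\<in>characters. fourier u \<chi> * fourier v \<chi> = 1)"
    then obtain v where uv: "u \<in> funs A" "v \<in> funs A"
      "\<forall>\<chi>\<in>characters. fourier u \<chi> * fourier v \<chi> = 1" by blast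
    then have "u \<otimes>\<^bsub>?R\<^esub> v = \<one>\<^bsub>?R\<^esub>" "v \<otimes>\<^bsub>?R\<^esub> u = \<one>\<^bsub>?R\<^esub>"
      using mult[OF uv(1,2) one] mult[OF uv(2,1) one] f1 by (simp_all add: mult.commute)
    then show "u \<in> Units ?R" using uv(1,2) unfolding Units_def by (auto simp: simps(1))
  qed
  have idem: "e \<otimes>\<^bsub>?R\<^esub> e = e \<longleftrightarrow> (\<forall>\<chi>\<in>characters. fourier e \<chi> \<in> {0, 1})" if "e \<in> funs A" for e
    using mult[OF that that that] by auto
  have "\<one>\<^bsub>?R\<^esub> \<noteq> \<zero>\<^bsub>?R\<^esub>"
  proof
    assume "\<one>\<^bsub>?R\<^esub> = \<zero>\<^bsub>?R\<^esub>"
    then have "\<one>\<^bsub>?R\<^esub> \<one> = \<zero>\<^bsub>?R\<^esub> \<one>" by simp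
    then show False unfolding simps by simp
  qed
  then have "clean_ring ?R \<longleftrightarrow>
      (\<forall>a\<in>carrier ?R. \<exists>u\<in>Units ?R. \<exists>e\<in>carrier ?R. e \<otimes>\<^bsub>?R\<^esub> e = e \<and> a = u \<oplus>\<^bsub>?R\<^esub> e)"
    using R.ring_axioms by (auto simp: clean_ring_def clean_ring_axioms_def)
  also have "\<dots> \<longleftrightarrow> (\<forall>a\<in>funs A. fourier_clean A a)"
  proof (intro ball_cong)
    fix a assume a: "a \<in> funs A"
    show "(\<exists>u\<in>Units ?R. \<exists>e\<in>carrier ?R. e \<otimes>\<^bsub>?R\<^esub> e = e \<and> a = u \<oplus>\<^bsub>?R\<^esub> e) \<longleftrightarrow> fourier_clean A a"
      (is "?l \<longleftrightarrow> ?r")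
    proof
      assume ?l
      then obtain u e where u: "u \<in> Units ?R" and e: "e \<in> carrier ?R" "e \<otimes>\<^bsub>?R\<^esub> e = e" "a = u \<oplus>\<^bsub>?R\<^esub> e"
        by (elim bexE conjE)
      from u obtain v where uv: "u \<in> funs A" "v \<in> funs A"
        "\<forall>\<chi>\<in>characters. fourier u \<chi> * fourier v \<chi> = 1"
        unfolding unit by (elim conjE bexE)
      have e': "e \<in> funs A" using e(1) by (simp only: simps)
      show ?r
        unfolding fourier_clean_def
      proof (intro bexI ballI conjI)
        fix \<chi> assume \<chi>: "\<chi> \<in> characters"
        show "fourier u \<chi> * fourier v \<chi> = 1" using uv(3) \<chi> by (rule bspec)
        show "fourier e \<chi> \<in> {0, 1}" using idem[OF e', THEN iffD1, OF e(2)] \<chi> by (rule bspec)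
        show "fourier a \<chi> = fourier u \<chi> + fourier e \<chi>"
          using add[OF uv(1) e' a, THEN iffD1, OF e(3)] \<chi> by (rule bspec)
      qed fact+
    next
      assume ?r
      then obtain u v e where uve: "u \<in> funs A" "v \<in> funs A" "e \<in> funs A"
        and h: "\<forall>\<chi>\<in>characters. fourier u \<chi> * fourier v \<chi> = 1 \<and> fourier e \<chi> \<in> {0, 1} \<and>
          fourier a \<chi> = fourier u \<chi> + fourier e \<chi>"
        unfolding fourier_clean_def by (elim bexE)
      show ?l
      proof (rule bexI[of _ u], rule bexI[of _ e], rule conjI)
        show "u \<in> Units ?R" unfolding unit using uve h by (intro conjI bexI[of _ v]) simp_all
        show "e \<in> carrier ?R" using uve by (simp only: simps)
        show "e \<otimes>\<^bsub>?R\<^esub> e = e" by (rule idem[OF uve(3), THEN iffD2]) (use h in simp)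
        show "a = u \<oplus>\<^bsub>?R\<^esub> e" by (rule add[OF uve(1,3) a, THEN iffD2]) (use h in simp)
      qed
    qed
  qed (simp only: simps)
  finally show ?thesis .
qed

end

section \<open>Clean group rings over localizations of cyclotomic rings\<close>

locale cyclotomic_group_ring =
  finite_abelian_group G + cyclotomic_setting n n0 N L p e k \<zeta> w
  for G (structure) and n n0 N L p e k :: nat and \<zeta> w :: complex +
  fixes P :: "complex set"
  assumes L_lcm: "L = lcm n (group_exponent G)"
    and P: "prime_ideal_of (int_span \<zeta>) P" and pP: "of_nat p \<in> P"
begin

sublocale P: prime_ideal_of "int_span \<zeta>" P
  by (rule P)

definition S :: "complex set"
  where "S = int_span \<zeta> - P"

definition A :: "complex set"
  where "A = fractions (int_span \<zeta>) S"

lemma cyclotomic_primeI: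
  "prime_ideal_of (int_span w) Q \<Longrightarrow> of_nat p \<in> Q \<Longrightarrow> cyclotomic_prime n n0 N L p e k \<zeta> w Q"
  by (intro cyclotomic_prime.intro cyclotomic_prime_axioms.intro cyclotomic_setting_axioms)

lemma S_mult: "s \<in> S \<Longrightarrow> t \<in> S \<Longrightarrow> s * t \<in> S"
  unfolding S_def using P.prime_in by auto

lemma S_nonzero: "s \<in> S \<Longrightarrow> s \<noteq> 0"
  unfolding S_def by auto

lemma one_in_S: "1 \<in> S"
  unfolding S_def by simp

lemma unital_subring_A: "unital_subring A"
  unfolding A_def S_def by (rule unital_subring_fractions[OF P order_refl unital_subring_int_span])

lemma O_subset_A: "int_span \<zeta> \<subseteq> A"
proof
  fix x assume "x \<in> int_span \<zeta>"
  then have "x / 1 \<in> A" unfolding A_def using one_in_S by (rule fractionsI)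
  then show "x \<in> A" by simp
qed

lemma prime_above: "\<exists>Q. prime_ideal_of (int_span w) Q \<and> Q \<inter> int_span \<zeta> = P"
  using P unital_subring_int_span O_subset
  by (rule lying_over) (rule algebraic_int_int_span[OF wL L_pos])

lemma character_pow_L:
  assumes "\<chi> \<in> characters" "x \<in> carrier G"
  shows "\<chi> x ^ L = 1"
proof -
  have "group_exponent G dvd L" by (simp add: L_lcm)
  then have "x [^] L = \<one>" by (rule pow_eq_one_dvd[OF assms(2) pow_group_exponent[OF assms(2)]])
  then show ?thesis using assms by (metis character_one character_pow)
qed

text \<open>An element whose order is the exponent of \<open>G\<close> may be sent to any root of
  unity of that exponent, here to a primitive one built from \<open>w\<close>.\<close>

lemma faithful_character_value:
  "\<exists>\<chi>\<in>characters. \<exists>g\<in>carrier G. \<chi> g = w ^ (L div group_exponent G)"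
proof -
  define M where "M = group_exponent G"
  obtain g where g: "g \<in> carrier G" "\<And>i::nat. g [^] i = \<one> \<Longrightarrow> M dvd i"
    unfolding M_def using element_of_order_group_exponent by blast
  have MdL: "M dvd L" by (simp add: L_lcm M_def)
  have "(w ^ (L div M)) ^ i = 1" if i: "g [^] i = \<one>" for i :: nat
  proof -
    obtain m where m: "i = M * m" using g(2)[OF i] by blast
    have "(w ^ (L div M)) ^ i = (w ^ L) ^ m" using MdL by (simp add: m flip: power_mult mult.assoc)
    then show ?thesis using wL by simp
  qed
  then show ?thesis using character_extension[OF g(1), of "w ^ (L div M)"] g(1) unfolding M_def by blast
qed

text \<open>As \<open>L\<close> is the least common multiple of \<open>n\<close> and the exponent,
  its cofactors \<open>a\<close> and \<open>b\<close> are coprime. Hence by Bezout \<open>w\<close>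
  is a product of powers of \<open>w ^ a\<close>, which lies in Z[\<zeta>], and of the given
  \<open>w ^ b\<close>.\<close>

lemma generator_in:
  assumes B: "unital_subring B" "int_span \<zeta> \<subseteq> B" "w ^ (L div group_exponent G) \<in> B"
  shows "int_span w \<subseteq> B"
proof (rule int_span_subset[OF B(1)])
  interpret unital_subring B by fact
  define M where "M = group_exponent G"
  define a b where "a = L div n" and "b = L div M"
  have nM: "n dvd L" "M dvd L" by (simp_all add: L_lcm M_def)
  have Lab: "L = n * a" "L = M * b" using nM by (simp_all add: a_def b_def)
  have a0: "a \<noteq> 0" using Lab L_pos by auto
  \<comment> \<open>A common divisor \<open>d > 1\<close> would make \<open>L / d\<close> a smaller
    common multiple of \<open>n\<close> and \<open>M\<close>.\<close>
  have "gcd a b = 1"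
  proof -
    define d where "d = gcd a b"
    obtain a' b' where ab: "a = d * a'" "b = d * b'" unfolding d_def by (metis gcd_dvd1 gcd_dvd2 dvdE)
    have d0: "0 < d" using a0 ab by (cases d) auto
    define L' where "L' = n * a'"
    have LL': "L = d * L'" using Lab ab by (simp add: L'_def)
    have "L = M * b' * d" using Lab ab by simp
    then have "L' = M * b'" using LL' d0 by simp
    then have "M dvd L'" by simp
    moreover have "n dvd L'" by (simp add: L'_def)
    ultimately have "lcm n M dvd L'" by (rule lcm_least[rotated])
    moreover have "lcm n M = d * L'" using LL' by (simp only: L_lcm M_def)
    ultimately have "d * L' dvd L'" by (simp only:)
    moreover have "0 < L'" using LL' L_pos by (cases L') auto
    ultimately have "d dvd 1" by (metis dvd_mult_cancel2 nat_dvd_1_iff_1)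
    then show ?thesis by (simp add: d_def)
  qed
  then obtain x y where xy: "a * x = b * y + 1" using bezout_nat[OF a0, of b] by auto
  have wa: "w ^ a \<in> B"
    using B(2) wL Lab(1) by (intro subsetD[OF B(2)] \<zeta>_root) (simp add: mult.commute flip: power_mult)
  define v where "v = (w ^ b) ^ y"
  have vB: "v \<in> B" using B(3) unfolding v_def b_def M_def by (rule power_mem)
  have "v ^ L = 1" unfolding v_def by (intro root_of_unity_power wL)
  then have vv: "v * v ^ (L - 1) = 1" using L_pos by (metis power_minus_mult mult.commute)
  have "(w ^ a) ^ x = v * w" unfolding v_def using xy by (simp flip: power_mult power_Suc2)
  then have "w = (w ^ a) ^ x * v ^ (L - 1)" using vv by (metis mult.assoc mult.commute mult.right_neutral)
  then show "w \<in> B" using wa vB by (metis mult_mem power_mem)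
qed

lemma clean_imp_powers:
  assumes clean: "clean_ring (group_ring (complex_subring A) G)"
    and a: "coprime a N" "[a = 1] (mod n0)"
  shows "\<exists>i. [a = p ^ i] (mod N)"
proof -
  interpret A: unital_subring A by (rule unital_subring_A)
  obtain \<chi> g where \<chi>: "\<chi> \<in> characters" and g: "g \<in> carrier G" "\<chi> g = w ^ (L div group_exponent G)"
    using faithful_character_value by blast
  \<comment> \<open>The image of the group ring under \<chi>. It contains Z[w] and \<open>A\<close>,
    and lies in the localization of Z[w] at \<open>S\<close>.\<close>
  define B where "B = (\<lambda>f. fourier f \<chi>) ` funs A"
  have delta: "c * \<chi> x \<in> B" if "c \<in> A" "x \<in> carrier G" for c x
  proof -
    have "(\<lambda>y\<in>carrier G. if y = x then c else 0) \<in> funs A" using that by auto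
    then have "fourier (\<lambda>y\<in>carrier G. if y = x then c else 0) \<chi> \<in> B" unfolding B_def by (rule imageI)
    then show ?thesis using fourier_delta[OF \<chi> that(2)] by simp
  qed
  have BI: "unital_subring B"
  proof
    show "1 \<in> B" using delta[of 1 \<one>] \<chi> by (simp add: character_one)
    fix x y assume "x \<in> B" "y \<in> B"
    then obtain f h where fh: "f \<in> funs A" "h \<in> funs A" "x = fourier f \<chi>" "y = fourier h \<chi>"
      by (auto simp: B_def)
    have "(\<lambda>z\<in>carrier G. f z - h z) \<in> funs A" using fh by auto
    then have "fourier (\<lambda>z\<in>carrier G. f z - h z) \<chi> \<in> B" unfolding B_def by (rule imageI)
    then show "x - y \<in> B" by (simp add: fourier_diff fh)
    have "fourier (convolution f h) \<chi> \<in> B"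
      unfolding B_def using convolution_closed[OF unital_subring_A fh(1,2)] by (rule imageI)
    then show "x * y \<in> B" by (simp add: fourier_convolution \<chi> fh)
  qed
  then interpret B: unital_subring B .
  have AB: "A \<subseteq> B" using delta[of _ \<one>] \<chi> by (auto simp: character_one)
  have WB: "int_span w \<subseteq> B"
    using BI O_subset_A AB delta[of 1 g] g by (intro generator_in) auto
  let ?W = "fractions (int_span w) S"
  have frac: "unital_subring ?W"
    unfolding S_def by (rule unital_subring_fractions[OF P O_subset unital_subring_int_span])
  then interpret F: unital_subring ?W .
  have BW: "B \<subseteq> ?W"
  proof
    fix y assume "y \<in> B"
    then obtain f where f: "f \<in> funs A" "y = fourier f \<chi>" by (auto simp: B_def)
    have "f x * \<chi> x \<in> ?W" if x: "x \<in> carrier G" for x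
    proof -
      have "f x \<in> A" using f x by auto
      then have "f x \<in> ?W" using O_subset by (auto simp: A_def fractions_def)
      moreover have "\<chi> x / 1 \<in> ?W"
        using w_root[OF character_pow_L[OF \<chi> x]] one_in_S by (rule fractionsI)
      ultimately show ?thesis by (simp add: F.mult_mem)
    qed
    then show "y \<in> ?W" unfolding f fourier_def by (intro F.sum_mem)
  qed
  have local: "(\<exists>v\<in>B. y * v = 1) \<or> (\<exists>v\<in>B. (y - 1) * v = 1)" if y: "y \<in> B" for y
  proof -
    obtain f where f: "f \<in> funs A" "y = fourier f \<chi>" using y by (auto simp: B_def)
    obtain u v e where uve: "u \<in> funs A" "v \<in> funs A" "e \<in> funs A"
      and "\<forall>\<chi>\<in>characters. fourier u \<chi> * fourier v \<chi> = 1 \<and> fourier e \<chi> \<in> {0, 1} \<and>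
          fourier f \<chi> = fourier u \<chi> + fourier e \<chi>"
      using clean[unfolded clean_group_ring_iff[OF unital_subring_A], THEN bspec, OF f(1)]
      unfolding fourier_clean_def by (elim bexE)
    then have h: "fourier u \<chi> * fourier v \<chi> = 1" "fourier e \<chi> = 0 \<or> fourier e \<chi> = 1"
      "y = fourier u \<chi> + fourier e \<chi>" using \<chi> f(2) by auto
    have vB: "fourier v \<chi> \<in> B" using uve by (auto simp: B_def)
    from h(2) show ?thesis
    proof
      assume "fourier e \<chi> = 0"
      then have "y * fourier v \<chi> = 1" using h by simp
      then show ?thesis using vB by blast
    next
      assume "fourier e \<chi> = 1"
      then have "(y - 1) * fourier v \<chi> = 1" using h by simp
      then show ?thesis using vB by blast
    qed
  qed
  \<comment> \<open>An element of Z[w] is a unit of the localization exactly if some multiple of it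
    in Z[w] lies in \<open>S\<close>; \<open>Q\<close> collects the nonunits.\<close>
  define Q where "Q = {x \<in> int_span w. \<not> (\<exists>v\<in>int_span w. x * v \<in> S)}"
  have nQ: "x \<notin> Q" if "x * v \<in> S" "v \<in> int_span w" for x v using that by (auto simp: Q_def)
  \<comment> \<open>By \<open>local\<close>, the elements \<open>x / s\<close> and
    \<open>x / s - 1\<close> cannot both be nonunits. Closure of \<open>Q\<close> under differences
    will follow from this.\<close>
  have sumQ: "x \<notin> Q \<or> s - x \<notin> Q" if x: "x \<in> int_span w" and s: "s \<in> S" for x s
  proof -
    have s0: "s \<noteq> 0" by (rule S_nonzero[OF s])
    have "1 / s \<in> A" unfolding A_def using s by (intro fractionsI) auto
    then have "x * (1 / s) \<in> B" using x WB AB by (intro B.mult_mem) auto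
    then have "x / s \<in> B" by simp
    then obtain v where v: "v \<in> B" "x / s * v = 1 \<or> (x / s - 1) * v = 1" using local by blast
    obtain v' t where t: "v = v' / t" "v' \<in> int_span w" "t \<in> S" using v(1) BW by (auto simp: fractions_def)
    have t0: "t \<noteq> 0" by (rule S_nonzero[OF t(3)])
    have st: "s * t \<in> S" using s t by (intro S_mult)
    from v(2) show ?thesis
    proof
      assume "x / s * v = 1"
      then have "x * v' = s * t" using s0 t0 t(1) by (simp add: field_simps)
      then show ?thesis using nQ[of x v'] st t by simp
    next
      assume "(x / s - 1) * v = 1"
      then have "(s - x) * (- v') = s * t" using s0 t0 t(1) by (simp add: field_simps)
      then show ?thesis using nQ[of "s - x" "- v'"] st t by (simp add: int_span.uminus_mem)
    qed
  qed
  have multQ: "x * y \<in> Q" if "x \<in> int_span w" "y \<in> Q" for x y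
  proof -
    have "y \<in> int_span w" using that by (simp add: Q_def)
    moreover have "x * y * v \<notin> S" if "v \<in> int_span w" for v
    proof
      assume "x * y * v \<in> S"
      then have "y * (x * v) \<in> S" by (simp add: mult_ac)
      then show False using nQ[of y "x * v"] \<open>y \<in> Q\<close> \<open>x \<in> int_span w\<close> that by (simp add: int_span.mult_mem)
    qed
    ultimately show ?thesis using that by (auto simp: Q_def)
  qed
  have primeQ: "prime_ideal_of (int_span w) Q"
  proof
    show "Q \<subseteq> int_span w" by (auto simp: Q_def)
    have "0 \<notin> S" using S_nonzero by blast
    then show "0 \<in> Q" by (auto simp: Q_def)
    show "1 \<notin> Q" using nQ[of 1 1] one_in_S by simp
    show "x * y \<in> Q" if "x \<in> int_span w" "y \<in> Q" for x y using that by (rule multQ)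
    show "x - y \<in> Q" if xy: "x \<in> Q" "y \<in> Q" for x y
    proof (rule ccontr)
      assume "x - y \<notin> Q"
      moreover have W: "x \<in> int_span w" "y \<in> int_span w" using xy by (auto simp: Q_def)
      ultimately obtain v where v: "v \<in> int_span w" "(x - y) * v \<in> S" by (auto simp: Q_def)
      have "v * x \<in> Q" using v(1) xy(1) by (rule multQ)
      moreover have "(- v) * y \<in> Q" using xy(2) v(1) by (intro multQ) (auto intro: int_span.uminus_mem)
      moreover have "(x - y) * v - v * x = (- v) * y" by (simp add: algebra_simps)
      ultimately show False using sumQ[of "v * x" "(x - y) * v"] v W by (auto simp: int_span.mult_mem)
    qed
    show "x \<in> Q \<or> y \<in> Q" if xy: "x \<in> int_span w" "y \<in> int_span w" "x * y \<in> Q" for x y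
    proof (rule ccontr)
      assume "\<not> ?thesis"
      then obtain u v where uv: "u \<in> int_span w" "x * u \<in> S" "v \<in> int_span w" "y * v \<in> S"
        using xy by (auto simp: Q_def)
      have "(x * y) * (u * v) = (x * u) * (y * v)" by (simp add: mult_ac)
      also have "\<dots> \<in> S" using uv(2,4) by (rule S_mult)
      finally show False using nQ[of "x * y" "u * v"] uv xy by (simp add: int_span.mult_mem)
    qed
  qed
  obtain Q' where Q': "prime_ideal_of (int_span w) Q'" "Q' \<inter> int_span \<zeta> = P" using prime_above by blast
  interpret Q': prime_ideal_of "int_span w" Q' by (rule Q')
  have pQ: "of_nat p \<in> Q"
  proof -
    have "of_nat p * v \<notin> S" if "v \<in> int_span w" for v
    proof
      assume s: "of_nat p * v \<in> S"
      have "of_nat p \<in> Q'" using pP Q' by auto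
      then have "of_nat p * v \<in> Q'" using that by (rule Q'.mult_in')
      then show False using s Q'(2) by (auto simp: S_def)
    qed
    then show ?thesis by (auto simp: Q_def)
  qed
  interpret cyclotomic_prime n n0 N L p e k \<zeta> w Q
    by (rule cyclotomic_primeI[OF primeQ pQ])
  show ?thesis
  proof (rule decomposition_group[OF _ a])
    fix a and F :: "int poly"
    assume a: "coprime a L" "[a = 1] (mod n)" and FQ: "ipoly F w \<in> Q"
    show "ipoly F (w ^ a) \<in> Q"
    proof (rule ccontr)
      assume "ipoly F (w ^ a) \<notin> Q"
      moreover have "ipoly F (w ^ a) \<in> int_span w"
        by (intro int_span.poly_mem int_span.power_mem) (auto simp: coeff_map_poly)
      ultimately obtain v where v: "v \<in> int_span w" "ipoly F (w ^ a) * v \<in> S" by (auto simp: Q_def)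
      define s where "s = ipoly F (w ^ a) * v"
      obtain V :: "int poly" where V: "v = ipoly V w" using v(1) by (elim int_spanE)
      have "s \<in> int_span \<zeta>" using v(2) by (simp add: s_def S_def)
      then obtain T :: "int poly" where T: "s = ipoly T \<zeta>" by (elim int_spanE)
      obtain c where c: "\<zeta> = w ^ c" using root_of_unity_eq_power[OF w \<zeta>L] by blast
      \<comment> \<open>The exponent of the inverse automorphism; it too fixes \<zeta>.\<close>
      obtain b where b: "[a * b = 1] (mod L)" using cong_solve_coprime_nat[OF a(1)] by auto
      have bL: "coprime b L"
        using b by (metis cong_imp_coprime cong_sym coprime_1_left coprime_mult_left_iff)
      have "[a * b = 1 * b] (mod n)" using a(2) by (rule cong_scalar_right)
      moreover have "[a * b = 1] (mod n)" using b nL by (rule cong_dvd_modulus_nat)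
      ultimately have bn: "[b = 1] (mod n)" by (metis cong_sym cong_trans mult_1)
      \<comment> \<open>Encodes the relation \<open>F (w ^ a) * V w = T \<zeta>\<close> as a
        polynomial vanishing at \<open>w\<close>. Its conjugate at \<open>w ^ b\<close> reads
        \<open>F w * V (w ^ b) = s\<close> with \<open>s\<close> in \<open>S\<close>, so
        \<open>ipoly F w\<close> could not be in \<open>Q\<close>.\<close>
      define E where "E = pcompose F (Polynomial.monom 1 a) * V - pcompose T (Polynomial.monom 1 c)"
      have E: "ipoly E y = ipoly F (y ^ a) * ipoly V y -
          ipoly T (y ^ c)" for y :: complex
        by (simp add: E_def of_int_poly_hom.hom_minus of_int_poly_hom.hom_mult of_int_hom.map_poly_pcompose
            map_poly_monom poly_pcompose poly_monom)
      have "ipoly E w = 0" by (simp add: E c[symmetric] T[symmetric] V[symmetric] s_def)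
      then have "ipoly E (w ^ b) = 0" by (rule root_conjugate[OF w bL])
      moreover have "(w ^ b) ^ a = w"
        using primitive_root_of_unity_eq_power_iff[OF w, of "a * b" 1] b by (simp add: mult.commute flip: power_mult)
      moreover have "(w ^ b) ^ c = \<zeta>"
      proof -
        have "(w ^ b) ^ c = \<zeta> ^ b" by (simp add: c mult.commute flip: power_mult)
        also have "\<dots> = \<zeta> ^ 1" using bn by (simp only: primitive_root_of_unity_eq_power_iff[OF \<zeta>])
        finally show ?thesis by simp
      qed
      ultimately have "ipoly F w * ipoly V (w ^ b) = s"
        by (simp add: E T)
      moreover have "ipoly V (w ^ b) \<in> int_span w"
        by (intro int_span.poly_mem int_span.power_mem) (auto simp: coeff_map_poly)
      moreover have "s \<in> S" using v(2) by (simp add: s_def)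
      ultimately show False using nQ FQ by metis
    qed
  qed
qed

text \<open>By Sylow's theorem for the first power of \<open>p\<close>, there would be a subgroup of
  order \<open>p\<close>, with a nontrivial element killed by both \<open>p\<close> and the coprime
  \<open>m\<close>.\<close>

lemma not_dvd_card_torsion:
  assumes m: "\<not> p dvd m"
  shows "subgroup {g \<in> carrier G. g [^] (m::nat) = \<one>} G"
    and "\<not> p dvd card {g \<in> carrier G. g [^] m = \<one>}"
proof -
  let ?H = "{g \<in> carrier G. g [^] m = \<one>}"
  show H: "subgroup ?H G"
    by (rule subgroupI) (auto simp: nat_pow_distrib nat_pow_inv)
  show "\<not> p dvd card ?H"
  proof
    assume "p dvd card ?H"
    then obtain r where r: "card ?H = p ^ 1 * r" by auto
    interpret H: group "G\<lparr>carrier := ?H\<rparr>" by (rule subgroup.subgroup_is_group[OF H is_group])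
    have "\<exists>T. subgroup T (G\<lparr>carrier := ?H\<rparr>) \<and> card T = p ^ 1"
      by (rule sylow_thm[OF p H.is_group, of 1 r]) (simp_all add: Coset.order_def r[simplified])
    then obtain T where T: "subgroup T (G\<lparr>carrier := ?H\<rparr>)" "card T = p" by auto
    have TG: "subgroup T G" by (rule incl_subgroup[OF H T(1)])
    have "T \<noteq> {\<one>}" using T(2) p prime_gt_1_nat by fastforce
    moreover have "\<one> \<in> T" using TG by (rule subgroup.one_closed)
    ultimately obtain x where x: "x \<in> T" "x \<noteq> \<one>" by blast
    interpret T: group "G\<lparr>carrier := T\<rparr>" by (rule subgroup.subgroup_is_group[OF TG is_group])
    have "x [^]\<^bsub>G\<lparr>carrier := T\<rparr>\<^esub> Coset.order (G\<lparr>carrier := T\<rparr>) = \<one>\<^bsub>G\<lparr>carrier := T\<rparr>\<^esub>"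
      using x(1) by (intro T.pow_order_eq_1) simp
    then have xp: "x [^] p = \<one>"
      by (simp add: Coset.order_def T(2) nat_pow_consistent[symmetric])
    have xH: "x \<in> ?H" using x(1) subgroup.subset[OF T(1)] by auto
    have "coprime p m" using p m by (rule prime_imp_coprime)
    then have "gcd m p = 1" by (simp only: coprime_imp_gcd_eq_1 gcd.commute[of m])
    then have "x [^] (1::nat) = \<one>" using pow_gcd_eq_one[of x m p] xp xH by simp
    then show False using x xH by simp
  qed
qed

text \<open>In the basis \<open>G\<close>, multiplication by \<open>f\<close> has the matrix
  \<open>f (x \<otimes> inv h)\<close> with the inverse characters as eigenvectors, so its
  determinant \<open>d\<close> is the product of the character values. It lies in Z[\<zeta>] and,
  \<open>Q\<close> being prime, outside \<open>Q\<close>, hence in \<open>S\<close>. The column of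
  the adjugate at the neutral element is \<open>v\<close>.\<close>

lemma unit_in_group_ring:
  assumes f: "\<And>g. g \<in> carrier G \<Longrightarrow> f g \<in> int_span \<zeta>"
    and nz: "\<And>\<chi>. \<chi> \<in> characters \<Longrightarrow> fourier f \<chi> \<notin> Q"
    and Q: "prime_ideal_of (int_span w) Q" "Q \<inter> int_span \<zeta> = P"
  shows "\<exists>v\<in>funs (int_span \<zeta>). \<exists>d\<in>S. \<forall>\<chi>\<in>characters. fourier f \<chi> * fourier v \<chi> = d"
proof -
  interpret Q: prime_ideal_of "int_span w" Q by (rule Q)
  define d where "d = (\<Prod>\<chi>\<in>characters. fourier f \<chi>)"
  let ?M = "\<lambda>x h. f (x \<otimes> inv h)"
  let ?F = "\<lambda>h \<chi>. \<chi> (inv h)"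
  have M: "?M x h \<in> int_span \<zeta>" if "x \<in> carrier G" "h \<in> carrier G" for x h using that by (intro f) auto
  have shift: "(\<Sum>h\<in>carrier G. ?M x h * r h) = (\<Sum>y\<in>carrier G. f y * r (inv y \<otimes> x))"
    if x: "x \<in> carrier G" for x and r :: "'a \<Rightarrow> complex"
  proof (rule sum.reindex_bij_witness[of _ "\<lambda>y. inv y \<otimes> x" "\<lambda>h. x \<otimes> inv h"])
    fix h assume h: "h \<in> carrier G"
    show "inv (x \<otimes> inv h) \<otimes> x = h" using x h by (simp add: inv_mult m_ac)
    then show "f (x \<otimes> inv h) * r (inv (x \<otimes> inv h) \<otimes> x) = ?M x h * r h" by simp
    show "x \<otimes> inv h \<in> carrier G" using x h by simp
    show "inv h \<otimes> x \<in> carrier G" using x h by simp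
    show "x \<otimes> inv (inv h \<otimes> x) = h" using x h by (simp add: inv_mult m_ac)
  qed
  have eig: "(\<Sum>h\<in>carrier G. ?M x h * ?F h \<chi>) = fourier f \<chi> * ?F x \<chi>"
    if x: "x \<in> carrier G" and \<chi>: "\<chi> \<in> characters" for x \<chi>
  proof -
    have "(\<Sum>h\<in>carrier G. ?M x h * ?F h \<chi>) = (\<Sum>y\<in>carrier G. f y * \<chi> (y \<otimes> inv x))"
      unfolding shift[OF x] using x by (intro sum.cong refl) (simp add: inv_mult m_comm)
    also have "\<dots> = fourier f \<chi> * ?F x \<chi>"
      using x \<chi> by (simp add: fourier_def sum_distrib_right character_mult mult.assoc)
    finally show ?thesis .
  qed
  have orth: "(\<Sum>h\<in>carrier G. \<chi> h * ?F h \<psi>) = (if \<chi> = \<psi> then of_nat (card (carrier G)) else 0)"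
    if \<chi>: "\<chi> \<in> characters" and \<psi>: "\<psi> \<in> characters" for \<chi> \<psi>
  proof -
    have "(\<forall>h\<in>carrier G. \<chi> h = \<psi> h) \<longleftrightarrow> \<chi> = \<psi>"
      using \<chi> \<psi> by (auto simp: characters_def intro!: extensionalityI[of _ "carrier G"])
    then show ?thesis using character_orthogonality[OF subgroup_self \<chi> \<psi>] by simp
  qed
  have card0: "(of_nat (card (carrier G)) :: complex) \<noteq> 0"
    using order_pos unfolding Coset.order_def by (metis of_nat_eq_0_iff less_irrefl)
  note adj = diagonalizable_adjugate[OF unital_subring_int_span finite_carrier finite_characters card_characters[symmetric],
      of ?M \<zeta> ?F "\<lambda>\<chi>. fourier f \<chi>" "\<lambda>\<chi>. \<chi>" "of_nat (card (carrier G))", OF M eig orth card0, folded d_def]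
  have dO: "d \<in> int_span \<zeta>" by (rule adj(1))
  obtain B where B: "\<And>i j. i \<in> carrier G \<Longrightarrow> j \<in> carrier G \<Longrightarrow> B i j \<in> int_span \<zeta>"
    "\<And>i j. i \<in> carrier G \<Longrightarrow> j \<in> carrier G \<Longrightarrow> (\<Sum>h\<in>carrier G. ?M i h * B h j) = (if i = j then d else 0)"
    using adj(2) by blast
  define v where "v = (\<lambda>h\<in>carrier G. B h \<one>)"
  have "v \<in> funs (int_span \<zeta>)" using B(1) by (auto simp: v_def)
  moreover have "d \<in> S"
  proof -
    have fW: "fourier f \<chi> \<in> int_span w" if "\<chi> \<in> characters" for \<chi>
      unfolding fourier_def using f O_subset w_root[OF character_pow_L[OF that]]
      by (intro int_span.sum_mem int_span.mult_mem) auto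
    have "d \<notin> Q"
    proof
      assume "d \<in> Q"
      then have "\<exists>\<chi>\<in>characters. fourier f \<chi> \<in> Q"
        unfolding d_def using fW by (intro Q.prod_in_imp) auto
      then show False using nz by blast
    qed
    then show ?thesis using dO Q(2) by (auto simp: S_def)
  qed
  moreover have "fourier f \<chi> * fourier v \<chi> = d" if \<chi>: "\<chi> \<in> characters" for \<chi>
  proof -
    have "convolution f v = (\<lambda>x\<in>carrier G. if x = \<one> then d else 0)"
    proof (rule extensionalityI[of _ "carrier G"])
      fix x assume x: "x \<in> carrier G"
      have "convolution f v x = (\<Sum>h\<in>carrier G. ?M x h * v h)"
        unfolding shift[OF x] using x by (simp add: convolution_def)
      also have "\<dots> = (\<Sum>h\<in>carrier G. ?M x h * B h \<one>)" by (simp add: v_def)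
      also have "\<dots> = (if x = \<one> then d else 0)" using x by (intro B(2)) auto
      finally show "convolution f v x = (\<lambda>x\<in>carrier G. if x = \<one> then d else 0) x" using x by simp
    qed (auto simp: convolution_def)
    then show ?thesis
      using fourier_convolution[OF \<chi>, of f v] fourier_delta[OF \<chi> one_closed, of d] \<chi> by (simp add: character_one)
  qed
  ultimately show ?thesis by blast
qed

lemma powers_imp_clean:
  assumes powers: "\<And>a. coprime a N \<Longrightarrow> [a = 1] (mod n0) \<Longrightarrow> \<exists>i. [a = p ^ i] (mod N)"
  shows "clean_ring (group_ring (complex_subring A) G)"
  unfolding clean_group_ring_iff[OF unital_subring_A]
proof
  fix f assume f: "f \<in> funs A"
  interpret A: unital_subring A by (rule unital_subring_A)
  obtain Q where Q: "prime_ideal_of (int_span w) Q" "Q \<inter> int_span \<zeta> = P" using prime_above by blast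
  interpret Q: prime_ideal_of "int_span w" Q by (rule Q)
  have pQ: "of_nat p \<in> Q" using pP Q(2) by auto
  interpret c: cyclotomic_prime n n0 N L p e k \<zeta> w Q
    by (rule cyclotomic_primeI[OF Q(1) pQ])
  have SQ: "s \<notin> Q" if "s \<in> S" for s using that Q(2) by (auto simp: S_def)
  have SO: "s \<in> int_span \<zeta>" if "s \<in> S" for s using that by (auto simp: S_def)
  have denom: "\<exists>s\<in>S. \<forall>g\<in>carrier G. s * h g \<in> int_span \<zeta>" if "h \<in> funs A" for h
    unfolding S_def
    by (rule common_denominator[OF P finite_carrier]) (use that in \<open>auto simp: A_def S_def\<close>)
  have chiW: "\<chi> x \<in> int_span w" if "\<chi> \<in> characters" "x \<in> carrier G" for \<chi> x
    by (rule w_root[OF character_pow_L[OF that]])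
  obtain s where s: "s \<in> S" "\<And>g. g \<in> carrier G \<Longrightarrow> s * f g \<in> int_span \<zeta>" using denom[OF f] by blast
  \<comment> \<open>\<open>f\<close> with denominators cleared, so that its character values lie in
    Z[w] and can be tested modulo \<open>Q\<close>.\<close>
  define b where "b = (\<lambda>g. s * f g)"
  have bO: "b g \<in> int_span \<zeta>" if "g \<in> carrier G" for g using s(2)[OF that] by (simp add: b_def)
  have bW: "b g \<in> int_span w" if "g \<in> carrier G" for g using bO[OF that] O_subset by blast
  have fb: "fourier b \<chi> = s * fourier f \<chi>" for \<chi> by (simp add: b_def fourier_def sum_distrib_left mult.assoc)
  have fbW: "fourier b \<chi> \<in> int_span w" if "\<chi> \<in> characters" for \<chi>
    unfolding fourier_def using bW chiW[OF that] by (intro int_span.sum_mem int_span.mult_mem) auto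
  have frob: "fourier b \<chi> ^ p ^ i - (\<Sum>g\<in>carrier G. b g ^ p ^ i * \<chi> g ^ p ^ i) \<in> Q"
    if "\<chi> \<in> characters" for \<chi> i
    using Q.frobenius_sum[OF p pQ, of "carrier G" "\<lambda>g. b g * \<chi> g" i] bW chiW[OF that]
    by (simp add: fourier_def power_mult_distrib int_span.mult_mem)
  define T where "T = {\<chi> \<in> characters. fourier b \<chi> \<in> Q}"
  \<comment> \<open>The number of elements of the residue field of Z[\<zeta>] at
    \<open>P\<close>.\<close>
  define q where "q = p ^ Pocklington.ord n0 p"
  let ?pow = "\<lambda>\<chi> j. restrict (\<lambda>x. \<chi> x ^ j) (carrier G)"
  \<comment> \<open>The coefficients \<open>b g\<close> are fixed by the \<open>q\<close>-th power
    modulo \<open>Q\<close>, so \<open>fourier b \<chi> ^ q\<close> is congruent to the value of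
    \<open>b\<close> at the \<open>q\<close>-th power of \<chi>.\<close>
  have Tq: "?pow \<chi> q \<in> T" if \<chi>: "\<chi> \<in> T" for \<chi>
  proof -
    have \<chi>': "\<chi> \<in> characters" "fourier b \<chi> \<in> Q" using \<chi> by (auto simp: T_def)
    have "(\<Sum>g\<in>carrier G. b g ^ q * \<chi> g ^ q) - fourier b (?pow \<chi> q) \<in> Q"
      unfolding fourier_def
    proof (rule Q.diff_sum)
      fix g assume g: "g \<in> carrier G"
      have "b g ^ q - b g \<in> Q" unfolding q_def by (rule c.residue_field_frobenius[OF bO[OF g]])
      then have "(b g ^ q - b g) * \<chi> g ^ q \<in> Q" using chiW[OF \<chi>'(1) g] by (intro Q.mult_in' int_span.power_mem)
      then show "b g ^ q * \<chi> g ^ q - b g * ?pow \<chi> q g \<in> Q" using g by (simp add: algebra_simps)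
    qed
    with frob[OF \<chi>'(1), of "Pocklington.ord n0 p", folded q_def]
    have "fourier b \<chi> ^ q - fourier b (?pow \<chi> q) \<in> Q" by (rule Q.diff_trans)
    moreover have "fourier b \<chi> ^ q \<in> Q"
      using \<chi>'(2) p_gt_1 by (intro Q.power_in_ideal) (auto simp: q_def)
    ultimately have "fourier b (?pow \<chi> q) \<in> Q" using Q.diff_mem_iff by blast
    then show ?thesis using character_power[OF \<chi>'(1)] by (simp add: T_def)
  qed
  have Tqi: "?pow \<chi> (q ^ i) \<in> T" if \<chi>: "\<chi> \<in> T" for \<chi> i
  proof (induction i)
    case 0
    have "?pow \<chi> (q ^ 0) = \<chi>"
      by (rule extensionalityI[of _ "carrier G"]) (use \<chi> in \<open>auto simp: T_def characters_def\<close>)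
    then show ?case using \<chi> by simp
  next
    case (Suc i)
    have "?pow (?pow \<chi> (q ^ i)) q = ?pow \<chi> (q ^ Suc i)"
      by (rule ext) (simp add: mult.commute flip: power_mult)
    then show ?case using Tq[OF Suc] by (simp only:)
  qed
  \<comment> \<open>\<open>H\<close> below is the part of \<open>G\<close> of order prime to
    \<open>p\<close>, and the \<open>p ^ \<kappa>\<close>-th power of every group element lands in
    it.\<close>
  obtain \<kappa> m where m: "Coset.order G = p ^ \<kappa> * m" "\<not> p dvd m"
    using multiplicity_decompose'[of "Coset.order G" p] order_pos p by (metis not_prime_unit not_gr_zero)
  define H where "H = {g \<in> carrier G. g [^] m = \<one>}"
  have H: "subgroup H G" and pH: "\<not> p dvd card H"
    unfolding H_def by (rule not_dvd_card_torsion[OF m(2)])+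
  have HG: "H \<subseteq> carrier G" by (auto simp: H_def)
  have finH: "finite H" using HG finite_carrier by (rule finite_subset)
  have cardH: "0 < card H" using finH subgroup.one_closed[OF H] by (auto simp: card_gt_0_iff)
  have pow_in_H: "g [^] (p ^ \<kappa>) \<in> H" if "g \<in> carrier G" for g
    using that m(1) pow_order_eq_1[OF that] by (simp add: H_def nat_pow_pow)
  have HN: "\<chi> h ^ N = 1" if \<chi>: "\<chi> \<in> characters" and h: "h \<in> H" for \<chi> h
  proof -
    have hG: "h \<in> carrier G" using h HG by blast
    have "group_exponent G dvd L" by (simp add: L_lcm)
    then have "h [^] L = \<one>" by (rule pow_eq_one_dvd[OF hG pow_group_exponent[OF hG]])
    then have 1: "h [^] gcd m L = \<one>" using h hG by (intro pow_gcd_eq_one) (auto simp: H_def)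
    have "coprime p m" using p m(2) by (rule prime_imp_coprime)
    then have "coprime m (p ^ k)" by (simp add: coprime_commute)
    then have "coprime (gcd m L) (p ^ k)" by (rule coprime_divisors[OF gcd_dvd1 dvd_refl])
    moreover have "gcd m L dvd p ^ k * N" by (simp flip: L)
    ultimately have "gcd m L dvd N" by (simp add: coprime_dvd_mult_right_iff)
    then have "h [^] N = \<one>" by (rule pow_eq_one_dvd[OF hG 1])
    then show ?thesis using \<chi> hG by (metis character_one character_pow)
  qed
  \<comment> \<open>Two characters agreeing on \<open>H\<close> have equal
    \<open>p ^ \<kappa>\<close>-th powers, so the \<open>p ^ \<kappa>\<close>-th powers of their
    values at \<open>b\<close> are congruent modulo \<open>Q\<close>.\<close>
  have T_restrict: "\<chi> \<in> T"
    if \<chi>: "\<chi> \<in> characters" and \<psi>: "\<psi> \<in> T" and eq: "restrict \<chi> H = restrict \<psi> H" for \<chi> \<psi>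
  proof -
    have \<psi>': "\<psi> \<in> characters" "fourier b \<psi> \<in> Q" using \<psi> by (auto simp: T_def)
    have "\<chi> g ^ p ^ \<kappa> = \<psi> g ^ p ^ \<kappa>" if g: "g \<in> carrier G" for g
    proof -
      have "\<chi> (g [^] (p ^ \<kappa>)) = \<psi> (g [^] (p ^ \<kappa>))"
        using fun_cong[OF eq, of "g [^] (p ^ \<kappa>)"] pow_in_H[OF g] by simp
      then show ?thesis using g \<chi> \<psi>'(1) by (simp add: character_pow)
    qed
    then have eq_sum: "(\<Sum>g\<in>carrier G. b g ^ p ^ \<kappa> * \<chi> g ^ p ^ \<kappa>) = (\<Sum>g\<in>carrier G. b g ^ p ^ \<kappa> * \<psi> g ^ p ^ \<kappa>)" by simp
    have "fourier b \<chi> ^ p ^ \<kappa> - fourier b \<psi> ^ p ^ \<kappa> \<in> Q"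
      by (rule Q.diff_trans[OF frob[OF \<chi>, of \<kappa>, unfolded eq_sum] Q.diff_sym[OF frob[OF \<psi>'(1), of \<kappa>]]])
    moreover have "fourier b \<psi> ^ p ^ \<kappa> \<in> Q"
      using \<psi>'(2) p_gt_1 by (intro Q.power_in_ideal) auto
    ultimately have "fourier b \<chi> ^ p ^ \<kappa> \<in> Q" using Q.diff_mem_iff by blast
    then have "fourier b \<chi> \<in> Q" by (rule Q.power_in[OF fbW[OF \<chi>]])
    then show ?thesis using \<chi> by (simp add: T_def)
  qed
  define TH where "TH = (\<lambda>\<chi>. restrict \<chi> H) ` T"
  have finTH: "finite TH" by (simp add: TH_def T_def)
  have TH_root: "\<theta> h ^ N = 1" if "\<theta> \<in> TH" "h \<in> H" for \<theta> h
    using that HN by (auto simp: TH_def T_def)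
  \<comment> \<open>On \<open>H\<close> characters take \<open>N\<close>-th roots of unity as
    values, so the exponent \<open>a\<close> may be replaced by a power of \<open>p\<close>; being 1
    modulo \<open>n0\<close>, this is a power of \<open>q\<close>.\<close>
  have TH_closed: "restrict (\<lambda>h. \<theta> h ^ a) H \<in> TH" if \<theta>: "\<theta> \<in> TH" and a: "a \<in> c.unit_kernel" for \<theta> a
  proof -
    obtain \<chi> where \<chi>: "\<chi> \<in> T" "\<theta> = restrict \<chi> H" using \<theta> by (auto simp: TH_def)
    have a': "coprime a N" "[a = 1] (mod n0)" using a by (auto simp: c.unit_kernel_def)
    obtain i where i: "[a = p ^ i] (mod N)" using powers[OF a'] by blast
    then have "[a = p ^ i] (mod n0)" using n0N by (rule cong_dvd_modulus_nat)
    then have "[p ^ i = 1] (mod n0)" using a'(2) by (metis cong_sym cong_trans)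
    then obtain j where j: "i = Pocklington.ord n0 p * j" unfolding ord_divides by (elim dvdE)
    have qj: "p ^ i = q ^ j" by (simp add: q_def j power_mult)
    have "\<chi> h ^ a = \<chi> h ^ (q ^ j)" if h: "h \<in> H" for h
    proof -
      have "\<chi> h ^ N = 1" using \<chi>(1) h HN by (simp add: T_def)
      then have "\<chi> h ^ (r mod N) = \<chi> h ^ r" for r by (rule root_of_unity_power_mod)
      then show ?thesis using i unfolding cong_def qj by metis
    qed
    then have "restrict (\<lambda>h. \<theta> h ^ a) H = restrict (?pow \<chi> (q ^ j)) H"
      using HG by (auto simp: \<chi>(2) restrict_def fun_eq_iff)
    moreover have "restrict (?pow \<chi> (q ^ j)) H \<in> TH" unfolding TH_def using Tqi[OF \<chi>(1)] by (rule imageI)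
    ultimately show ?thesis by (simp only:)
  qed
  have TH_inj: "inj_on (\<lambda>\<theta>. restrict (\<lambda>h. \<theta> h ^ a) H) TH" if a: "a \<in> c.unit_kernel" for a
  proof (rule inj_onI)
    fix \<theta> \<theta>' assume th: "\<theta> \<in> TH" "\<theta>' \<in> TH" "restrict (\<lambda>h. \<theta> h ^ a) H = restrict (\<lambda>h. \<theta>' h ^ a) H"
    obtain a' where a': "[a * a' = 1] (mod N)"
      using a cong_solve_coprime_nat[of a N] by (auto simp: c.unit_kernel_def)
    have inv: "(x ^ a) ^ a' = x" if "x ^ N = 1" for x :: complex
    proof -
      have mod: "x ^ (r mod N) = x ^ r" for r using that by (rule root_of_unity_power_mod)
      have "x ^ (a * a') = x ^ 1" using a' mod[of "a * a'"] mod[of 1] by (simp only: cong_def)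
      then show ?thesis by (simp add: power_mult)
    qed
    show "\<theta> = \<theta>'"
    proof (rule extensionalityI[of _ H])
      fix h assume h: "h \<in> H"
      then have "\<theta> h ^ a = \<theta>' h ^ a" using fun_cong[OF th(3), of h] by simp
      then show "\<theta> h = \<theta>' h" using inv[OF TH_root[OF th(1) h]] inv[OF TH_root[OF th(2) h]] by metis
    qed (use th in \<open>auto simp: TH_def\<close>)
  qed
  have TH_sum: "(\<Sum>\<theta>\<in>TH. \<theta> h ^ a) = (\<Sum>\<theta>\<in>TH. \<theta> h)" if h: "h \<in> H" and a: "a \<in> c.unit_kernel" for h a
  proof -
    let ?t = "\<lambda>\<theta>. restrict (\<lambda>h. \<theta> h ^ a) H"
    have "?t ` TH \<subseteq> TH" using TH_closed[OF _ a] by (rule image_subsetI)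
    with finTH have "?t ` TH = TH" using TH_inj[OF a] by (rule endo_inj_surj)
    with TH_inj[OF a] have "bij_betw ?t TH TH" by (rule bij_betw_imageI)
    from sum.reindex_bij_betw[OF this, of "\<lambda>\<theta>. \<theta> h"] show ?thesis using h by simp
  qed
  have cardS: "of_nat (card H) \<in> S"
  proof -
    have "coprime p (card H)" using p pH by (rule prime_imp_coprime)
    then have "of_nat (card H) \<notin> P" by (rule P.coprime_of_nat_notin[OF pP])
    then show ?thesis by (simp add: S_def)
  qed
  \<comment> \<open>Inverse Fourier transform on \<open>H\<close> of the indicator function of
    \<open>TH\<close>, extended by 0 to \<open>G\<close>.\<close>
  define e where "e = (\<lambda>g\<in>carrier G. if g \<in> H then (\<Sum>\<theta>\<in>TH. \<theta> (inv g)) / of_nat (card H) else 0)"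
  have eA: "e \<in> funs A"
  proof -
    have "(\<Sum>\<theta>\<in>TH. \<theta> h) / of_nat (card H) \<in> A" if h: "h \<in> H" for h
    proof -
      obtain x y where xy: "x \<in> int_span \<zeta>" "y \<in> int_span \<zeta> - Q" "(\<Sum>\<theta>\<in>TH. \<theta> h) * y = x"
        using c.trace_descent[of TH "\<lambda>\<theta>. \<theta> h"] TH_root[OF _ h] TH_sum[OF h] by blast
      have yS: "y \<in> S" using xy(2) Q(2) by (auto simp: S_def)
      have "x / (y * of_nat (card H)) \<in> A"
        unfolding A_def using xy(1) S_mult[OF yS cardS] by (rule fractionsI)
      moreover have "(\<Sum>\<theta>\<in>TH. \<theta> h) = x / y" using xy(3) S_nonzero[OF yS] by (simp add: field_simps)
      ultimately show ?thesis by simp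
    qed
    then show ?thesis using subgroup.m_inv_closed[OF H] by (auto simp: e_def)
  qed
  have fe: "fourier e \<chi> = (if \<chi> \<in> T then 1 else 0)" if \<chi>: "\<chi> \<in> characters" for \<chi>
  proof -
    have "fourier e \<chi> = (\<Sum>g\<in>H. (\<Sum>\<theta>\<in>TH. \<theta> (inv g)) / of_nat (card H) * \<chi> g)"
    proof -
      have "fourier e \<chi> = (\<Sum>g\<in>H. e g * \<chi> g)"
        unfolding fourier_def by (rule sum.mono_neutral_right) (use HG in \<open>auto simp: e_def\<close>)
      then show ?thesis using HG by (auto simp: e_def intro!: sum.cong)
    qed
    also have "\<dots> = (\<Sum>\<theta>\<in>TH. (\<Sum>g\<in>H. \<chi> g * \<theta> (inv g)) / of_nat (card H))"
      by (simp add: sum_distrib_left sum_distrib_right sum_divide_distrib mult_ac) (rule sum.swap)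
    also have "\<dots> = (\<Sum>\<theta>\<in>TH. if \<theta> = restrict \<chi> H then 1 else 0)"
    proof (rule sum.cong[OF refl])
      fix \<theta> assume "\<theta> \<in> TH"
      then obtain \<psi> where \<psi>: "\<psi> \<in> characters" "\<theta> = restrict \<psi> H" by (auto simp: TH_def T_def)
      have "(\<Sum>g\<in>H. \<chi> g * \<theta> (inv g)) = (\<Sum>g\<in>H. \<chi> g * \<psi> (inv g))"
        using subgroup.m_inv_closed[OF H] by (intro sum.cong) (auto simp: \<psi>(2))
      also have "\<dots> = (if \<forall>h\<in>H. \<chi> h = \<psi> h then of_nat (card H) else 0)"
        by (rule character_orthogonality[OF H \<chi> \<psi>(1)])
      also have "(\<forall>h\<in>H. \<chi> h = \<psi> h) \<longleftrightarrow> \<theta> = restrict \<chi> H"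
        unfolding \<psi>(2) by (auto simp: restrict_def fun_eq_iff)
      finally show "(\<Sum>g\<in>H. \<chi> g * \<theta> (inv g)) / of_nat (card H) = (if \<theta> = restrict \<chi> H then 1 else 0)"
        using cardH by simp
    qed
    also have "\<dots> = (if restrict \<chi> H \<in> TH then 1 else 0)" using finTH by simp
    also have "restrict \<chi> H \<in> TH \<longleftrightarrow> \<chi> \<in> T"
    proof
      assume "restrict \<chi> H \<in> TH"
      then obtain \<psi> where "\<psi> \<in> T" "restrict \<chi> H = restrict \<psi> H" by (auto simp: TH_def)
      then show "\<chi> \<in> T" by (rule T_restrict[OF \<chi>])
    qed (auto simp: TH_def)
    finally show ?thesis .
  qed
  define u where "u = (\<lambda>g\<in>carrier G. f g - e g)"
  have uA: "u \<in> funs A" using f eA by (auto simp: u_def)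
  have fu: "fourier u \<chi> = fourier f \<chi> - fourier e \<chi>" for \<chi> unfolding u_def by (rule fourier_diff)
  obtain t where t: "t \<in> S" "\<And>g. g \<in> carrier G \<Longrightarrow> t * u g \<in> int_span \<zeta>" using denom[OF uA] by blast
  \<comment> \<open>\<open>t\<close> clears the denominators of \<open>u\<close>; the factor
    \<open>s\<close> is included so that the character values can be written in terms of
    \<open>b\<close>.\<close>
  define r where "r = s * t"
  have rS: "r \<in> S" unfolding r_def using s(1) t(1) by (rule S_mult)
  define u' where "u' = (\<lambda>g. r * u g)"
  have fu': "fourier u' \<chi> = r * fourier u \<chi>" for \<chi>
    by (simp add: u'_def fourier_def sum_distrib_left mult.assoc)
  have "u' g \<in> int_span \<zeta>" if "g \<in> carrier G" for g
  proof -
    have "s * (t * u g) \<in> int_span \<zeta>" using SO[OF s(1)] t(2)[OF that] by (rule int_span.mult_mem)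
    then show ?thesis by (simp add: u'_def r_def mult.assoc)
  qed
  moreover have "fourier u' \<chi> \<notin> Q" if \<chi>: "\<chi> \<in> characters" for \<chi>
  proof
    assume "fourier u' \<chi> \<in> Q"
    moreover have "fourier u' \<chi> = t * (fourier b \<chi> - s * fourier e \<chi>)"
      by (simp add: fu' fu fb r_def algebra_simps)
    moreover have "fourier b \<chi> - s * fourier e \<chi> \<in> int_span w"
      using fbW[OF \<chi>] SO[OF s(1)] O_subset fe[OF \<chi>] by (auto intro!: int_span.diff_mem)
    moreover have "t \<in> int_span w" using SO[OF t(1)] O_subset by blast
    ultimately have "t \<in> Q \<or> fourier b \<chi> - s * fourier e \<chi> \<in> Q" using Q.prime_in by metis
    then have d: "fourier b \<chi> - s * fourier e \<chi> \<in> Q" using SQ[OF t(1)] by blast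
    show False
    proof (cases "\<chi> \<in> T")
      case True
      then have "fourier b \<chi> \<in> Q" by (simp add: T_def)
      then have "s \<in> Q" using d fe[OF \<chi>] True Q.diff_mem_iff[of "fourier b \<chi>" s] by simp
      then show False using SQ[OF s(1)] by blast
    next
      case False
      then show False using d fe[OF \<chi>] \<chi> by (simp add: T_def)
    qed
  qed
  ultimately obtain v' d where v': "v' \<in> funs (int_span \<zeta>)" and d: "d \<in> S"
    and uv: "\<And>\<chi>. \<chi> \<in> characters \<Longrightarrow> fourier u' \<chi> * fourier v' \<chi> = d"
    using unit_in_group_ring[of u' Q] Q by blast
  \<comment> \<open>Since \<open>u'\<close> is \<open>r * u\<close> and the convolution of
    \<open>u'\<close> and \<open>v'\<close> has all character values \<open>d\<close>, the factor
    \<open>r / d\<close> gives the inverse of \<open>u\<close>.\<close>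
  define v where "v = (\<lambda>g\<in>carrier G. (r / d) * v' g)"
  have "r / d \<in> A" unfolding A_def using SO[OF rS] d by (rule fractionsI)
  then have "(r / d) * v' g \<in> A" if "g \<in> carrier G" for g
    using PiE_mem[OF v' that] O_subset_A by (intro A.mult_mem) auto
  then have "v \<in> funs A" unfolding v_def by (intro restrict_PiE_iff[THEN iffD2] ballI)
  moreover have "fourier u \<chi> * fourier v \<chi> = 1" if \<chi>: "\<chi> \<in> characters" for \<chi>
  proof -
    have "fourier u \<chi> * fourier v \<chi> = fourier u' \<chi> * fourier v' \<chi> / d"
      unfolding v_def fourier_scale fu' by simp
    then show ?thesis using uv[OF \<chi>] S_nonzero[OF d] by simp
  qed
  ultimately show "fourier_clean A f"
    unfolding fourier_clean_def
    by (intro bexI[of _ u, OF _ uA] bexI[of _ v] bexI[of _ e, OF _ eA] ballI conjI) (simp_all add: fe fu)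
qed

end

theorem theorem1p1:
  fixes n p n0 n1 m' :: nat
    and \<zeta> :: complex
    and K \<O> \<O>\<^sub>P :: "complex ring"
    and P :: "complex set"
    and G :: "('g, 'd) monoid_scheme"
  assumes "0 < n"
    and "primitive_root_of_unity n \<zeta>"
    and "K = rat_adjoin \<zeta>"
    and "\<O> = int_adjoin \<zeta>"
    and "primeideal P \<O>"
    and "P \<noteq> {0}"
    and "\<O>\<^sub>P = localization_in K (carrier \<O>) P"
    and "comm_group G"
    and "finite (carrier G)"
    and "Factorial_Ring.prime p"
    and "{of_nat p * of_int k | k :: int. True} = P \<inter> \<int>"
    and "n0 = Max {d. d dvd n \<and> \<not> p dvd d}"
    and "n1 = Max {d. d dvd group_exponent G \<and> \<not> p dvd d \<and> gcd d n0 = 1}"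
    and "m' = Max {d. d dvd lcm (group_exponent G) n0 div (n0 * n1) \<and> \<not> p dvd d}"
  shows "(clean_ring (group_ring \<O>\<^sub>P G) \<longleftrightarrow>
            ord n1 p = totient n1 \<and>
            ord (n0 * m') p = m' * ord n0 p \<and>
            gcd (ord n1 p) (ord (n0 * m') p) = 1) \<and>
         (group_exponent G dvd n \<longrightarrow> clean_ring (group_ring \<O>\<^sub>P G))"
proof -
  interpret G: comm_group G by fact
  interpret G: finite_abelian_group G by unfold_locales fact
  define N where "N = n0 * m' * n1"
  define L where "L = lcm n (group_exponent G)"
  define w where "w = cis (2 * pi / real L)"
  note decomp = lcm_decomposition[OF assms(1) G.group_exponent_pos assms(10,12,13,14)]
  obtain e where e: "n = p ^ e * n0" using decomp(1) by blast
  obtain k where k: "L = p ^ k * N" using decomp(2) unfolding L_def N_def by blast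
  have pN: "\<not> p dvd N" and cop: "coprime n1 (n0 * m')" and Npos: "0 < N"
    unfolding N_def by (fact decomp)+
  have cpN: "coprime p N" using assms(10) pN by (rule prime_imp_coprime)
  have Lpos: "0 < L" unfolding L_def using assms(1) G.group_exponent_pos by (rule lcm_pos_nat)
  have P: "prime_ideal_of (int_span \<zeta>) P"
    using assms(5) unfolding assms(4) int_adjoin_eq
    by (rule prime_ideal_of_primeideal) (rule unital_subring_int_span)
  have "of_nat p * of_int 1 \<in> P \<inter> \<int>" unfolding assms(11)[symmetric] by blast
  then have pP: "of_nat p \<in> P" by simp
  interpret R: cyclotomic_group_ring G n n0 N L p e k \<zeta> w P
  proof (intro cyclotomic_group_ring.intro cyclotomic_group_ring_axioms.intro cyclotomic_setting.intro)
    show "finite_abelian_group G" by (rule G.finite_abelian_group_axioms)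
    show "primitive_root_of_unity L w" unfolding w_def using Lpos by (rule primitive_root_of_unity_cis)
    show "n0 dvd N" by (simp add: N_def)
    show "n dvd L" by (simp add: L_def)
  qed (fact assms(2,10) e k pN P pP L_def)+
  have "\<O>\<^sub>P = localization_in (rat_adjoin \<zeta>) (int_span \<zeta>) P"
    by (simp add: assms(3,4,7) int_adjoin_eq)
  then have OP: "\<O>\<^sub>P = complex_subring R.A"
    unfolding R.A_def R.S_def by (simp only: localization_in_eq_fractions[OF R.P.zero_in])
  have clean: "clean_ring (group_ring \<O>\<^sub>P G) \<longleftrightarrow>
      (\<forall>a. coprime a N \<and> [a = 1] (mod n0) \<longrightarrow> (\<exists>i. [a = p ^ i] (mod N)))"
    unfolding OP using R.clean_imp_powers R.powers_imp_clean by blast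
  also have "\<dots> \<longleftrightarrow> ord n1 p = totient n1 \<and> ord (n0 * m') p = m' * ord n0 p \<and>
      gcd (ord n1 p) (ord (n0 * m') p) = 1"
    unfolding N_def using Npos[unfolded N_def] cop cpN[unfolded N_def] decomp(5)
    by (rule powers_fill_kernel_iff)
  finally have iff: "clean_ring (group_ring \<O>\<^sub>P G) \<longleftrightarrow> ord n1 p = totient n1 \<and>
      ord (n0 * m') p = m' * ord n0 p \<and> gcd (ord n1 p) (ord (n0 * m') p) = 1" .
  have "\<forall>a. coprime a N \<and> [a = 1] (mod n0) \<longrightarrow> (\<exists>i. [a = p ^ i] (mod N))"
    if "group_exponent G dvd n"
  proof -
    \<comment> \<open>Here \<open>L = n\<close>, so \<open>N\<close> divides \<open>n0\<close>, and
      the zeroth power of \<open>p\<close> already serves.\<close>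
    have "p ^ e * n0 = p ^ k * N" using that e k by (simp add: L_def lcm_proj1_if_dvd)
    then have "N dvd p ^ e * n0" by simp
    moreover have "coprime N (p ^ e)" using cpN by (simp add: coprime_commute)
    ultimately have "N dvd n0" by (simp add: coprime_dvd_mult_right_iff)
    then have "[a = p ^ 0] (mod N)" if "[a = 1] (mod n0)" for a
      using that by (simp add: cong_dvd_modulus_nat)
    then show ?thesis by blast
  qed
  then have "group_exponent G dvd n \<longrightarrow> clean_ring (group_ring \<O>\<^sub>P G)"
    using clean by simp
  with iff show ?thesis by (rule conjI)
qed

end
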